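(* Let $A$ be a type with $\Xi\vdash A:\mathtt{Prop}$, let $M$ be a well-kinded metaterm of $\lambda^{\mathsf F\omega}_{\mathfrak m}$ and let $\Gamma$ be an environment well-formed under $\Xi$. If $\mathrm{ver}_A(M^{\Gamma})\twoheadrightarrow\star$ and $M$ is good, then the $\beta$-normal form $M^{\downarrow}$ of $M$ is a term such that $\Xi;\Gamma\vdash M^{\downarrow}:A$.
   Context: Kinds: $K,J ::= \kappa \mid \mathtt{Prop} \mid K\to J$ ($\kappa$ ranging over base kinds). There are disjoint sets of type-variables $a,b,\dots$ and eigenvariables $\mathbf{a},\mathbf{b},\dots$. Types: $A,B ::= a \mid \mathbf{a} \mid \lambda a{:}K.A \mid A\,B \mid A\Rightarrow B \mid \forall a{:}K.A$. A kind-environment $\xi$ assigns kinds to finitely many type-variables/eigenvariables; kinding $\xi\vdash A:K$ is standard (variables get their assigned kind; abstraction and application as in simply typed $\lambda$-calculus; $A\Rightarrow B:\mathtt{Prop}$ if $A,B:\mathtt{Prop}$; $\forall a{:}K.A:\mathtt{Prop}$ if $A:\mathtt{Prop}$ under $\xi,a:K$). $=_\beta$ on types is the congruence generated by $(\lambda a{:}K.A)B\to_\beta A\{a:=B\}$. A fixed global kind-assignment $\Xi$ maps every type-variable and eigenvariable to a kind, with infinitely many of each kind; $\Xi\vdash A:K$ means $\xi\vdash A:K$ for some $\xi\subseteq\Xi$. Terms: $t ::= x \mid \lambda x.t \mid t\,s \mid \Lambda a{:}K.t \mid t\,A$. An environment $\Gamma$ (finite set of $x:A$, distinct variables) is well-formed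 under $\Xi$ if every $A$ in it satisfies $\xi\vdash A:\mathtt{Prop}$ for some $\xi\subseteq\Xi$. Typing $\xi;\Gamma\vdash t:A$: variable rule (for well-formed $\Gamma,x:A$); $\Rightarrow$-introduction and elimination as usual; from $\xi,a:K;\Gamma\vdash t:A$ with $a$ not free in $\Gamma$ infer $\xi;\Gamma\vdash\Lambda a{:}K.t:\forall a{:}K.A$; from $\xi;\Gamma\vdash t:\forall a{:}K.A$ and $\xi\vdash B:K$ infer $\xi;\Gamma\vdash t\,B:A\{a:=B\}$; conversion: from $\xi;\Gamma\vdash t:A$, $\xi\vdash A,B:\mathtt{Prop}$ and $A=_\beta B$ infer $\xi;\Gamma\vdash t:B$. $\Xi;\Gamma\vdash t:A$ means this holds for some $\xi\subseteq\Xi$. Pre-metaterms: $M,N ::= x \mid \lambda x.M \mid M\,N \mid \Lambda a{:}K.M \mid M\,A \mid \star \mid (M\triangleright N) \mid \mathrm{gen}_A \mid \mathrm{ver}_A(M) \mid \nu\mathbf{a}{:}K.M$. A pre-metaterm is well-kinded if in every $\mathrm{gen}_A$ and $\mathrm{ver}_A(\cdot)$ we have $\Xi\vdash A:\mathtt{Prop}$, in every $M\,A$ the type $A$ is well-kinded under $\Xi$, and binders $\Lambda a{:}K$, $\nu\mathbf{a}{:}K$ satisfy $\Xi(a)=K$, $\Xi(\mathbf{a})=K$. Metaterms are well-kinded pre-metaterms modulo $\beta$-conversion of the types occurring in them. A metaterm is pure if it uses only the first five productions (pure metaterms are identified with terms), and good if pure and $\beta$-normalizing, where $\beta$-reduction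 is $(\lambda x.M)N\to M\{x:=N\}$ and $(\Lambda a{:}K.M)A\to M\{a:=A\}$. Reduction $\to$ is the closure under arbitrary contexts of: (1) $(\lambda x.M)N\to M\{x:=N\}$; (2) $(\Lambda a{:}K.M)A\to M\{a:=A\}$ if $\Xi\vdash A:K$; (3) $(\star\triangleright M)\to M$; (4) $\mathrm{ver}_{\mathbf{a}A_1\cdots A_n}(\mathrm{gen}_{\mathbf{a}A_1\cdots A_n})\to\star$; (5) $\mathrm{ver}_{A\Rightarrow B}(M)\to\mathrm{ver}_B(M\,\mathrm{gen}_A)$; (6) $\mathrm{ver}_{\forall a{:}K.A}(M)\to\nu\mathbf{a}{:}K.\mathrm{ver}_{A\{a:=\mathbf{a}\}}(M\,\mathbf{a})$, $\mathbf{a}$ fresh; (7) $\mathrm{gen}_{A\Rightarrow B}\to\lambda x.(\mathrm{ver}_A(x)\triangleright\mathrm{gen}_B)$; (8) $\mathrm{gen}_{\forall a{:}K.A}\to\Lambda a{:}K.\mathrm{gen}_A$; (9) $\nu\mathbf{a}{:}K.M\to M$ if $\mathbf{a}$ not free in $M$. $\twoheadrightarrow$ is its reflexive-transitive closure. $M^{\Gamma}$ replaces each free occurrence of each variable $x$ with $x:A\in\Gamma$ by $\mathrm{gen}_A$. *)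

theory Defs
  imports Main
begin

text \<open>
  Syntax is taken up to renaming of bound variables, in locally nameless style: free variables
  are names, bound variables are indices.  There are three index spaces: \<open>BVar\<close> (bound by
  \<open>\<lambda>x\<close>), \<open>TBound\<close> (type-variables, bound by \<open>\<lambda>a:K\<close>, \<open>\<forall>a:K\<close> and \<open>\<Lambda>a:K\<close>) and \<open>EBound\<close>
  (eigenvariables, bound by \<open>\<nu>a:K\<close>).  A rule that goes below a binder opens the body with a fresh
  name; what is substituted for an index is always locally closed, so that nothing is shifted.
  Base kinds, type-variables, eigenvariables and term variables range over the types
  \<open>'k\<close>, \<open>'a\<close>, \<open>'e\<close> and \<open>'x\<close>.
\<close>

datatype 'k kind = KBase 'k | KProp | KFun "'k kind" "'k kind"

datatype ('k, 'a, 'e) ty =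
    TBound nat
  | EBound nat
  | TVar 'a
  | EVar 'e
  | TLam "'k kind" "('k, 'a, 'e) ty"
  | TApp "('k, 'a, 'e) ty" "('k, 'a, 'e) ty"
  | Imp "('k, 'a, 'e) ty" "('k, 'a, 'e) ty"
  | TAll "'k kind" "('k, 'a, 'e) ty"

primrec ty_open :: "nat \<Rightarrow> ('k, 'a, 'e) ty \<Rightarrow> ('k, 'a, 'e) ty \<Rightarrow> ('k, 'a, 'e) ty" where
  "ty_open i C (TBound j) = (if j = i then C else TBound j)"
| "ty_open i C (EBound j) = EBound j"
| "ty_open i C (TVar a) = TVar a"
| "ty_open i C (EVar e) = EVar e"
| "ty_open i C (TLam K A) = TLam K (ty_open (Suc i) C A)"
| "ty_open i C (TApp A B) = TApp (ty_open i C A) (ty_open i C B)"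
| "ty_open i C (Imp A B) = Imp (ty_open i C A) (ty_open i C B)"
| "ty_open i C (TAll K A) = TAll K (ty_open (Suc i) C A)"

primrec ty_eopen :: "nat \<Rightarrow> 'e \<Rightarrow> ('k, 'a, 'e) ty \<Rightarrow> ('k, 'a, 'e) ty" where
  "ty_eopen i d (TBound j) = TBound j"
| "ty_eopen i d (EBound j) = (if j = i then EVar d else EBound j)"
| "ty_eopen i d (TVar a) = TVar a"
| "ty_eopen i d (EVar e) = EVar e"
| "ty_eopen i d (TLam K A) = TLam K (ty_eopen i d A)"
| "ty_eopen i d (TApp A B) = TApp (ty_eopen i d A) (ty_eopen i d B)"
| "ty_eopen i d (Imp A B) = Imp (ty_eopen i d A) (ty_eopen i d B)"
| "ty_eopen i d (TAll K A) = TAll K (ty_eopen i d A)"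

primrec ty_ftv :: "('k, 'a, 'e) ty \<Rightarrow> 'a set" where
  "ty_ftv (TBound j) = {}"
| "ty_ftv (EBound j) = {}"
| "ty_ftv (TVar a) = {a}"
| "ty_ftv (EVar e) = {}"
| "ty_ftv (TLam K A) = ty_ftv A"
| "ty_ftv (TApp A B) = ty_ftv A \<union> ty_ftv B"
| "ty_ftv (Imp A B) = ty_ftv A \<union> ty_ftv B"
| "ty_ftv (TAll K A) = ty_ftv A"

primrec ty_fev :: "('k, 'a, 'e) ty \<Rightarrow> 'e set" where
  "ty_fev (TBound j) = {}"
| "ty_fev (EBound j) = {}"
| "ty_fev (TVar a) = {}"
| "ty_fev (EVar e) = {e}"
| "ty_fev (TLam K A) = ty_fev A"
| "ty_fev (TApp A B) = ty_fev A \<union> ty_fev B"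
| "ty_fev (Imp A B) = ty_fev A \<union> ty_fev B"
| "ty_fev (TAll K A) = ty_fev A"

text \<open>\<open>ty_lc 0 A\<close>: no dangling index in \<open>A\<close>.\<close>

primrec ty_lc :: "nat \<Rightarrow> ('k, 'a, 'e) ty \<Rightarrow> bool" where
  "ty_lc n (TBound j) \<longleftrightarrow> j < n"
| "ty_lc n (EBound j) \<longleftrightarrow> False"
| "ty_lc n (TVar a) \<longleftrightarrow> True"
| "ty_lc n (EVar e) \<longleftrightarrow> True"
| "ty_lc n (TLam K A) \<longleftrightarrow> ty_lc (Suc n) A"
| "ty_lc n (TApp A B) \<longleftrightarrow> ty_lc n A \<and> ty_lc n B"
| "ty_lc n (Imp A B) \<longleftrightarrow> ty_lc n A \<and> ty_lc n B"
| "ty_lc n (TAll K A) \<longleftrightarrow> ty_lc (Suc n) A"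

text \<open>
  The premises on local closure are needed because opening does not shift: contracting a redex
  with a dangling argument would capture it, and (through symmetry) could relate closed types.
\<close>

inductive ty_eq :: "('k, 'a, 'e) ty \<Rightarrow> ('k, 'a, 'e) ty \<Rightarrow> bool" where
  refl: "ty_lc 0 A \<Longrightarrow> ty_eq A A"
| sym: "ty_eq A B \<Longrightarrow> ty_eq B A"
| trans: "ty_eq A B \<Longrightarrow> ty_eq B C \<Longrightarrow> ty_eq A C"
| beta: "ty_lc 0 (TLam K A) \<Longrightarrow> ty_lc 0 B \<Longrightarrow> ty_eq (TApp (TLam K A) B) (ty_open 0 B A)"
| TLam: "a \<notin> ty_ftv A \<Longrightarrow> a \<notin> ty_ftv A' \<Longrightarrow>
    ty_eq (ty_open 0 (TVar a) A) (ty_open 0 (TVar a) A') \<Longrightarrow> ty_eq (TLam K A) (TLam K A')"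
| TApp: "ty_eq A A' \<Longrightarrow> ty_eq B B' \<Longrightarrow> ty_eq (TApp A B) (TApp A' B')"
| Imp: "ty_eq A A' \<Longrightarrow> ty_eq B B' \<Longrightarrow> ty_eq (Imp A B) (Imp A' B')"
| TAll: "a \<notin> ty_ftv A \<Longrightarrow> a \<notin> ty_ftv A' \<Longrightarrow>
    ty_eq (ty_open 0 (TVar a) A) (ty_open 0 (TVar a) A') \<Longrightarrow> ty_eq (TAll K A) (TAll K A')"

text \<open>
  The names in the domain of a kind-environment \<open>\<xi>\<close> are type-variables (\<open>Inl\<close>) and eigenvariables
  (\<open>Inr\<close>); likewise for the global kind-assignment \<open>\<Xi>\<close>.
\<close>

inductive kinding :: "('a + 'e \<rightharpoonup> 'k kind) \<Rightarrow> ('k, 'a, 'e) ty \<Rightarrow> 'k kind \<Rightarrow> bool" where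
  TVar: "\<xi> (Inl a) = Some K \<Longrightarrow> kinding \<xi> (TVar a) K"
| EVar: "\<xi> (Inr e) = Some K \<Longrightarrow> kinding \<xi> (EVar e) K"
| TLam: "Inl a \<notin> dom \<xi> \<Longrightarrow> a \<notin> ty_ftv A \<Longrightarrow>
    kinding (\<xi>(Inl a \<mapsto> K)) (ty_open 0 (TVar a) A) J \<Longrightarrow> kinding \<xi> (TLam K A) (KFun K J)"
| TApp: "kinding \<xi> A (KFun K J) \<Longrightarrow> kinding \<xi> B K \<Longrightarrow> kinding \<xi> (TApp A B) J"
| Imp: "kinding \<xi> A KProp \<Longrightarrow> kinding \<xi> B KProp \<Longrightarrow> kinding \<xi> (Imp A B) KProp"
| TAll: "Inl a \<notin> dom \<xi> \<Longrightarrow> a \<notin> ty_ftv A \<Longrightarrow>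
    kinding (\<xi>(Inl a \<mapsto> K)) (ty_open 0 (TVar a) A) KProp \<Longrightarrow> kinding \<xi> (TAll K A) KProp"

definition kind_assignment :: "('a + 'e \<Rightarrow> 'k kind) \<Rightarrow> bool" where
  "kind_assignment \<Xi> \<longleftrightarrow>
     (\<forall>K. infinite {a. \<Xi> (Inl a) = K} \<and> infinite {e. \<Xi> (Inr e) = K})"

text \<open>\<open>sub_kenv \<xi> \<Xi>\<close>: \<open>\<xi>\<close> is a (finite) kind-environment with \<open>\<xi> \<subseteq> \<Xi>\<close>.\<close>

definition sub_kenv :: "('a + 'e \<rightharpoonup> 'k kind) \<Rightarrow> ('a + 'e \<Rightarrow> 'k kind) \<Rightarrow> bool" where
  "sub_kenv \<xi> \<Xi> \<longleftrightarrow> finite (dom \<xi>) \<and> (\<forall>v K. \<xi> v = Some K \<longrightarrow> \<Xi> v = K)"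

definition gkinding :: "('a + 'e \<Rightarrow> 'k kind) \<Rightarrow> ('k, 'a, 'e) ty \<Rightarrow> 'k kind \<Rightarrow> bool" where
  "gkinding \<Xi> A K \<longleftrightarrow> (\<exists>\<xi>. sub_kenv \<xi> \<Xi> \<and> kinding \<xi> A K)"


text \<open>Pre-metaterms. The pure ones among them are the terms.\<close>

datatype ('k, 'a, 'e, 'x) mterm =
    BVar nat
  | Var 'x
  | Lam "('k, 'a, 'e, 'x) mterm"
  | App "('k, 'a, 'e, 'x) mterm" "('k, 'a, 'e, 'x) mterm"
  | LamT "'k kind" "('k, 'a, 'e, 'x) mterm"
  | AppT "('k, 'a, 'e, 'x) mterm" "('k, 'a, 'e) ty"
  | Star
  | Guard "('k, 'a, 'e, 'x) mterm" "('k, 'a, 'e, 'x) mterm"  \<comment> \<open>\<open>M \<triangleright> N\<close>\<close>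
  | Gen "('k, 'a, 'e) ty"
  | Ver "('k, 'a, 'e) ty" "('k, 'a, 'e, 'x) mterm"
  | Nu "'k kind" "('k, 'a, 'e, 'x) mterm"

primrec pure :: "('k, 'a, 'e, 'x) mterm \<Rightarrow> bool" where
  "pure (BVar j) \<longleftrightarrow> True"
| "pure (Var x) \<longleftrightarrow> True"
| "pure (Lam M) \<longleftrightarrow> pure M"
| "pure (App M N) \<longleftrightarrow> pure M \<and> pure N"
| "pure (LamT K M) \<longleftrightarrow> pure M"
| "pure (AppT M A) \<longleftrightarrow> pure M"
| "pure Star \<longleftrightarrow> False"
| "pure (Guard M N) \<longleftrightarrow> False"
| "pure (Gen A) \<longleftrightarrow> False"
| "pure (Ver A M) \<longleftrightarrow> False"
| "pure (Nu K M) \<longleftrightarrow> False"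

primrec m_open :: "nat \<Rightarrow> ('k, 'a, 'e, 'x) mterm \<Rightarrow> ('k, 'a, 'e, 'x) mterm
    \<Rightarrow> ('k, 'a, 'e, 'x) mterm" where
  "m_open i P (BVar j) = (if j = i then P else BVar j)"
| "m_open i P (Var x) = Var x"
| "m_open i P (Lam M) = Lam (m_open (Suc i) P M)"
| "m_open i P (App M N) = App (m_open i P M) (m_open i P N)"
| "m_open i P (LamT K M) = LamT K (m_open i P M)"
| "m_open i P (AppT M A) = AppT (m_open i P M) A"
| "m_open i P Star = Star"
| "m_open i P (Guard M N) = Guard (m_open i P M) (m_open i P N)"
| "m_open i P (Gen A) = Gen A"
| "m_open i P (Ver A M) = Ver A (m_open i P M)"
| "m_open i P (Nu K M) = Nu K (m_open i P M)"

primrec m_topen :: "nat \<Rightarrow> ('k, 'a, 'e) ty \<Rightarrow> ('k, 'a, 'e, 'x) mterm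
    \<Rightarrow> ('k, 'a, 'e, 'x) mterm" where
  "m_topen i C (BVar j) = BVar j"
| "m_topen i C (Var x) = Var x"
| "m_topen i C (Lam M) = Lam (m_topen i C M)"
| "m_topen i C (App M N) = App (m_topen i C M) (m_topen i C N)"
| "m_topen i C (LamT K M) = LamT K (m_topen (Suc i) C M)"
| "m_topen i C (AppT M A) = AppT (m_topen i C M) (ty_open i C A)"
| "m_topen i C Star = Star"
| "m_topen i C (Guard M N) = Guard (m_topen i C M) (m_topen i C N)"
| "m_topen i C (Gen A) = Gen (ty_open i C A)"
| "m_topen i C (Ver A M) = Ver (ty_open i C A) (m_topen i C M)"
| "m_topen i C (Nu K M) = Nu K (m_topen i C M)"

primrec m_eopen :: "nat \<Rightarrow> 'e \<Rightarrow> ('k, 'a, 'e, 'x) mterm \<Rightarrow> ('k, 'a, 'e, 'x) mterm" where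
  "m_eopen i d (BVar j) = BVar j"
| "m_eopen i d (Var x) = Var x"
| "m_eopen i d (Lam M) = Lam (m_eopen i d M)"
| "m_eopen i d (App M N) = App (m_eopen i d M) (m_eopen i d N)"
| "m_eopen i d (LamT K M) = LamT K (m_eopen i d M)"
| "m_eopen i d (AppT M A) = AppT (m_eopen i d M) (ty_eopen i d A)"
| "m_eopen i d Star = Star"
| "m_eopen i d (Guard M N) = Guard (m_eopen i d M) (m_eopen i d N)"
| "m_eopen i d (Gen A) = Gen (ty_eopen i d A)"
| "m_eopen i d (Ver A M) = Ver (ty_eopen i d A) (m_eopen i d M)"
| "m_eopen i d (Nu K M) = Nu K (m_eopen (Suc i) d M)"

primrec m_fv :: "('k, 'a, 'e, 'x) mterm \<Rightarrow> 'x set" where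
  "m_fv (BVar j) = {}"
| "m_fv (Var x) = {x}"
| "m_fv (Lam M) = m_fv M"
| "m_fv (App M N) = m_fv M \<union> m_fv N"
| "m_fv (LamT K M) = m_fv M"
| "m_fv (AppT M A) = m_fv M"
| "m_fv Star = {}"
| "m_fv (Guard M N) = m_fv M \<union> m_fv N"
| "m_fv (Gen A) = {}"
| "m_fv (Ver A M) = m_fv M"
| "m_fv (Nu K M) = m_fv M"

primrec m_ftv :: "('k, 'a, 'e, 'x) mterm \<Rightarrow> 'a set" where
  "m_ftv (BVar j) = {}"
| "m_ftv (Var x) = {}"
| "m_ftv (Lam M) = m_ftv M"
| "m_ftv (App M N) = m_ftv M \<union> m_ftv N"
| "m_ftv (LamT K M) = m_ftv M"
| "m_ftv (AppT M A) = m_ftv M \<union> ty_ftv A"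
| "m_ftv Star = {}"
| "m_ftv (Guard M N) = m_ftv M \<union> m_ftv N"
| "m_ftv (Gen A) = ty_ftv A"
| "m_ftv (Ver A M) = ty_ftv A \<union> m_ftv M"
| "m_ftv (Nu K M) = m_ftv M"

primrec m_fev :: "('k, 'a, 'e, 'x) mterm \<Rightarrow> 'e set" where
  "m_fev (BVar j) = {}"
| "m_fev (Var x) = {}"
| "m_fev (Lam M) = m_fev M"
| "m_fev (App M N) = m_fev M \<union> m_fev N"
| "m_fev (LamT K M) = m_fev M"
| "m_fev (AppT M A) = m_fev M \<union> ty_fev A"
| "m_fev Star = {}"
| "m_fev (Guard M N) = m_fev M \<union> m_fev N"
| "m_fev (Gen A) = ty_fev A"
| "m_fev (Ver A M) = ty_fev A \<union> m_fev M"
| "m_fev (Nu K M) = m_fev M"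

text \<open>Well-kinded pre-metaterms (these are locally closed).\<close>

inductive wk :: "('a + 'e \<Rightarrow> 'k kind) \<Rightarrow> ('k, 'a, 'e, 'x) mterm \<Rightarrow> bool" for \<Xi> where
  Var: "wk \<Xi> (Var x)"
| Lam: "x \<notin> m_fv M \<Longrightarrow> wk \<Xi> (m_open 0 (Var x) M) \<Longrightarrow> wk \<Xi> (Lam M)"
| App: "wk \<Xi> M \<Longrightarrow> wk \<Xi> N \<Longrightarrow> wk \<Xi> (App M N)"
| LamT: "a \<notin> m_ftv M \<Longrightarrow> \<Xi> (Inl a) = K \<Longrightarrow> wk \<Xi> (m_topen 0 (TVar a) M) \<Longrightarrow> wk \<Xi> (LamT K M)"
| AppT: "wk \<Xi> M \<Longrightarrow> gkinding \<Xi> A K \<Longrightarrow> wk \<Xi> (AppT M A)"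
| Star: "wk \<Xi> Star"
| Guard: "wk \<Xi> M \<Longrightarrow> wk \<Xi> N \<Longrightarrow> wk \<Xi> (Guard M N)"
| Gen: "gkinding \<Xi> A KProp \<Longrightarrow> wk \<Xi> (Gen A)"
| Ver: "gkinding \<Xi> A KProp \<Longrightarrow> wk \<Xi> M \<Longrightarrow> wk \<Xi> (Ver A M)"
| Nu: "e \<notin> m_fev M \<Longrightarrow> \<Xi> (Inr e) = K \<Longrightarrow> wk \<Xi> (m_eopen 0 e M) \<Longrightarrow> wk \<Xi> (Nu K M)"

text \<open>Conversion of the types occurring in a pre-metaterm.\<close>

inductive m_conv :: "('k, 'a, 'e, 'x) mterm \<Rightarrow> ('k, 'a, 'e, 'x) mterm \<Rightarrow> bool" where
  Var: "m_conv (Var x) (Var x)"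
| Lam: "x \<notin> m_fv M \<Longrightarrow> x \<notin> m_fv M' \<Longrightarrow>
    m_conv (m_open 0 (Var x) M) (m_open 0 (Var x) M') \<Longrightarrow> m_conv (Lam M) (Lam M')"
| App: "m_conv M M' \<Longrightarrow> m_conv N N' \<Longrightarrow> m_conv (App M N) (App M' N')"
| LamT: "a \<notin> m_ftv M \<Longrightarrow> a \<notin> m_ftv M' \<Longrightarrow>
    m_conv (m_topen 0 (TVar a) M) (m_topen 0 (TVar a) M') \<Longrightarrow> m_conv (LamT K M) (LamT K M')"
| AppT: "m_conv M M' \<Longrightarrow> ty_eq A A' \<Longrightarrow> m_conv (AppT M A) (AppT M' A')"
| Star: "m_conv Star Star"
| Guard: "m_conv M M' \<Longrightarrow> m_conv N N' \<Longrightarrow> m_conv (Guard M N) (Guard M' N')"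
| Gen: "ty_eq A A' \<Longrightarrow> m_conv (Gen A) (Gen A')"
| Ver: "ty_eq A A' \<Longrightarrow> m_conv M M' \<Longrightarrow> m_conv (Ver A M) (Ver A' M')"
| Nu: "e \<notin> m_fev M \<Longrightarrow> e \<notin> m_fev M' \<Longrightarrow>
    m_conv (m_eopen 0 e M) (m_eopen 0 e M') \<Longrightarrow> m_conv (Nu K M) (Nu K M')"

text \<open>
  Metaterms are the equivalence classes of \<open>meta_eq \<Xi>\<close> on well-kinded pre-metaterms. They are
  handled through representatives, and reduction is taken modulo \<open>meta_eq \<Xi>\<close>.
\<close>

definition meta_eq :: "('a + 'e \<Rightarrow> 'k kind) \<Rightarrow> ('k, 'a, 'e, 'x) mterm
    \<Rightarrow> ('k, 'a, 'e, 'x) mterm \<Rightarrow> bool" where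
  "meta_eq \<Xi> M N \<longleftrightarrow> wk \<Xi> M \<and> wk \<Xi> N \<and> m_conv M N"

text \<open>
  Closure of \<open>R\<close> under arbitrary contexts. The bound names are given the kinds prescribed by \<open>\<Xi>\<close>,
  as \<open>R\<close> may refer to them.
\<close>

inductive ctxt_closure :: "('a + 'e \<Rightarrow> 'k kind)
    \<Rightarrow> (('k, 'a, 'e, 'x) mterm \<Rightarrow> ('k, 'a, 'e, 'x) mterm \<Rightarrow> bool)
    \<Rightarrow> ('k, 'a, 'e, 'x) mterm \<Rightarrow> ('k, 'a, 'e, 'x) mterm \<Rightarrow> bool"
  for \<Xi> and R where
  base: "R M N \<Longrightarrow> ctxt_closure \<Xi> R M N"
| Lam: "x \<notin> m_fv M \<Longrightarrow> x \<notin> m_fv M' \<Longrightarrow>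
    ctxt_closure \<Xi> R (m_open 0 (Var x) M) (m_open 0 (Var x) M') \<Longrightarrow>
    ctxt_closure \<Xi> R (Lam M) (Lam M')"
| AppL: "ctxt_closure \<Xi> R M M' \<Longrightarrow> ctxt_closure \<Xi> R (App M N) (App M' N)"
| AppR: "ctxt_closure \<Xi> R N N' \<Longrightarrow> ctxt_closure \<Xi> R (App M N) (App M N')"
| LamT: "a \<notin> m_ftv M \<Longrightarrow> a \<notin> m_ftv M' \<Longrightarrow> \<Xi> (Inl a) = K \<Longrightarrow>
    ctxt_closure \<Xi> R (m_topen 0 (TVar a) M) (m_topen 0 (TVar a) M') \<Longrightarrow>
    ctxt_closure \<Xi> R (LamT K M) (LamT K M')"
| AppT: "ctxt_closure \<Xi> R M M' \<Longrightarrow> ctxt_closure \<Xi> R (AppT M A) (AppT M' A)"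
| GuardL: "ctxt_closure \<Xi> R M M' \<Longrightarrow> ctxt_closure \<Xi> R (Guard M N) (Guard M' N)"
| GuardR: "ctxt_closure \<Xi> R N N' \<Longrightarrow> ctxt_closure \<Xi> R (Guard M N) (Guard M N')"
| Ver: "ctxt_closure \<Xi> R M M' \<Longrightarrow> ctxt_closure \<Xi> R (Ver A M) (Ver A M')"
| Nu: "e \<notin> m_fev M \<Longrightarrow> e \<notin> m_fev M' \<Longrightarrow> \<Xi> (Inr e) = K \<Longrightarrow>
    ctxt_closure \<Xi> R (m_eopen 0 e M) (m_eopen 0 e M') \<Longrightarrow>
    ctxt_closure \<Xi> R (Nu K M) (Nu K M')"

text \<open>
  In rule \<open>ver_All\<close> the eigenvariable is the index \<open>0\<close> of the new binder; \<open>M\<close> is locally closed in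
  all uses, hence the eigenvariable is fresh for it. In rule \<open>nu\<close> the side condition says that the
  bound eigenvariable, named \<open>e\<close>, does not occur in the body.
\<close>

inductive root_red :: "('a + 'e \<Rightarrow> 'k kind) \<Rightarrow> ('k, 'a, 'e, 'x) mterm
    \<Rightarrow> ('k, 'a, 'e, 'x) mterm \<Rightarrow> bool" for \<Xi> where
  beta: "root_red \<Xi> (App (Lam M) N) (m_open 0 N M)"
| tbeta: "gkinding \<Xi> A K \<Longrightarrow> root_red \<Xi> (AppT (LamT K M) A) (m_topen 0 A M)"
| guard: "root_red \<Xi> (Guard Star M) M"
| ver_gen: "A = foldl TApp (EVar e) As \<Longrightarrow> root_red \<Xi> (Ver A (Gen A)) Star"
| ver_Imp: "root_red \<Xi> (Ver (Imp A B) M) (Ver B (App M (Gen A)))"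
| ver_All: "root_red \<Xi> (Ver (TAll K A) M)
    (Nu K (Ver (ty_open 0 (EBound 0) A) (AppT M (EBound 0))))"
| gen_Imp: "root_red \<Xi> (Gen (Imp A B)) (Lam (Guard (Ver A (BVar 0)) (Gen B)))"
| gen_All: "root_red \<Xi> (Gen (TAll K A)) (LamT K (Gen A))"
| nu: "e \<notin> m_fev (m_eopen 0 e M) \<Longrightarrow> root_red \<Xi> (Nu K M) (m_eopen 0 e M)"

definition red :: "('a + 'e \<Rightarrow> 'k kind) \<Rightarrow> ('k, 'a, 'e, 'x) mterm
    \<Rightarrow> ('k, 'a, 'e, 'x) mterm \<Rightarrow> bool" where
  "red \<Xi> M N \<longleftrightarrow>
     (\<exists>M' N'. meta_eq \<Xi> M M' \<and> ctxt_closure \<Xi> (root_red \<Xi>) M' N' \<and> meta_eq \<Xi> N' N)"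

definition reds :: "('a + 'e \<Rightarrow> 'k kind) \<Rightarrow> ('k, 'a, 'e, 'x) mterm
    \<Rightarrow> ('k, 'a, 'e, 'x) mterm \<Rightarrow> bool" where
  "reds \<Xi> M N \<longleftrightarrow> (\<exists>N'. (red \<Xi>)\<^sup>*\<^sup>* M N' \<and> meta_eq \<Xi> N' N)"

inductive root_beta :: "('k, 'a, 'e, 'x) mterm \<Rightarrow> ('k, 'a, 'e, 'x) mterm \<Rightarrow> bool" where
  beta: "root_beta (App (Lam M) N) (m_open 0 N M)"
| tbeta: "root_beta (AppT (LamT K M) A) (m_topen 0 A M)"

text \<open>
  A \<open>\<beta>\<close>-step does not look at the types in a metaterm, so type conversion can be postponed to the
  end of a \<open>\<beta>\<close>-reduction sequence. As \<open>root_beta\<close> has no kinding condition, a \<open>\<beta>\<close>-reduct may fail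
  to be well-kinded and thus be outside the domain of \<open>meta_eq \<Xi>\<close>; it is then its own only
  representative, hence the disjunct \<open>N' = N\<close>.
\<close>

definition beta_nf_of :: "('a + 'e \<Rightarrow> 'k kind) \<Rightarrow> ('k, 'a, 'e, 'x) mterm
    \<Rightarrow> ('k, 'a, 'e, 'x) mterm \<Rightarrow> bool" where
  "beta_nf_of \<Xi> M N \<longleftrightarrow>
     (\<exists>N'. (ctxt_closure \<Xi> root_beta)\<^sup>*\<^sup>* M N' \<and>
           (\<nexists>P. ctxt_closure \<Xi> root_beta N' P) \<and> (N' = N \<or> meta_eq \<Xi> N' N))"

definition good :: "('a + 'e \<Rightarrow> 'k kind) \<Rightarrow> ('k, 'a, 'e, 'x) mterm \<Rightarrow> bool" where
  "good \<Xi> M \<longleftrightarrow> pure M \<and> (\<exists>N. beta_nf_of \<Xi> M N)"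


definition wf_env :: "('a + 'e \<rightharpoonup> 'k kind) \<Rightarrow> ('x \<rightharpoonup> ('k, 'a, 'e) ty) \<Rightarrow> bool" where
  "wf_env \<xi> \<Gamma> \<longleftrightarrow> finite (dom \<Gamma>) \<and> (\<forall>x A. \<Gamma> x = Some A \<longrightarrow> kinding \<xi> A KProp)"

definition gwf_env :: "('a + 'e \<Rightarrow> 'k kind) \<Rightarrow> ('x \<rightharpoonup> ('k, 'a, 'e) ty) \<Rightarrow> bool" where
  "gwf_env \<Xi> \<Gamma> \<longleftrightarrow> finite (dom \<Gamma>) \<and> (\<forall>x A. \<Gamma> x = Some A \<longrightarrow> gkinding \<Xi> A KProp)"

inductive typing :: "('a + 'e \<rightharpoonup> 'k kind) \<Rightarrow> ('x \<rightharpoonup> ('k, 'a, 'e) ty)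
    \<Rightarrow> ('k, 'a, 'e, 'x) mterm \<Rightarrow> ('k, 'a, 'e) ty \<Rightarrow> bool" where
  Var: "wf_env \<xi> \<Gamma> \<Longrightarrow> \<Gamma> x = Some A \<Longrightarrow> typing \<xi> \<Gamma> (Var x) A"
| Lam: "x \<notin> dom \<Gamma> \<Longrightarrow> x \<notin> m_fv t \<Longrightarrow>
    typing \<xi> (\<Gamma>(x \<mapsto> A)) (m_open 0 (Var x) t) B \<Longrightarrow> typing \<xi> \<Gamma> (Lam t) (Imp A B)"
| App: "typing \<xi> \<Gamma> t (Imp A B) \<Longrightarrow> typing \<xi> \<Gamma> s A \<Longrightarrow> typing \<xi> \<Gamma> (App t s) B"
| LamT: "Inl a \<notin> dom \<xi> \<Longrightarrow> a \<notin> m_ftv t \<Longrightarrow> a \<notin> ty_ftv A \<Longrightarrow>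
    (\<And>x B. \<Gamma> x = Some B \<Longrightarrow> a \<notin> ty_ftv B) \<Longrightarrow>
    typing (\<xi>(Inl a \<mapsto> K)) \<Gamma> (m_topen 0 (TVar a) t) (ty_open 0 (TVar a) A) \<Longrightarrow>
    typing \<xi> \<Gamma> (LamT K t) (TAll K A)"
| AppT: "typing \<xi> \<Gamma> t (TAll K A) \<Longrightarrow> kinding \<xi> B K \<Longrightarrow>
    typing \<xi> \<Gamma> (AppT t B) (ty_open 0 B A)"
| conv: "typing \<xi> \<Gamma> t A \<Longrightarrow> kinding \<xi> A KProp \<Longrightarrow> kinding \<xi> B KProp \<Longrightarrow> ty_eq A B \<Longrightarrow>
    typing \<xi> \<Gamma> t B"

definition gtyping :: "('a + 'e \<Rightarrow> 'k kind) \<Rightarrow> ('x \<rightharpoonup> ('k, 'a, 'e) ty)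
    \<Rightarrow> ('k, 'a, 'e, 'x) mterm \<Rightarrow> ('k, 'a, 'e) ty \<Rightarrow> bool" where
  "gtyping \<Xi> \<Gamma> t A \<longleftrightarrow> (\<exists>\<xi>. sub_kenv \<xi> \<Xi> \<and> typing \<xi> \<Gamma> t A)"

text \<open>\<open>env_subst \<Gamma> M\<close> is \<open>M\<^sup>\<Gamma>\<close>.\<close>

primrec env_subst :: "('x \<rightharpoonup> ('k, 'a, 'e) ty) \<Rightarrow> ('k, 'a, 'e, 'x) mterm
    \<Rightarrow> ('k, 'a, 'e, 'x) mterm" where
  "env_subst \<Gamma> (BVar j) = BVar j"
| "env_subst \<Gamma> (Var x) = (case \<Gamma> x of None \<Rightarrow> Var x | Some A \<Rightarrow> Gen A)"
| "env_subst \<Gamma> (Lam M) = Lam (env_subst \<Gamma> M)"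
| "env_subst \<Gamma> (App M N) = App (env_subst \<Gamma> M) (env_subst \<Gamma> N)"
| "env_subst \<Gamma> (LamT K M) = LamT K (env_subst \<Gamma> M)"
| "env_subst \<Gamma> (AppT M A) = AppT (env_subst \<Gamma> M) A"
| "env_subst \<Gamma> Star = Star"
| "env_subst \<Gamma> (Guard M N) = Guard (env_subst \<Gamma> M) (env_subst \<Gamma> N)"
| "env_subst \<Gamma> (Gen A) = Gen A"
| "env_subst \<Gamma> (Ver A M) = Ver A (env_subst \<Gamma> M)"
| "env_subst \<Gamma> (Nu K M) = Nu K (env_subst \<Gamma> M)"

end

theory Submission
  imports Defs "HOL-Library.Countable_Set_Type"
begin

text \<open>
  Metaterms get a denotation in a filter model: the set of their points, which are infinitary
  intersection types. If \<open>M \<rightarrow> N\<close>, then every point of \<open>N\<close> is one of \<open>M\<close> (for \<open>\<beta>\<close>-redexes because the model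
  is continuous with respect to countable sets), and if \<open>M \<rightarrow>\<^sub>\<beta> N\<close>, then every point of \<open>M\<close> is one of \<open>N\<close>.
  Hence \<open>ver\<^sub>A(M\<^sup>\<Gamma>) \<rightarrow>* \<star>\<close> implies that the verification of \<open>A\<close> succeeds in the model on the \<open>\<beta>\<close>-normal form
  of \<open>M\<close>, and no confluence or standardization result for metaterms is needed. By induction on this
  normal form, a successful verification is a typing derivation: under \<open>\<lambda>\<close> and \<open>\<Lambda>\<close> the verifier supplies
  \<open>gen\<close> and a fresh eigenvariable, a neutral term \<open>x N\<^sub>1 \<dots> N\<^sub>k\<close> denotes points of \<open>gen\<^sub>D\<close> where \<open>D\<close> is its
  inferred type, and \<open>ver\<^sub>A\<close> accepts points of \<open>gen\<^sub>D\<close> only if \<open>A =\<^sub>\<beta> D\<close>.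
\<close>

subsection \<open>Substitution in types\<close>

text \<open>Impredicativity rules out defining the points of \<open>gen\<close> and the tests of
  \<open>ver\<close> by recursion on the type: instantiating a quantifier may enlarge the type.
  \<open>G\<close> and \<open>V\<close> are therefore a mutual least fixed point, and their
  properties are proved by induction on derivations. A fresh eigenvariable has no canonical name in
  the model, so \<nu> means all but finitely many members of a sample; any finite set of names can
  then be avoided afterwards. The price is that one test may consult infinitely many points. Finite
  intersections would then be too small for \<beta>-expansion; countable ones are large enough once
  the sample is countable. Types are compared through a common reduct rather than through
  \<open>ty_eq\<close>, because inverting an equation between two implications or two quantified
  types needs confluence. Types are treated with indices and simultaneous substitution; fresh names
  occur only where the given rules demand them.\<close>

text \<open>Both index spaces and both sorts of names, so that opening, renaming and valuating a type are
  instances of one simultaneous substitution \<open>ty_sub\<close>.\<close>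

datatype ('a, 'e) leaf = LB nat | LE nat | LV 'a | LX 'e

fun leaf_ty :: "('a, 'e) leaf \<Rightarrow> ('k, 'a, 'e) ty" where
  "leaf_ty (LB n) = TBound n"
| "leaf_ty (LE n) = EBound n"
| "leaf_ty (LV a) = TVar a"
| "leaf_ty (LX e) = EVar e"

fun push :: "'v \<Rightarrow> (('a, 'e) leaf \<Rightarrow> 'v) \<Rightarrow> ('a, 'e) leaf \<Rightarrow> 'v" where
  "push v f (LB 0) = v"
| "push v f (LB (Suc n)) = f (LB n)"
| "push v f (LE n) = f (LE n)"
| "push v f (LV a) = f (LV a)"
| "push v f (LX e) = f (LX e)"

fun epush :: "'v \<Rightarrow> (('a, 'e) leaf \<Rightarrow> 'v) \<Rightarrow> ('a, 'e) leaf \<Rightarrow> 'v" where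
  "epush v f (LE 0) = v"
| "epush v f (LE (Suc n)) = f (LE n)"
| "epush v f (LB n) = f (LB n)"
| "epush v f (LV a) = f (LV a)"
| "epush v f (LX e) = f (LX e)"

lemma leaf_ext:
  assumes "\<And>n. f (LB n) = g (LB n)" "\<And>n. f (LE n) = g (LE n)"
    "\<And>a. f (LV a) = g (LV a)" "\<And>e. f (LX e) = g (LX e)"
  shows "f = g"
proof
  fix l show "f l = g l" using assms by (cases l) auto
qed

lemma leaf_cases [case_names LB0 LBS LE0 LES LV LX]:
  obtains "l = LB 0" | n where "l = LB (Suc n)" | "l = LE 0" | n where "l = LE (Suc n)"
    | a where "l = LV a" | e where "l = LX e"
proof (cases l)
  case (LB n) with that show ?thesis by (cases n) auto
next
  case (LE n) with that show ?thesis by (cases n) auto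
qed (use that in auto)

lemma push_eqI:
  assumes "g (LB 0) = v" "\<And>n. g (LB (Suc n)) = f (LB n)" "\<And>n. g (LE n) = f (LE n)"
    "\<And>a. g (LV a) = f (LV a)" "\<And>e. g (LX e) = f (LX e)"
  shows "g = push v f"
proof
  fix l show "g l = push v f l" using assms by (cases l rule: leaf_cases) simp_all
qed

lemma epush_eqI:
  assumes "g (LE 0) = v" "\<And>n. g (LE (Suc n)) = f (LE n)" "\<And>n. g (LB n) = f (LB n)"
    "\<And>a. g (LV a) = f (LV a)" "\<And>e. g (LX e) = f (LX e)"
  shows "g = epush v f"
proof
  fix l show "g l = epush v f l" using assms by (cases l rule: leaf_cases) simp_all
qed

lemma comp_push: "(\<lambda>l. h (push v f l)) = push (h v) (\<lambda>l. h (f l))"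
  by (rule push_eqI) auto

text \<open>Renaming precedes substitution because \<open>up\<close> needs a shift.
  \<open>EBound\<close> indices stay as they are, since no type constructor binds them.\<close>

primrec ty_ren :: "(nat \<Rightarrow> nat) \<Rightarrow> ('k, 'a, 'e) ty \<Rightarrow> ('k, 'a, 'e) ty" where
  "ty_ren r (TBound j) = TBound (r j)"
| "ty_ren r (EBound j) = EBound j"
| "ty_ren r (TVar a) = TVar a"
| "ty_ren r (EVar e) = EVar e"
| "ty_ren r (TLam K A) = TLam K (ty_ren (case_nat 0 (\<lambda>n. Suc (r n))) A)"
| "ty_ren r (TApp A B) = TApp (ty_ren r A) (ty_ren r B)"
| "ty_ren r (Imp A B) = Imp (ty_ren r A) (ty_ren r B)"
| "ty_ren r (TAll K A) = TAll K (ty_ren (case_nat 0 (\<lambda>n. Suc (r n))) A)"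

definition up :: "(('a, 'e) leaf \<Rightarrow> ('k, 'a, 'e) ty) \<Rightarrow> ('a, 'e) leaf \<Rightarrow> ('k, 'a, 'e) ty" where
  "up \<sigma> = push (TBound 0) (\<lambda>l. ty_ren Suc (\<sigma> l))"

primrec ty_sub :: "(('a, 'e) leaf \<Rightarrow> ('k, 'a, 'e) ty) \<Rightarrow> ('k, 'a, 'e) ty \<Rightarrow> ('k, 'a, 'e) ty" where
  "ty_sub \<sigma> (TBound j) = \<sigma> (LB j)"
| "ty_sub \<sigma> (EBound j) = \<sigma> (LE j)"
| "ty_sub \<sigma> (TVar a) = \<sigma> (LV a)"
| "ty_sub \<sigma> (EVar e) = \<sigma> (LX e)"
| "ty_sub \<sigma> (TLam K A) = TLam K (ty_sub (up \<sigma>) A)"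
| "ty_sub \<sigma> (TApp A B) = TApp (ty_sub \<sigma> A) (ty_sub \<sigma> B)"
| "ty_sub \<sigma> (Imp A B) = Imp (ty_sub \<sigma> A) (ty_sub \<sigma> B)"
| "ty_sub \<sigma> (TAll K A) = TAll K (ty_sub (up \<sigma>) A)"

fun leaf_ren :: "(nat \<Rightarrow> nat) \<Rightarrow> ('a, 'e) leaf \<Rightarrow> ('a, 'e) leaf" where
  "leaf_ren r (LB n) = LB (r n)"
| "leaf_ren r (LE n) = LE n"
| "leaf_ren r (LV a) = LV a"
| "leaf_ren r (LX e) = LX e"

lemma ty_sub_leaf_ty_leaf [simp]: "ty_sub \<sigma> (leaf_ty l) = \<sigma> l" by (cases l) auto
lemma ty_ren_leaf_ty [simp]: "ty_ren r (leaf_ty l) = leaf_ty (leaf_ren r l)" by (cases l) auto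

lemma up_leaf_ty: "up leaf_ty = leaf_ty"
  unfolding up_def by (rule push_eqI[symmetric]) auto

lemma ty_sub_id [simp]: "ty_sub leaf_ty A = A"
  by (induction A) (auto simp: up_leaf_ty)

lemma ty_ren_eq_ty_sub: "ty_ren r A = ty_sub (\<lambda>l. leaf_ty (leaf_ren r l)) A"
proof (induction A arbitrary: r)
  case (TLam K A)
  have "up (\<lambda>l. leaf_ty (leaf_ren r l)) = (\<lambda>l. leaf_ty (leaf_ren (case_nat 0 (\<lambda>n. Suc (r n))) l))"
    unfolding up_def by (rule push_eqI[symmetric]) auto
  then show ?case unfolding ty_ren.simps ty_sub.simps TLam[of "case_nat 0 (\<lambda>n. Suc (r n))"]
      by (rule arg_cong[OF HOL.sym])
next
  case (TAll K A)
  have "up (\<lambda>l. leaf_ty (leaf_ren r l)) = (\<lambda>l. leaf_ty (leaf_ren (case_nat 0 (\<lambda>n. Suc (r n))) l))"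
    unfolding up_def by (rule push_eqI[symmetric]) auto
  then show ?case unfolding ty_ren.simps ty_sub.simps TAll[of "case_nat 0 (\<lambda>n. Suc (r n))"]
      by (rule arg_cong[OF HOL.sym])
qed auto

lemma ty_ren_ty_ren: "ty_ren r (ty_ren q A) = ty_ren (\<lambda>n. r (q n)) A"
proof (induction A arbitrary: r q)
  case (TLam K A)
  have "(\<lambda>n. case case n of 0 \<Rightarrow> 0 | Suc n \<Rightarrow> Suc (q n) of 0 \<Rightarrow> 0 | Suc n \<Rightarrow> Suc (r n))
     = case_nat 0 (\<lambda>n. Suc (r (q n)))" by (auto split: nat.split)
  then show ?case using TLam by simp
next
  case (TAll K A)
  have "(\<lambda>n. case case n of 0 \<Rightarrow> 0 | Suc n \<Rightarrow> Suc (q n) of 0 \<Rightarrow> 0 | Suc n \<Rightarrow> Suc (r n))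
     = case_nat 0 (\<lambda>n. Suc (r (q n)))" by (auto split: nat.split)
  then show ?case using TAll by simp
qed auto

lemma ty_sub_ty_ren: "ty_sub \<sigma> (ty_ren r A) = ty_sub (\<lambda>l. \<sigma> (leaf_ren r l)) A"
proof (induction A arbitrary: \<sigma> r)
  case (TLam K A)
  have "(\<lambda>l. up \<sigma> (leaf_ren (case_nat 0 (\<lambda>n. Suc (r n))) l)) = up (\<lambda>l. \<sigma> (leaf_ren r l))"
    unfolding up_def by (rule push_eqI) auto
  then show ?case using TLam by simp
next
  case (TAll K A)
  have "(\<lambda>l. up \<sigma> (leaf_ren (case_nat 0 (\<lambda>n. Suc (r n))) l)) = up (\<lambda>l. \<sigma> (leaf_ren r l))"
    unfolding up_def by (rule push_eqI) auto
  then show ?case using TAll by simp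
qed auto

lemma ty_ren_ty_sub: "ty_ren r (ty_sub \<sigma> A) = ty_sub (\<lambda>l. ty_ren r (\<sigma> l)) A"
proof (induction A arbitrary: \<sigma> r)
  case (TLam K A)
  have "(\<lambda>l. ty_ren (case_nat 0 (\<lambda>n. Suc (r n))) (up \<sigma> l)) = up (\<lambda>l. ty_ren r (\<sigma> l))"
    unfolding up_def by (rule push_eqI) (auto simp: ty_ren_ty_ren)
  then show ?case using TLam by simp
next
  case (TAll K A)
  have "(\<lambda>l. ty_ren (case_nat 0 (\<lambda>n. Suc (r n))) (up \<sigma> l)) = up (\<lambda>l. ty_ren r (\<sigma> l))"
    unfolding up_def by (rule push_eqI) (auto simp: ty_ren_ty_ren)
  then show ?case using TAll by simp
qed auto

text \<open>At index 0 both sides give \<open>TBound 0\<close>; elsewhere both are shifts, which the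
  two mixed laws of renaming and substitution move across \<open>ty_sub\<close>.\<close>

lemma up_comp: "(\<lambda>l. ty_sub (up \<tau>) (up \<sigma> l)) = up (\<lambda>l. ty_sub \<tau> (\<sigma> l))"
proof -
  have "(\<lambda>l. up \<tau> (leaf_ren Suc l)) = (\<lambda>l. ty_ren Suc (\<tau> l))"
    unfolding up_def by (rule leaf_ext) auto
  then show ?thesis
    by (subst (2 3) up_def) (rule push_eqI; simp add: ty_sub_ty_ren ty_ren_ty_sub; simp add: up_def)
qed

lemma ty_sub_ty_sub: "ty_sub \<tau> (ty_sub \<sigma> A) = ty_sub (\<lambda>l. ty_sub \<tau> (\<sigma> l)) A"
  by (induction A arbitrary: \<sigma> \<tau>) (auto simp: up_comp)

text \<open>Unlike \<open>ty_open 0\<close>, this lowers the remaining indices, so it is the correct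
  \<beta>-instantiation even when body and argument have dangling indices.\<close>

definition inst :: "('k, 'a, 'e) ty \<Rightarrow> ('k, 'a, 'e) ty \<Rightarrow> ('k, 'a, 'e) ty" where
  "inst B A = ty_sub (push B leaf_ty) A"

lemma ty_sub_push_ty_ren: "ty_sub (push B \<sigma>) (ty_ren Suc A) = ty_sub \<sigma> A"
proof -
  have "(\<lambda>l. push B \<sigma> (leaf_ren Suc l)) = \<sigma>" by (rule leaf_ext) auto
  then show ?thesis by (simp add: ty_sub_ty_ren)
qed

text \<open>Turns instantiation after a substitution into an extension of the environment, the form
  in which \<open>den\<close> interprets binders.\<close>

lemma inst_up: "inst B (ty_sub (up \<sigma>) A) = ty_sub (push B \<sigma>) A"
proof -
  have "(\<lambda>l. ty_sub (push B leaf_ty) (up \<sigma> l)) = push B \<sigma>"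
    unfolding up_def by (rule push_eqI) (auto simp: ty_sub_push_ty_ren)
  then show ?thesis by (simp add: inst_def ty_sub_ty_sub)
qed

lemma ty_sub_inst: "ty_sub \<sigma> (inst B A) = ty_sub (push (ty_sub \<sigma> B) \<sigma>) A"
  by (simp add: inst_def ty_sub_ty_sub comp_push[of "ty_sub \<sigma>"])

lemma ty_sub_inst_up: "ty_sub \<sigma> (inst B A) = inst (ty_sub \<sigma> B) (ty_sub (up \<sigma>) A)"
  by (simp add: inst_up ty_sub_inst)

section \<open>Kinds computed on types with indices\<close>

fun kapp :: "'k kind option \<Rightarrow> 'k kind option \<Rightarrow> 'k kind option" where
  "kapp (Some (KFun K J)) (Some K') = (if K' = K then Some J else None)"
| "kapp _ _ = None"

lemma kapp_Some: "kapp u v = Some J \<longleftrightarrow> (\<exists>K. u = Some (KFun K J) \<and> v = Some K)"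
  by (cases "(u, v)" rule: kapp.cases) auto

text \<open>Kinding is syntax-directed, so the kind can be computed. An environment that also covers
  indices avoids fresh names and makes the substitution law an equation.\<close>

primrec kind_of :: "(('a, 'e) leaf \<Rightarrow> 'k kind option) \<Rightarrow> ('k, 'a, 'e) ty \<Rightarrow> 'k kind option" where
  "kind_of \<kappa> (TBound j) = \<kappa> (LB j)"
| "kind_of \<kappa> (EBound j) = \<kappa> (LE j)"
| "kind_of \<kappa> (TVar a) = \<kappa> (LV a)"
| "kind_of \<kappa> (EVar e) = \<kappa> (LX e)"
| "kind_of \<kappa> (TLam K A) = map_option (KFun K) (kind_of (push (Some K) \<kappa>) A)"
| "kind_of \<kappa> (TApp A B) = kapp (kind_of \<kappa> A) (kind_of \<kappa> B)"
| "kind_of \<kappa> (Imp A B) = (if kind_of \<kappa> A = Some KProp \<and>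
    kind_of \<kappa> B = Some KProp then Some KProp else None)"
| "kind_of \<kappa> (TAll K A) = (if kind_of (push (Some K) \<kappa>) A = Some KProp then Some KProp else None)"

lemma kind_of_TApp_Some:
    "kind_of \<kappa> (TApp A B) = Some J \<longleftrightarrow> (\<exists>K. kind_of \<kappa> A = Some (KFun K J) \<and> kind_of \<kappa> B = Some K)"
  by (simp add: kapp_Some)

lemma kind_of_leaf_ty [simp]: "kind_of \<kappa> (leaf_ty l) = \<kappa> l" by (cases l) auto

lemma kind_of_ty_ren: "kind_of \<kappa> (ty_ren r A) = kind_of (\<lambda>l. \<kappa> (leaf_ren r l)) A"
proof (induction A arbitrary: \<kappa> r)
  case (TLam K A)
  have "(\<lambda>l. push (Some K) \<kappa> (leaf_ren (case_nat 0 (\<lambda>n. Suc (r n))) l)) =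
      push (Some K) (\<lambda>l. \<kappa> (leaf_ren r l))"
    by (rule push_eqI) auto
  then show ?case using TLam by simp
next
  case (TAll K A)
  have "(\<lambda>l. push (Some K) \<kappa> (leaf_ren (case_nat 0 (\<lambda>n. Suc (r n))) l)) =
      push (Some K) (\<lambda>l. \<kappa> (leaf_ren r l))"
    by (rule push_eqI) auto
  then show ?case using TAll by simp
qed auto

lemma kind_of_up: "(\<lambda>l. kind_of (push (Some K) \<kappa>) (up \<sigma> l)) = push (Some K) (\<lambda>l. kind_of \<kappa> (\<sigma> l))"
proof -
  have "(\<lambda>l. push (Some K) \<kappa> (leaf_ren Suc l)) = \<kappa>" by (rule leaf_ext) auto
  then show ?thesis by (intro push_eqI) (auto simp: up_def kind_of_ty_ren)
qed

lemma kind_of_ty_sub: "kind_of \<kappa> (ty_sub \<sigma> A) = kind_of (\<lambda>l. kind_of \<kappa> (\<sigma> l)) A"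
  by (induction A arbitrary: \<kappa> \<sigma>) (auto simp: kind_of_up)

lemma kind_of_inst: "kind_of \<kappa> (inst B A) = kind_of (push (kind_of \<kappa> B) \<kappa>) A"
  by (simp add: inst_def kind_of_ty_sub comp_push[of "kind_of \<kappa>"])

primrec ty_within :: "(('a, 'e) leaf \<Rightarrow> bool) \<Rightarrow> ('k, 'a, 'e) ty \<Rightarrow> bool" where
  "ty_within Z (TBound j) = Z (LB j)"
| "ty_within Z (EBound j) = Z (LE j)"
| "ty_within Z (TVar a) = Z (LV a)"
| "ty_within Z (EVar e) = Z (LX e)"
| "ty_within Z (TLam K A) = ty_within (push True Z) A"
| "ty_within Z (TApp A B) = (ty_within Z A \<and> ty_within Z B)"
| "ty_within Z (Imp A B) = (ty_within Z A \<and> ty_within Z B)"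
| "ty_within Z (TAll K A) = ty_within (push True Z) A"

lemma ty_within_leaf_ty [simp]: "ty_within Z (leaf_ty l) = Z l" by (cases l) auto

lemma ty_within_ty_ren: "ty_within Z (ty_ren r A) = ty_within (\<lambda>l. Z (leaf_ren r l)) A"
proof (induction A arbitrary: Z r)
  case (TLam K A)
  have "(\<lambda>l. push True Z (leaf_ren (case_nat 0 (\<lambda>n. Suc (r n))) l)) = push True (\<lambda>l. Z (leaf_ren r l))"
    by (rule push_eqI) auto
  then show ?case using TLam by simp
next
  case (TAll K A)
  have "(\<lambda>l. push True Z (leaf_ren (case_nat 0 (\<lambda>n. Suc (r n))) l)) = push True (\<lambda>l. Z (leaf_ren r l))"
    by (rule push_eqI) auto
  then show ?case using TAll by simp
qed auto

lemma ty_within_up: "(\<lambda>l. ty_within (push True Z) (up \<sigma> l)) = push True (\<lambda>l. ty_within Z (\<sigma> l))"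
proof -
  have "(\<lambda>l. push True Z (leaf_ren Suc l)) = Z" by (rule leaf_ext) auto
  then show ?thesis by (intro push_eqI) (auto simp: up_def ty_within_ty_ren)
qed

lemma ty_within_ty_sub: "ty_within Z (ty_sub \<sigma> A) = ty_within (\<lambda>l. ty_within Z (\<sigma> l)) A"
  by (induction A arbitrary: Z \<sigma>) (auto simp: ty_within_up)

lemma push_rel:
  assumes "push True Z l" "P v w" "\<And>l. Z l \<Longrightarrow> P (f l) (g l)"
  shows "P (push v f l) (push w g l)"
  using assms by (cases l rule: leaf_cases) simp_all

lemma epush_rel:
  assumes "epush True Z l" "P v w" "\<And>l. Z l \<Longrightarrow> P (f l) (g l)"
  shows "P (epush v f l) (epush w g l)"
  using assms by (cases l rule: leaf_cases) simp_all

lemma push_mono: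
  assumes "\<And>l. Z l \<Longrightarrow> Z' l" "push True Z l"
  shows "push True Z' l"
  using assms by (cases l rule: leaf_cases) simp_all

lemma epush_mono:
  assumes "\<And>l. Z l \<Longrightarrow> Z' l" "epush True Z l"
  shows "epush True Z' l"
  using assms by (cases l rule: leaf_cases) simp_all

lemma ty_within_mono: "ty_within Z A \<Longrightarrow> (\<And>l. Z l \<Longrightarrow> Z' l) \<Longrightarrow> ty_within Z' A"
proof (induction A arbitrary: Z Z')
  case (TLam K A) 
  show ?case using TLam.IH[of "push True Z" "push True Z'"] push_mono[of Z Z'] TLam.prems by auto
next
  case (TAll K A) 
  show ?case using TAll.IH[of "push True Z" "push True Z'"] push_mono[of Z Z'] TAll.prems by auto
qed auto

lemma ty_within_all: "(\<And>l. Z l) \<Longrightarrow> ty_within Z A"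
proof (induction A arbitrary: Z)
  case (TLam K A)
  have "push True Z l" for l using TLam.prems by (cases l rule: leaf_cases) simp_all
  then show ?case by (simp add: TLam.IH)
next
  case (TAll K A)
  have "push True Z l" for l using TAll.prems by (cases l rule: leaf_cases) simp_all
  then show ?case by (simp add: TAll.IH)
qed simp_all

lemma ty_sub_agree: "ty_within Z A \<Longrightarrow> (\<And>l. Z l \<Longrightarrow> \<sigma> l = \<tau> l) \<Longrightarrow> ty_sub \<sigma> A = ty_sub \<tau> A"
proof (induction A arbitrary: Z \<sigma> \<tau>)
  case (TLam K A)
  have "up \<sigma> l = up \<tau> l" if "push True Z l" for l
    unfolding up_def using that
    by (rule push_rel[of Z l "(=)"]) (rule HOL.refl, rule arg_cong[of _ _
        "ty_ren Suc"], erule TLam.prems(2))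
  from TLam.IH[OF _ this] show ?case using TLam.prems(1) by simp
next
  case (TAll K A)
  have "up \<sigma> l = up \<tau> l" if "push True Z l" for l
    unfolding up_def using that
    by (rule push_rel[of Z l "(=)"]) (rule HOL.refl, rule arg_cong[of _ _
        "ty_ren Suc"], erule TAll.prems(2))
  from TAll.IH[OF _ this] show ?case using TAll.prems(1) by simp
next
  case (TApp A B)
  show ?case using TApp.IH[of Z \<sigma> \<tau>] TApp.prems by simp
next
  case (Imp A B)
  show ?case using Imp.IH[of Z \<sigma> \<tau>] Imp.prems by simp
qed simp_all

lemma kind_of_ty_within: "kind_of \<kappa> A = Some K \<Longrightarrow> ty_within (\<lambda>l. \<kappa> l \<noteq> None) A"
proof (induction A arbitrary: \<kappa> K)
  case (TLam K1 A)
  have "(\<lambda>l. push (Some K1) \<kappa> l \<noteq> None) = push True (\<lambda>l. \<kappa> l \<noteq> None)"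
    by (rule push_eqI) auto
  moreover obtain J where "kind_of (push (Some K1) \<kappa>) A = Some J" using TLam.prems by auto
  ultimately show ?case using TLam.IH by fastforce
next
  case (TAll K1 A)
  have "(\<lambda>l. push (Some K1) \<kappa> l \<noteq> None) = push True (\<lambda>l. \<kappa> l \<noteq> None)"
    by (rule push_eqI) auto
  moreover have "kind_of (push (Some K1) \<kappa>) A = Some KProp" using TAll.prems by (simp split: if_splits)
  ultimately show ?case using TAll.IH by fastforce
next
  case (TApp A B) then show ?case unfolding kind_of_TApp_Some ty_within.simps by blast
next
  case (Imp A B) then show ?case by (simp split: if_splits)
qed auto

lemma kind_of_agree: "ty_within Z A \<Longrightarrow> (\<And>l. Z l \<Longrightarrow> \<kappa> l = \<kappa>' l) \<Longrightarrow> kind_of \<kappa> A = kind_of \<kappa>' A"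
proof (induction A arbitrary: Z \<kappa> \<kappa>')
  case (TLam K A)
  have "push (Some K) \<kappa> l = push (Some K) \<kappa>' l" if "push True Z l" for l
    using that by (rule push_rel[of Z l "(=)"]) (rule HOL.refl, erule TLam.prems(2))
  from TLam.IH[OF _ this] show ?case using TLam.prems(1) by simp
next
  case (TAll K A)
  have "push (Some K) \<kappa> l = push (Some K) \<kappa>' l" if "push True Z l" for l
    using that by (rule push_rel[of Z l "(=)"]) (rule HOL.refl, erule TAll.prems(2))
  from TAll.IH[OF _ this] show ?case using TAll.prems(1) by simp
next
  case (TApp A B)
  show ?case using TApp.IH[of Z \<kappa> \<kappa>'] TApp.prems by simp
next
  case (Imp A B)
  show ?case using Imp.IH[of Z \<kappa> \<kappa>'] Imp.prems by simp
qed simp_all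

lemma kind_of_mono:
  assumes "kind_of \<kappa> A = Some K" "\<And>l. \<kappa> l \<noteq> None \<Longrightarrow> \<kappa>' l = \<kappa> l"
  shows "kind_of \<kappa>' A = Some K"
proof -
  have "kind_of \<kappa> A = kind_of \<kappa>' A" by (rule kind_of_agree[OF kind_of_ty_within[OF assms(1)]])
      (simp add: assms(2))
  then show ?thesis using assms(1) by simp
qed

section \<open>Closed types, and opening as an instance of substitution\<close>

fun name :: "('a, 'e) leaf \<Rightarrow> bool" where
  "name (LV a) = True" | "name (LX e) = True" | "name _ = False"

lemma name_iff: "name l \<longleftrightarrow> (\<exists>a. l = LV a) \<or> (\<exists>e. l = LX e)"
  by (cases l) auto

definition closed :: "('k, 'a, 'e) ty \<Rightarrow> bool" where
  "closed A \<longleftrightarrow> ty_within name A"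

lemma ty_lc_ty_within: "ty_lc n A \<longleftrightarrow> ty_within (\<lambda>l. name l \<or> (\<exists>j<n. l = LB j)) A"
proof -
  have "push True (\<lambda>l. name l \<or> (\<exists>j<n. l = LB j)) = (\<lambda>l. name l \<or> (\<exists>j<Suc n. l = LB j))" for n
    by (rule push_eqI[symmetric]) auto
  note [simp] = this
  show ?thesis by (induction A arbitrary: n) simp_all
qed

lemma ty_lc_closed: "ty_lc 0 A \<longleftrightarrow> closed A"
  by (simp add: ty_lc_ty_within closed_def)

lemma ty_sub_closed: "closed A \<Longrightarrow> (\<And>l. name l \<Longrightarrow> \<sigma> l = \<tau> l) \<Longrightarrow> ty_sub \<sigma> A = ty_sub \<tau> A"
  unfolding closed_def by (rule ty_sub_agree)

lemma ty_ren_closed: "closed A \<Longrightarrow> ty_ren r A = A"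
proof -
  assume "closed A"
  then have "ty_sub (\<lambda>l. leaf_ty (leaf_ren r l)) A = ty_sub leaf_ty A"
      by (rule ty_sub_closed) (auto simp: name_iff)
  then show ?thesis by (simp add: ty_ren_eq_ty_sub)
qed

text \<open>Opening inserts \<open>C\<close> below binders without shifting, hence the premise that
  shifting leaves \<open>C\<close> alone. It holds for closed types and for \<open>EBound 0\<close>,
  which the verification of a quantified type inserts.\<close>

lemma ty_open_ty_sub:
  assumes "ty_ren Suc C = C" shows "ty_open k C A = ty_sub (leaf_ty(LB k := C)) A"
proof -
  have "up (leaf_ty(LB k := C)) = leaf_ty(LB (Suc k) := C)" for k
    unfolding up_def using assms by (intro push_eqI[symmetric]) auto
  note [simp] = this
  show ?thesis by (induction A arbitrary: k) simp_all
qed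

lemma ty_eopen_ty_sub: "ty_eopen k d A = ty_sub (leaf_ty(LE k := EVar d)) A"
proof -
  have "up (leaf_ty(LE k := EVar d)) = leaf_ty(LE k := EVar d)" for k
    unfolding up_def by (intro push_eqI[symmetric]) auto
  note [simp] = this
  show ?thesis by (induction A arbitrary: k) simp_all
qed

text \<open>With index 0 the only dangling one, there is no other index for \<open>inst\<close> to
  lower.\<close>

lemma ty_open_inst:
  assumes "ty_ren Suc C = C" "ty_lc (Suc 0) A" shows "ty_open 0 C A = inst C A"
  unfolding inst_def ty_open_ty_sub[OF assms(1)]
  by (rule ty_sub_agree[OF assms(2)[unfolded ty_lc_ty_within]]) (auto simp: name_iff)

lemma ty_within_free:
  "ty_within Z A \<Longrightarrow> ty_within (\<lambda>l. Z l \<and> (\<forall>a. l = LV a \<longrightarrow> a \<in> ty_ftv A) \<and> (\<forall>e. l = LX e \<longrightarrow>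
      e \<in> ty_fev A)) A"
proof -
  \<comment> \<open>Fixed supersets \<open>P\<close> and \<open>Q\<close> replace the sets of free
    names, so that the induction hypotheses for the components speak of the same predicate.\<close>
  have "ty_within Z A \<Longrightarrow> ty_ftv A \<subseteq> P \<Longrightarrow> ty_fev A \<subseteq> Q \<Longrightarrow>
     ty_within (\<lambda>l. Z l \<and> (\<forall>a. l = LV a \<longrightarrow> a \<in> P) \<and> (\<forall>e. l = LX e \<longrightarrow> e \<in> Q)) A" for P Q
  proof (induction A arbitrary: Z)
    case (TLam K A)
    have eq: "push True (\<lambda>l. Z l \<and> (\<forall>a. l = LV a \<longrightarrow> a \<in> P) \<and> (\<forall>e. l = LX e \<longrightarrow> e \<in> Q)) =
      (\<lambda>l. push True Z l \<and> (\<forall>a. l = LV a \<longrightarrow> a \<in> P) \<and> (\<forall>e. l = LX e \<longrightarrow> e \<in> Q))"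
      by (rule push_eqI[symmetric]) auto
    show ?case using TLam.IH[of "push True Z"] TLam.prems
        by (simp only: ty_within.simps ty_ftv.simps ty_fev.simps eq)
  next
    case (TAll K A)
    have eq: "push True (\<lambda>l. Z l \<and> (\<forall>a. l = LV a \<longrightarrow> a \<in> P) \<and> (\<forall>e. l = LX e \<longrightarrow> e \<in> Q)) =
      (\<lambda>l. push True Z l \<and> (\<forall>a. l = LV a \<longrightarrow> a \<in> P) \<and> (\<forall>e. l = LX e \<longrightarrow> e \<in> Q))"
      by (rule push_eqI[symmetric]) auto
    show ?case using TAll.IH[of "push True Z"] TAll.prems
        by (simp only: ty_within.simps ty_ftv.simps ty_fev.simps eq)
  qed auto
  then show "ty_within Z A \<Longrightarrow> ?thesis" by blast
qed

lemma ty_within_ftv: "ty_within Z A \<Longrightarrow> a \<notin> ty_ftv A \<Longrightarrow> ty_within (\<lambda>l. Z l \<and> l \<noteq> LV a) A"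
  by (drule ty_within_free, erule ty_within_mono) auto

lemma ty_within_fev: "ty_within Z A \<Longrightarrow> e \<notin> ty_fev A \<Longrightarrow> ty_within (\<lambda>l. Z l \<and> l \<noteq> LX e) A"
  by (drule ty_within_free, erule ty_within_mono) auto

lemma finite_ftv [simp]: "finite (ty_ftv A)" by (induction A) auto
lemma finite_fev [simp]: "finite (ty_fev A)" by (induction A) auto

subsection \<open>Confluence of the conversion of types\<close>

text \<open>Parallel reduction in the style of Tait and Martin-Loef, on raw types: bodies are
  reduced in place, without names and without local closure.\<close>

inductive par :: "('k, 'a, 'e) ty \<Rightarrow> ('k, 'a, 'e) ty \<Rightarrow> bool" where
  par_TBound: "par (TBound j) (TBound j)"
| par_EBound: "par (EBound j) (EBound j)"
| par_TVar: "par (TVar a) (TVar a)"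
| par_EVar: "par (EVar e) (EVar e)"
| par_TLam: "par A A' \<Longrightarrow> par (TLam K A) (TLam K A')"
| par_TApp: "par A A' \<Longrightarrow> par B B' \<Longrightarrow> par (TApp A B) (TApp A' B')"
| par_Imp: "par A A' \<Longrightarrow> par B B' \<Longrightarrow> par (Imp A B) (Imp A' B')"
| par_TAll: "par A A' \<Longrightarrow> par (TAll K A) (TAll K A')"
| par_beta: "par A A' \<Longrightarrow> par B B' \<Longrightarrow> par (TApp (TLam K A) B) (inst B' A')"

inductive_cases par_TLamE: "par (TLam K A) B"
inductive_cases par_TAppE: "par (TApp A1 A2) B"
inductive_cases par_ImpE: "par (Imp A1 A2) B"
inductive_cases par_TAllE: "par (TAll K A) B"

lemma par_refl [simp]: "par A A"
  by (induction A) (auto intro: par.intros)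

lemma ty_ren_inst: "ty_ren r (inst B A) = inst (ty_ren r B) (ty_ren (case_nat 0 (\<lambda>n. Suc (r n))) A)"
proof -
  have "up (\<lambda>l. leaf_ty (leaf_ren r l)) = (\<lambda>l. leaf_ty (leaf_ren (case_nat 0 (\<lambda>n. Suc (r n))) l))"
    unfolding up_def by (rule push_eqI[symmetric]) auto
  then show ?thesis unfolding ty_ren_eq_ty_sub ty_sub_inst_up by (rule arg_cong)
qed

lemma par_ty_ren: "par A B \<Longrightarrow> par (ty_ren r A) (ty_ren r B)"
proof (induction arbitrary: r rule: par.induct)
  case (par_beta A A' B B' K)
  then show ?case unfolding ty_ren_inst ty_ren.simps by (blast intro: par.par_beta)
qed (auto intro: par.intros)

lemma par_up: "(\<And>l. par (\<sigma> l) (\<tau> l)) \<Longrightarrow> par (up \<sigma> l) (up \<tau> l)"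
  unfolding up_def by (cases l rule: leaf_cases) (simp_all add: par_ty_ren)

lemma par_ty_sub: "par A B \<Longrightarrow> (\<And>l. par (\<sigma> l) (\<tau> l)) \<Longrightarrow> par (ty_sub \<sigma> A) (ty_sub \<tau> B)"
proof (induction arbitrary: \<sigma> \<tau> rule: par.induct)
  case (par_beta A A' B B' K)
  have "par (ty_sub (up \<sigma>) A) (ty_sub (up \<tau>) A')"
      by (rule par_beta.IH(1)) (rule par_up, rule par_beta.prems)
  moreover have "par (ty_sub \<sigma> B) (ty_sub \<tau> B')" by (rule par_beta.IH(2)) (rule par_beta.prems)
  ultimately show ?case unfolding ty_sub_inst_up ty_sub.simps by (rule par.par_beta)
next
  case (par_TLam A A' K)
  show ?case unfolding ty_sub.simps
    by (rule par.par_TLam, rule par_TLam.IH) (rule par_up, rule par_TLam.prems)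
next
  case (par_TAll A A' K)
  show ?case unfolding ty_sub.simps
    by (rule par.par_TAll, rule par_TAll.IH) (rule par_up, rule par_TAll.prems)
next
  case (par_TApp A A' B B')
  show ?case unfolding ty_sub.simps by (rule par.par_TApp; rule par_TApp.IH) (rule par_TApp.prems)+
next
  case (par_Imp A A' B B')
  show ?case unfolding ty_sub.simps by (rule par.par_Imp; rule par_Imp.IH) (rule par_Imp.prems)+
qed simp_all

lemma par_inst: "par A A' \<Longrightarrow> par B B' \<Longrightarrow> par (inst B A) (inst B' A')"
  unfolding inst_def
proof (rule par_ty_sub)
  fix l show "par B B' \<Longrightarrow> par (push B leaf_ty l) (push B' leaf_ty l)"
      by (cases l rule: leaf_cases) simp_all
qed

text \<open>Takahashi's complete development: all redexes present in the type are contracted at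
  once.\<close>

fun develop :: "('k, 'a, 'e) ty \<Rightarrow> ('k, 'a, 'e) ty" where
  "develop (TApp (TLam K A) B) = inst (develop B) (develop A)"
| "develop (TApp A B) = TApp (develop A) (develop B)"
| "develop (TLam K A) = TLam K (develop A)"
| "develop (Imp A B) = Imp (develop A) (develop B)"
| "develop (TAll K A) = TAll K (develop A)"
| "develop A = A"

text \<open>Whichever redexes a parallel step contracted, the remaining ones can be contracted in
  one further step, with a result that depends on \<open>A\<close> alone. Confluence follows from
  this triangle.\<close>

lemma par_develop: "par A B \<Longrightarrow> par B (develop A)"
proof (induction rule: par.induct)
  case (par_TApp A A' B B')
  show ?case
  \<comment> \<open>If the head is an abstraction, \<open>develop\<close> also contracts the outer
    redex that this step left in place.\<close>
  proof (cases "\<exists>K A0. A = TLam K A0")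
    case True
    then obtain K A0 where A: "A = TLam K A0" by blast
    with par_TApp.hyps(1) obtain A1 where A': "A' = TLam K A1" by (auto elim: par_TLamE)
    from par_TApp.IH(1) have "par A1 (develop A0)" unfolding A A' by (auto elim: par_TLamE)
    then show ?thesis unfolding A A' develop.simps by (rule par.par_beta) (rule par_TApp.IH)
  next
    case False
    then have "develop (TApp A B) = TApp (develop A) (develop B)" by (cases A) auto
    then show ?thesis using par_TApp.IH by (simp add: par.par_TApp)
  qed
next
  case (par_beta A A' B B' K)
  then show ?case by (simp add: par_inst)
qed (auto intro: par.intros)

abbreviation pars :: "('k, 'a, 'e) ty \<Rightarrow> ('k, 'a, 'e) ty \<Rightarrow> bool" where
  "pars \<equiv> par\<^sup>*\<^sup>*"

lemma pars_strip: "pars A B \<Longrightarrow> par A C \<Longrightarrow> \<exists>D. par B D \<and> pars C D"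
proof (induction arbitrary: rule: rtranclp_induct)
  case base then show ?case by blast
next
  case (step B B')
  then obtain D where "par B D" "pars C D" by blast
  with step(2) par_develop have "par B' (develop B)" "par D (develop B)" by blast+
  with \<open>pars C D\<close> show ?case by (meson rtranclp.rtrancl_into_rtrancl)
qed

lemma pars_confluent: "pars A B \<Longrightarrow> pars A C \<Longrightarrow> \<exists>D. pars B D \<and> pars C D"
proof (induction arbitrary: C rule: converse_rtranclp_induct)
  case base then show ?case by blast
next
  case (step A A')
  from pars_strip[OF step.prems step(1)] obtain D where "par C D" "pars A' D" by blast
  with step.IH[of D] show ?case by (meson converse_rtranclp_into_rtranclp)
qed

text \<open>Stands in for conversion also on types with dangling indices, about which
  \<open>ty_eq\<close> says nothing.\<close>

definition joinable :: "('k, 'a, 'e) ty \<Rightarrow> ('k, 'a, 'e) ty \<Rightarrow> bool" where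
  "joinable A B \<longleftrightarrow> (\<exists>C. pars A C \<and> pars B C)"

lemma joinable_refl [simp]: "joinable A A" unfolding joinable_def by blast
lemma joinable_sym: "joinable A B \<Longrightarrow> joinable B A" unfolding joinable_def by blast
lemma joinable_trans [trans]: "joinable A B \<Longrightarrow> joinable B C \<Longrightarrow> joinable A C"
  unfolding joinable_def by (meson pars_confluent rtranclp_trans)
lemma pars_joinable: "pars A B \<Longrightarrow> joinable A B" unfolding joinable_def by blast

lemma pars_map: "pars A B \<Longrightarrow> (\<And>A B. par A B \<Longrightarrow> par (f A) (f B)) \<Longrightarrow> pars (f A) (f B)"
  by (induction rule: rtranclp_induct) (auto intro: rtranclp.rtrancl_into_rtrancl)

lemma joinable_map: "joinable A B \<Longrightarrow> (\<And>A B. par A B \<Longrightarrow> par (f A) (f B)) \<Longrightarrow> joinable (f A) (f B)"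
  unfolding joinable_def by (blast intro: pars_map)

lemma joinable_map2:
  assumes "joinable A A'" "joinable B B'" "\<And>A A' B B'. par A A' \<Longrightarrow> par B B' \<Longrightarrow> par (f A B) (f A' B')"
  shows "joinable (f A B) (f A' B')"
  using joinable_map[OF assms(1), of "\<lambda>x. f x B"] joinable_map[OF assms(2), of "f A'"] assms(3)
  by (meson joinable_trans par_refl)

lemma joinable_ty_sub1: "joinable A B \<Longrightarrow> joinable (ty_sub \<sigma> A) (ty_sub \<sigma> B)"
  by (erule joinable_map) (simp add: par_ty_sub)

lemma joinable_inst: "joinable A A' \<Longrightarrow> joinable B B' \<Longrightarrow> joinable (inst B A) (inst B' A')"
  using joinable_map2[of A A' B B' "\<lambda>x y. inst y x"] par_inst by blast

lemma joinable_ty_ren: "joinable A B \<Longrightarrow> joinable (ty_ren r A) (ty_ren r B)"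
  by (simp add: ty_ren_eq_ty_sub joinable_ty_sub1)

lemma joinable_up: "(\<And>l. joinable (\<sigma> l) (\<tau> l)) \<Longrightarrow> joinable (up \<sigma> l) (up \<tau> l)"
  unfolding up_def by (cases l rule: leaf_cases) (simp_all add: joinable_ty_ren)

lemma joinable_ty_sub2: "(\<And>l. joinable (\<sigma> l) (\<tau> l)) \<Longrightarrow> joinable (ty_sub \<sigma> A) (ty_sub \<tau> A)"
proof (induction A arbitrary: \<sigma> \<tau>)
  case (TLam K A)
  show ?case unfolding ty_sub.simps
    by (rule joinable_map[of _ _ "TLam K"], rule TLam.IH)
        (rule joinable_up, rule TLam.prems, rule par_TLam)
next
  case (TAll K A)
  show ?case unfolding ty_sub.simps
    by (rule joinable_map[of _ _ "TAll K"], rule TAll.IH)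
        (rule joinable_up, rule TAll.prems, rule par_TAll)
next
  case (TApp A B)
  then show ?case unfolding ty_sub.simps by (blast intro: joinable_map2[of _ _ _ _ TApp] par_TApp)
next
  case (Imp A B)
  then show ?case unfolding ty_sub.simps by (blast intro: joinable_map2[of _ _ _ _ Imp] par_Imp)
qed simp_all

lemma pars_Imp: "pars (Imp A B) C \<Longrightarrow> \<exists>A' B'. C = Imp A' B' \<and> pars A A' \<and> pars B B'"
  by (induction rule: rtranclp_induct) (auto elim!: par_ImpE intro: rtranclp.rtrancl_into_rtrancl)

lemma pars_TAll: "pars (TAll K A) C \<Longrightarrow> \<exists>A'. C = TAll K A' \<and> pars A A'"
  by (induction rule: rtranclp_induct) (auto elim!: par_TAllE intro: rtranclp.rtrancl_into_rtrancl)

text \<open>Every reduct of an implication is an implication, so a common reduct exposes matching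
  components. Together with confluence this makes the type constructors injective up to
  conversion.\<close>

lemma joinable_ImpD:
  assumes "joinable A A'" "pars A (Imp B C)"
  shows "\<exists>B' C'. pars A' (Imp B' C') \<and> joinable B B' \<and> joinable C C'"
proof -
  from assms have "joinable (Imp B C) A'" by (blast intro: joinable_trans joinable_sym pars_joinable)
  then obtain D where "pars (Imp B C) D" "pars A' D" unfolding joinable_def by blast
  then show ?thesis by (blast dest: pars_Imp intro: pars_joinable)
qed

lemma joinable_TAllD:
  assumes "joinable A A'" "pars A (TAll K C)"
  shows "\<exists>C'. pars A' (TAll K C') \<and> joinable C C'"
proof -
  from assms have "joinable (TAll K C) A'" by (blast intro: joinable_trans joinable_sym pars_joinable)
  then obtain D where "pars (TAll K C) D" "pars A' D" unfolding joinable_def by blast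
  then show ?thesis by (blast dest: pars_TAll intro: pars_joinable)
qed

lemma joinable_Imp_Imp: "joinable (Imp A B) (Imp A' B') \<Longrightarrow> joinable A A' \<and> joinable B B'"
  unfolding joinable_def by (blast dest: pars_Imp)

lemma joinable_TAll_TAll: "joinable (TAll K A) (TAll K' A') \<Longrightarrow> K = K' \<and> joinable A A'"
  unfolding joinable_def by (blast dest: pars_TAll)

lemma kind_of_par: "par A B \<Longrightarrow> kind_of \<kappa> A = Some K \<Longrightarrow> kind_of \<kappa> B = Some K"
proof (induction arbitrary: \<kappa> K rule: par.induct)
  case (par_TApp A A' B B') then show ?case unfolding kind_of_TApp_Some by blast
next
  case (par_beta A A' B B' K1)
  from par_beta.prems obtain K2 where "kind_of (push (Some K1) \<kappa>) A = Some K" "kind_of \<kappa> B = Some K1"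
    unfolding kind_of_TApp_Some by auto
  with par_beta.IH show ?case by (simp add: kind_of_inst)
qed (auto split: if_splits)

lemma kind_of_pars: "pars A B \<Longrightarrow> kind_of \<kappa> A = Some K \<Longrightarrow> kind_of \<kappa> B = Some K"
  by (induction rule: rtranclp_induct) (auto intro: kind_of_par)

lemma kind_of_joinable: "joinable A B \<Longrightarrow> kind_of \<kappa> A = Some K \<Longrightarrow> kind_of \<kappa> B = Some J \<Longrightarrow> K = J"
  unfolding joinable_def by (metis kind_of_pars option.inject)

lemma ty_within_par: "par A B \<Longrightarrow> ty_within Z A \<Longrightarrow> ty_within Z B"
proof (induction arbitrary: Z rule: par.induct)
  case (par_beta A A' B B' K1)
  then have "ty_within (push True Z) A'" "ty_within Z B'" by auto
  then show ?case by (simp add: inst_def ty_within_ty_sub comp_push[of "ty_within Z"])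
qed auto

lemma ty_within_pars: "pars A B \<Longrightarrow> ty_within Z A \<Longrightarrow> ty_within Z B"
  by (induction rule: rtranclp_induct) (auto intro: ty_within_par)

lemma leaf_ty_neq [simp]: "leaf_ty l \<noteq> TLam K A" "leaf_ty l \<noteq> Imp A B" "leaf_ty l \<noteq> TAll K A"
  by (cases l; simp)+

lemma par_leaf_ty: "par (leaf_ty l) B \<Longrightarrow> B = leaf_ty l"
  by (cases l) (auto elim: par.cases)

text \<open>Replacing leaves by leaves creates no abstraction and hence no redex, so each step of
  the renamed type is the image of a step of the original.\<close>

lemma par_reflect:
  "par (ty_sub (\<lambda>l. leaf_ty (r l)) A) B \<Longrightarrow> \<exists>B'. par A B' \<and> B = ty_sub (\<lambda>l. leaf_ty (r l)) B'"
proof (induction A arbitrary: r B)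
  case (TLam K A)
  let ?r = "push (LB 0) (\<lambda>l. leaf_ren Suc (r l))"
  have eq: "up (\<lambda>l. leaf_ty (r l)) = (\<lambda>l. leaf_ty (?r l))" unfolding up_def
      by (rule push_eqI[symmetric]) auto
  from TLam.prems have "par (TLam K (ty_sub (\<lambda>l. leaf_ty (?r l)) A)) B" unfolding ty_sub.simps eq .
  then obtain B1 where B1: "B = TLam K B1" "par (ty_sub (\<lambda>l. leaf_ty (?r l)) A) B1" by (rule par_TLamE)
  from TLam.IH[OF B1(2)] obtain C where C: "par A C" "B1 = ty_sub (\<lambda>l. leaf_ty (?r l)) C" by blast
  have "B = ty_sub (\<lambda>l. leaf_ty (r l)) (TLam K C)" unfolding B1(1) C(2) ty_sub.simps eq ..
  with par_TLam[OF C(1)] show ?case by blast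
next
  case (TAll K A)
  let ?r = "push (LB 0) (\<lambda>l. leaf_ren Suc (r l))"
  have eq: "up (\<lambda>l. leaf_ty (r l)) = (\<lambda>l. leaf_ty (?r l))" unfolding up_def
      by (rule push_eqI[symmetric]) auto
  from TAll.prems have "par (TAll K (ty_sub (\<lambda>l. leaf_ty (?r l)) A)) B" unfolding ty_sub.simps eq .
  then obtain B1 where B1: "B = TAll K B1" "par (ty_sub (\<lambda>l. leaf_ty (?r l)) A) B1" by (rule par_TAllE)
  from TAll.IH[OF B1(2)] obtain C where C: "par A C" "B1 = ty_sub (\<lambda>l. leaf_ty (?r l)) C" by blast
  have "B = ty_sub (\<lambda>l. leaf_ty (r l)) (TAll K C)" unfolding B1(1) C(2) ty_sub.simps eq ..
  with par_TAll[OF C(1)] show ?case by blast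
next
  case (Imp A1 A2)
  from Imp.prems obtain B1 B2 where "B = Imp B1 B2" "par (ty_sub (\<lambda>l. leaf_ty (r l)) A1) B1"
    "par (ty_sub (\<lambda>l. leaf_ty (r l)) A2) B2" by (auto elim: par_ImpE)
  with Imp.IH show ?case by (metis par_Imp ty_sub.simps(7))
next
  case (TApp A1 A2)
  from TApp.prems consider
      (1) B1 B2 where "B = TApp B1 B2" "par (ty_sub (\<lambda>l. leaf_ty (r l)) A1) B1"
          "par (ty_sub (\<lambda>l. leaf_ty (r l)) A2) B2"
    | (2) A K B1 B2 where "ty_sub (\<lambda>l. leaf_ty (r l)) A1 = TLam K A" "B = inst B2 B1" "par A B1"
        "par (ty_sub (\<lambda>l. leaf_ty (r l)) A2) B2"
    unfolding ty_sub.simps by (auto elim: par_TAppE)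
  then show ?case
  proof cases
    case 1
    with TApp.IH show ?thesis by (metis par_TApp ty_sub.simps(6))
  next
    case 2
    \<comment> \<open>Only an abstraction is renamed to an abstraction, so the contracted redex was
      already present in \<open>TApp A1 A2\<close>.\<close>
    from 2(1) obtain A0 where A1: "A1 = TLam K A0" "A = ty_sub (up (\<lambda>l. leaf_ty (r l))) A0"
      by (cases A1) auto
    from 2(3) have "par (ty_sub (\<lambda>l. leaf_ty (r l)) A1) (TLam K B1)"
      unfolding A1 ty_sub.simps by (rule par_TLam)
    with TApp.IH(1) obtain C where C: "par A1 C" "TLam K B1 = ty_sub (\<lambda>l. leaf_ty (r l)) C" by blast
    from C(1) obtain C0 where C0: "C = TLam K C0" "par A0 C0" unfolding A1 by (auto elim: par_TLamE)
    from TApp.IH(2)[OF 2(4)] obtain D where D: "par A2 D" "B2 = ty_sub (\<lambda>l. leaf_ty (r l)) D" by blast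
    have "B = ty_sub (\<lambda>l. leaf_ty (r l)) (inst D C0)" using 2(2) C(2) D(2) unfolding C0 ty_sub_inst_up
        by simp
    moreover have "par (TApp A1 A2) (inst D C0)" unfolding A1 by (rule par_beta) fact+
    ultimately show ?thesis by blast
  qed
qed (metis par_leaf_ty par_refl ty_sub.simps(1-4))+

lemma pars_reflect:
  "pars (ty_sub (\<lambda>l. leaf_ty (r l)) A) B \<Longrightarrow> \<exists>B'. pars A B' \<and> B = ty_sub (\<lambda>l. leaf_ty (r l)) B'"
  by (induction rule: rtranclp_induct)
    (blast, metis par_reflect rtranclp.rtrancl_into_rtrancl)

subsection \<open>Agreement with the conversion and kinding relations\<close>

lemma inst_TVar_ty_open:
  fixes A :: "('k, 'a, 'e) ty"
  assumes "closed (ty_open 0 (TVar a) A)"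
  shows "ty_lc (Suc 0) A" "ty_open 0 (TVar a) A = inst (TVar a) A"
proof -
  let ?\<sigma> = "leaf_ty(LB 0 := TVar a) :: ('a, 'e) leaf \<Rightarrow> ('k, 'a, 'e) ty"
  have "ty_within (\<lambda>l. ty_within name (?\<sigma> l)) A"
    using assms unfolding closed_def ty_open_ty_sub[OF ty_ren.simps(3)] ty_within_ty_sub .
  moreover have "name l \<or> (\<exists>j<Suc 0. l = LB j)" if "ty_within name (?\<sigma> l)" for l
    using that by (cases "l = LB 0") auto
  ultimately show "ty_lc (Suc 0) A" unfolding ty_lc_ty_within by (rule ty_within_mono)
  then show "ty_open 0 (TVar a) A = inst (TVar a) A" by (simp add: ty_open_inst)
qed

text \<open>Passes from bodies opened with a fresh name to the bodies themselves, both for the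
  binder rules of \<open>ty_eq\<close> and for tests made with a fresh eigenvariable.\<close>

lemma inst_leaf_inj:
  fixes A B :: "('k, 'a, 'e) ty"
  assumes "joinable (inst (leaf_ty k) A) (inst (leaf_ty k) B)" "name k" "ty_within (\<lambda>l. l \<noteq> k) A"
      "ty_within (\<lambda>l. l \<noteq> k) B"
  shows "joinable A B"
proof -
  \<comment> \<open>\<open>c\<close> abstracts \<open>k\<close> again: \<open>k\<close> becomes
    index 0 and the other indices move up by one. On types without \<open>k\<close> this undoes
    \<open>inst (leaf_ty k)\<close>.\<close>
  define c :: "('a, 'e) leaf \<Rightarrow> ('k, 'a, 'e) ty" where
    "c l = (if l = k then TBound 0 else case l of LB n \<Rightarrow> TBound (Suc n) | _ \<Rightarrow> leaf_ty l)" for l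
  have *: "push (TBound 0) c l = leaf_ty l" if "l \<noteq> k" for l
    using that assms(2) by (cases l rule: leaf_cases) (auto simp: c_def)
  have "ty_sub c (inst (leaf_ty k) C) = C" if "ty_within (\<lambda>l. l \<noteq> k) C" for C :: "('k, 'a, 'e) ty"
  proof -
    have "ty_sub c (inst (leaf_ty k) C) = ty_sub (push (TBound 0) c) C" by (simp add: ty_sub_inst c_def)
    also have "\<dots> = ty_sub leaf_ty C" by (rule ty_sub_agree[OF that *])
    finally show ?thesis by simp
  qed
  with joinable_ty_sub1[OF assms(1), of c] assms(3,4) show ?thesis by simp
qed

lemma ty_within_fresh_ftv: "a \<notin> ty_ftv A \<Longrightarrow> ty_within (\<lambda>l. l \<noteq> LV a) A"
  using ty_within_ftv[OF ty_within_all, of "\<lambda>_. True" a A] by simp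

lemma ty_within_fresh_fev: "e \<notin> ty_fev A \<Longrightarrow> ty_within (\<lambda>l. l \<noteq> LX e) A"
  using ty_within_fev[OF ty_within_all, of "\<lambda>_. True" e A] by simp

lemma ty_eq_joinable: "ty_eq A B \<Longrightarrow> joinable A B \<and> closed A \<and> closed B"
proof (induction rule: ty_eq.induct)
  case (refl A) then show ?case by (simp add: ty_lc_closed)
next
  case (beta K A B)
  then have B: "closed B" and A: "ty_lc (Suc 0) A" by (auto simp: ty_lc_closed)
  have eq: "ty_open 0 B A = inst B A" by (rule ty_open_inst) (auto simp: ty_ren_closed A B)
  have "ty_within (push True name) A" using beta(1) by (simp add: ty_lc_ty_within)
  then have "closed (inst B A)" using B
    by (simp add: inst_def closed_def ty_within_ty_sub comp_push[of "ty_within name"])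
  moreover have "joinable (TApp (TLam K A) B) (inst B A)"
    by (intro pars_joinable r_into_rtranclp par_beta par_refl)
  ultimately show ?case using beta by (simp add: eq ty_lc_closed[symmetric])
next
  case (TLam a A A' K)
  note * = inst_TVar_ty_open[of a A] inst_TVar_ty_open[of a A']
  have "joinable A A'" by (rule inst_leaf_inj[of "LV a"])
      (use TLam * in \<open>auto intro: ty_within_fresh_ftv\<close>)
  then have "joinable (TLam K A) (TLam K A')" by (rule joinable_map) (rule par_TLam)
  then show ?case using TLam * by (simp add: ty_lc_closed[symmetric])
next
  case (TAll a A A' K)
  note * = inst_TVar_ty_open[of a A] inst_TVar_ty_open[of a A']
  have "joinable A A'" by (rule inst_leaf_inj[of "LV a"])
      (use TAll * in \<open>auto intro: ty_within_fresh_ftv\<close>)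
  then have "joinable (TAll K A) (TAll K A')" by (rule joinable_map) (rule par_TAll)
  then show ?case using TAll * by (simp add: ty_lc_closed[symmetric])
next
  case (TApp A A' B B')
  then show ?case by (simp add: closed_def joinable_map2[of _ _ _ _ TApp] par_TApp)
next
  case (Imp A A' B B')
  then show ?case by (simp add: closed_def joinable_map2[of _ _ _ _ Imp] par_Imp)
qed (auto intro: joinable_sym joinable_trans)

lemma closed_lc_up:
  fixes A :: "('k, 'a, 'e) ty"
  assumes "\<And>l. closed (\<sigma> l)" shows "ty_lc (Suc 0) (ty_sub (up \<sigma>) A)"
proof -
  have "ty_within (push True name) (up \<sigma> l)" for l
  proof -
    have "ty_within (push True name) B" if "closed B" for B :: "('k, 'a, 'e) ty"
      using that unfolding closed_def by (rule ty_within_mono) (auto simp: name_iff)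
    then show ?thesis using assms unfolding up_def
      by (cases l rule: leaf_cases) (simp_all add: ty_ren_closed)
  qed
  then have "ty_within (push True name) (ty_sub (up \<sigma>) A)"
    unfolding ty_within_ty_sub by (rule ty_within_all)
  then show ?thesis using ty_lc_ty_within[of 0 "TLam K (ty_sub (up \<sigma>) A)" for K] by simp
qed

lemma ty_open_up:
  assumes "\<And>l. closed (\<sigma> l)" "closed C"
  shows "ty_open 0 C (ty_sub (up \<sigma>) A) = ty_sub (push C \<sigma>) A"
  using ty_open_inst[of C "ty_sub (up \<sigma>) A"] closed_lc_up[of \<sigma> A] assms
      by (simp add: inst_up ty_ren_closed)

lemma closed_push: "closed B \<Longrightarrow> (\<And>l. closed (\<sigma> l)) \<Longrightarrow> closed (push B \<sigma> l)"
  by (cases l rule: leaf_cases) simp_all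

lemma closed_ty_sub_all: "(\<And>l. closed (\<sigma> l)) \<Longrightarrow> closed (ty_sub \<sigma> A)"
  unfolding closed_def ty_within_ty_sub by (rule ty_within_all)

lemma closed_TVar [simp]: "closed (TVar a)" and closed_EVar [simp]: "closed (EVar e)"
  by (simp_all add: closed_def)

text \<open>\<open>par\<close> goes below binders, where dangling indices arise, while
  \<open>ty_eq\<close> relates closed types only. Closing substitutions bridge the gap: below a
  binder, \<open>\<sigma>\<close> is extended with a fresh type-variable.\<close>

lemma par_ty_eq_ty_sub:
  fixes A B :: "('k, 'a, 'e) ty"
  assumes inf: "infinite (UNIV :: 'a set)"
  shows "par A B \<Longrightarrow> (\<And>l. closed (\<sigma> l)) \<Longrightarrow> ty_eq (ty_sub \<sigma> A) (ty_sub \<sigma> B)"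
proof (induction arbitrary: \<sigma> rule: par.induct)
  case (par_TLam A A' K)
  obtain a where a: "a \<notin> ty_ftv (ty_sub (up \<sigma>) A) \<union> ty_ftv (ty_sub (up \<sigma>) A')"
    using ex_new_if_finite[OF inf, of "ty_ftv (ty_sub (up \<sigma>) A) \<union> ty_ftv (ty_sub (up \<sigma>) A')"] by auto
  have "ty_eq (ty_sub (push (TVar a) \<sigma>) A) (ty_sub (push (TVar a) \<sigma>) A')"
    by (rule par_TLam.IH) (simp add: closed_push par_TLam.prems)
  then show ?case unfolding ty_sub.simps using a
    by (intro ty_eq.TLam[of a]) (simp_all add: ty_open_up par_TLam.prems)
next
  case (par_TAll A A' K)
  obtain a where a: "a \<notin> ty_ftv (ty_sub (up \<sigma>) A) \<union> ty_ftv (ty_sub (up \<sigma>) A')"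
    using ex_new_if_finite[OF inf, of "ty_ftv (ty_sub (up \<sigma>) A) \<union> ty_ftv (ty_sub (up \<sigma>) A')"] by auto
  have "ty_eq (ty_sub (push (TVar a) \<sigma>) A) (ty_sub (push (TVar a) \<sigma>) A')"
    by (rule par_TAll.IH) (simp add: closed_push par_TAll.prems)
  then show ?case unfolding ty_sub.simps using a
    by (intro ty_eq.TAll[of a]) (simp_all add: ty_open_up par_TAll.prems)
next
  case (par_beta A A' B B' K)
  obtain a where a: "a \<notin> ty_ftv (ty_sub (up \<sigma>) A) \<union> ty_ftv (ty_sub (up \<sigma>) A')"
    using ex_new_if_finite[OF inf, of "ty_ftv (ty_sub (up \<sigma>) A) \<union> ty_ftv (ty_sub (up \<sigma>) A')"] by auto
  have "ty_eq (ty_sub (push (TVar a) \<sigma>) A) (ty_sub (push (TVar a) \<sigma>) A')"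
    by (rule par_beta.IH(1)) (simp add: closed_push par_beta.prems)
  then have "ty_eq (TLam K (ty_sub (up \<sigma>) A)) (TLam K (ty_sub (up \<sigma>) A'))" using a
    by (intro ty_eq.TLam[of a]) (simp_all add: ty_open_up par_beta.prems)
  moreover have "ty_eq (ty_sub \<sigma> B) (ty_sub \<sigma> B')" by (rule par_beta.IH(2)) (rule par_beta.prems)
  ultimately have 1: "ty_eq (ty_sub \<sigma> (TApp (TLam K A) B)) (TApp (TLam K (ty_sub (up \<sigma>) A')) (ty_sub \<sigma>
      B'))"
    unfolding ty_sub.simps by (rule ty_eq.TApp)
  have B': "closed (ty_sub \<sigma> B')" by (rule closed_ty_sub_all) (rule par_beta.prems)
  have "closed (ty_sub \<sigma> (TLam K A'))" by (rule closed_ty_sub_all) (rule par_beta.prems)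
  then have "ty_eq (TApp (TLam K (ty_sub (up \<sigma>) A')) (ty_sub \<sigma> B')) (ty_open 0 (ty_sub \<sigma> B') (ty_sub
      (up \<sigma>) A'))"
    using B' by (intro ty_eq.beta) (simp_all only: ty_lc_closed ty_sub.simps)
  also have "ty_open 0 (ty_sub \<sigma> B') (ty_sub (up \<sigma>) A') = ty_sub \<sigma> (inst B' A')"
    unfolding ty_sub_inst by (rule ty_open_up[OF par_beta.prems B'])
  finally show ?case using ty_eq.trans[OF 1] by blast
next
  case (par_TApp A A' B B')
  then show ?case by (simp add: ty_eq.TApp)
next
  case (par_Imp A A' B B')
  then show ?case by (simp add: ty_eq.Imp)
qed (auto intro: ty_eq.refl simp: ty_lc_closed)

lemma pars_ty_eq:
  fixes A B :: "('k, 'a, 'e) ty"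
  assumes "infinite (UNIV :: 'a set)" "pars A B" "closed A"
  shows "ty_eq A B"
proof -
  \<comment> \<open>Indices go to an arbitrary closed type, which makes \<open>\<sigma>\<close>
    closing; names stay fixed, so closed types are unchanged.\<close>
  define \<sigma> :: "('a, 'e) leaf \<Rightarrow> ('k, 'a, 'e) ty"
      where "\<sigma> l = (if name l then leaf_ty l else TVar undefined)" for l
  have \<sigma>: "closed (\<sigma> l)" for l by (cases l) (auto simp: \<sigma>_def)
  have eq: "ty_sub \<sigma> C = C" if "closed C" for C
  proof -
    have "ty_sub \<sigma> C = ty_sub leaf_ty C" by (rule ty_sub_closed[OF that]) (simp add: \<sigma>_def)
    then show ?thesis by simp
  qed
  from assms(2,3) have "ty_eq A B \<and> closed B"
  proof (induction rule: rtranclp_induct)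
    case base then show ?case by (simp add: ty_eq.refl ty_lc_closed)
  next
    case (step B C)
    then have "closed B" "ty_eq A B" by auto
    moreover from \<open>closed B\<close> step(2) have "closed C" unfolding closed_def by (metis ty_within_par)
    moreover have "ty_eq (ty_sub \<sigma> B) (ty_sub \<sigma> C)" by (rule par_ty_eq_ty_sub[OF assms(1) step(2) \<sigma>])
    ultimately show ?case by (metis eq ty_eq.trans)
  qed
  then show ?thesis by blast
qed

lemma joinable_ty_eq:
  fixes A B :: "('k, 'a, 'e) ty"
  assumes "infinite (UNIV :: 'a set)" "joinable A B" "closed A" "closed B"
  shows "ty_eq A B"
  using assms unfolding joinable_def by (meson pars_ty_eq ty_eq.sym ty_eq.trans)

section \<open>Kinding judgements and computed kinds\<close>

fun kind_env :: "('a + 'e \<rightharpoonup> 'k kind) \<Rightarrow> ('a, 'e) leaf \<Rightarrow> 'k kind option" where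
  "kind_env \<xi> (LV a) = \<xi> (Inl a)" | "kind_env \<xi> (LX e) = \<xi> (Inr e)" | "kind_env \<xi> _ = None"

lemma kind_env_name: "kind_env \<xi> l \<noteq> None \<Longrightarrow> name l" by (cases l) auto

lemma kind_of_kind_env_closed: "kind_of (kind_env \<xi>) A = Some K \<Longrightarrow> closed A"
  unfolding closed_def by (erule kind_of_ty_within[THEN ty_within_mono]) (rule kind_env_name)

lemma kind_of_open_fresh:
  assumes "a \<notin> ty_ftv A"
  shows "kind_of (kind_env (\<xi>(Inl a \<mapsto> K))) (ty_open 0 (TVar a) A) =
      kind_of (push (Some K) (kind_env \<xi>)) A"
proof -
  have *: "kind_of (kind_env (\<xi>(Inl a \<mapsto> K))) ((leaf_ty(LB 0 := TVar a)) l) =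
      push (Some K) (kind_env \<xi>) l" if "l \<noteq> LV a" for l
    using that by (cases l rule: leaf_cases) simp_all
  have "ty_within (\<lambda>l. l \<noteq> LV a) A" using assms by (rule ty_within_fresh_ftv)
  then show ?thesis unfolding ty_open_ty_sub[OF ty_ren.simps(3)] kind_of_ty_sub
      by (rule kind_of_agree) (use * in blast)
qed

lemma kinding_kind_of: "kinding \<xi> A K \<Longrightarrow> kind_of (kind_env \<xi>) A = Some K"
proof (induction rule: kinding.induct)
  case (TApp \<xi> A K J B) then show ?case unfolding kind_of_TApp_Some by blast
qed (simp_all add: kind_of_open_fresh del: fun_upd_apply)

lemma size_ty_open_TVar: "size (ty_open k (TVar a) A) = size A"
  by (induction A arbitrary: k) auto

text \<open>An opened body is not a subterm, hence the induction on size; a finite domain leaves a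
  fresh type-variable for each binder.\<close>

lemma kind_of_kinding:
  fixes A :: "('k, 'a, 'e) ty"
  assumes inf: "infinite (UNIV :: 'a set)"
  shows "finite (dom \<xi>) \<Longrightarrow> kind_of (kind_env \<xi>) A = Some K \<Longrightarrow> kinding \<xi> A K"
proof (induction A arbitrary: \<xi> K rule: measure_induct_rule[of size])
  case (less A)
  have fresh: "\<exists>a. Inl a \<notin> dom \<xi> \<and> a \<notin> ty_ftv A1" for A1 :: "('k, 'a, 'e) ty"
    using ex_new_if_finite[OF inf, of "Inl -` dom \<xi> \<union> ty_ftv A1"] less.prems(1)
    by (auto simp: finite_vimageI)
  show ?case
  proof (cases A)
    case (TLam K1 A1)
    then obtain J where J: "K = KFun K1 J" "kind_of (push (Some K1) (kind_env \<xi>)) A1 = Some J"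
      using less.prems(2) by auto
    obtain a where a: "Inl a \<notin> dom \<xi>" "a \<notin> ty_ftv A1" using fresh by blast
    have "kinding (\<xi>(Inl a \<mapsto> K1)) (ty_open 0 (TVar a) A1) J"
      by (rule less.IH) (simp_all add: TLam size_ty_open_TVar less.prems(1) kind_of_open_fresh a J
          del: fun_upd_apply)
    with a show ?thesis unfolding TLam J by (intro kinding.TLam)
  next
    case (TAll K1 A1)
    then have J: "K = KProp" "kind_of (push (Some K1) (kind_env \<xi>)) A1 = Some KProp"
      using less.prems(2) by (auto split: if_splits)
    obtain a where a: "Inl a \<notin> dom \<xi>" "a \<notin> ty_ftv A1" using fresh by blast
    have "kinding (\<xi>(Inl a \<mapsto> K1)) (ty_open 0 (TVar a) A1) KProp"
      by (rule less.IH) (simp_all add: TAll size_ty_open_TVar less.prems(1) kind_of_open_fresh a J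
          del: fun_upd_apply)
    with a show ?thesis unfolding TAll J by (intro kinding.TAll)
  next
    case (TApp A1 A2)
    then obtain J where "kind_of (kind_env \<xi>) A1 = Some (KFun J K)" "kind_of (kind_env \<xi>) A2 = Some J"
      using less.prems(2) unfolding TApp kind_of_TApp_Some by blast
    then show ?thesis unfolding TApp
      by (intro kinding.TApp[of _ _ J]; intro less.IH) (simp_all add: TApp less.prems(1))
  next
    case (Imp A1 A2)
    then have "K = KProp" "kind_of (kind_env \<xi>) A1 = Some KProp" "kind_of (kind_env \<xi>) A2 = Some KProp"
      using less.prems(2) by (auto split: if_splits)
    then show ?thesis unfolding Imp
      by (simp only:) (intro kinding.Imp; intro less.IH; simp add: Imp less.prems(1))
  qed (use less.prems in \<open>auto intro: kinding.intros\<close>)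
qed

text \<open>Computed kinds survive enlarging the environment, so the finite part chosen by
  \<open>gkinding\<close> gives way to all of \<Xi>, which all types can share.\<close>

lemma gkinding_kind_of: "gkinding \<Xi> A K \<Longrightarrow> kind_of (kind_env (\<lambda>v. Some (\<Xi> v))) A = Some K"
  unfolding gkinding_def sub_kenv_def
proof (elim exE conjE)
  fix \<xi> assume \<xi>: "\<forall>v K. \<xi> v = Some K \<longrightarrow> \<Xi> v = K" and "kinding \<xi> A K"
  from kinding_kind_of[OF this(2)] show ?thesis
  proof (rule kind_of_mono)
    fix l show "kind_env \<xi> l \<noteq> None \<Longrightarrow> kind_env (\<lambda>v. Some (\<Xi> v)) l = kind_env \<xi> l"
      using \<xi> by (cases l) fastforce+
  qed
qed

subsection \<open>The model\<close>

text \<open>Points are observations on a metaterm: it evaluates to \<open>\<star>\<close>; it is \<open>gen\<^sub>A\<close>; applied to an argument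
  having all points in \<open>S\<close>, it has the point \<open>\<tau>\<close>; applied to the type \<open>B\<close>, it has the point \<open>\<tau>\<close>.\<close>

datatype ('k, 'a, 'e) point =
    PStar
  | At "('k, 'a, 'e) ty"
  | PFun "('k, 'a, 'e) point cset" "('k, 'a, 'e) point"
  | PTFun "('k, 'a, 'e) ty" "('k, 'a, 'e) point"

definition fapp :: "('k, 'a, 'e) point set \<Rightarrow> ('k, 'a, 'e) point set \<Rightarrow> ('k, 'a, 'e) point set" where
  "fapp X Y = {\<tau>. \<exists>S. PFun S \<tau> \<in> X \<and> rcset S \<subseteq> Y}"

lemma fapp_mono: "X \<subseteq> X' \<Longrightarrow> Y \<subseteq> Y' \<Longrightarrow> fapp X Y \<subseteq> fapp X' Y'"
  unfolding fapp_def by blast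

text \<open>The tests on \<open>\<nu>a:K\<close> range over the sample \<open>E K\<close>. It has to be countable: a test may then use
  infinitely many points of an argument, but countably many suffice.\<close>

locale model =
  fixes \<Xi> :: "'a + 'e \<Rightarrow> 'k kind" and E :: "'k kind \<Rightarrow> 'e set"
  assumes E_kind: "e \<in> E K \<Longrightarrow> \<Xi> (Inr e) = K"
    and E_countable: "countable (E K)"
    and E_infinite: "infinite (E K)"
begin

abbreviation gkind :: "('k, 'a, 'e) ty \<Rightarrow> 'k kind option" where
  "gkind \<equiv> kind_of (kind_env (\<lambda>v. Some (\<Xi> v)))"

text \<open>The kind of \<open>A\<close> is checked because \<open>root_beta\<close> may contract a type redex that \<open>root_red\<close> refuses;
  with the check such a redex, and every application to an ill-kinded type, has no points.\<close>

definition tapp :: "('k, 'a, 'e) point set \<Rightarrow> ('k, 'a, 'e) ty \<Rightarrow> ('k, 'a, 'e) point set" where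
  "tapp X A = {\<tau>. \<exists>B K. PTFun B \<tau> \<in> X \<and> joinable B A \<and> gkind A = Some K \<and> gkind B = Some K}"

lemma tapp_mono: "X \<subseteq> X' \<Longrightarrow> tapp X A \<subseteq> tapp X' A"
  unfolding tapp_def by blast

text \<open>\<open>G A\<close> holds of the points of \<open>gen\<^sub>A\<close>, and \<open>V A X\<close> if \<open>ver\<^sub>A(M)\<close> evaluates to \<open>\<star>\<close> as soon as \<open>M\<close>
  has all points in \<open>X\<close>. \<open>G_At\<close> and \<open>V_At\<close> are not limited to types headed
      by an eigenvariable: the extra
  points are harmless, since reduction only has to be sound for expansion.\<close>

inductive G :: "('k, 'a, 'e) ty \<Rightarrow> ('k, 'a, 'e) point \<Rightarrow> bool"
  and V :: "('k, 'a, 'e) ty \<Rightarrow> ('k, 'a, 'e) point set \<Rightarrow> bool" where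
  G_At: "joinable A A' \<Longrightarrow> G A (At A')"
| G_Imp: "pars A (Imp B C) \<Longrightarrow> V B (rcset S) \<Longrightarrow> G C \<tau> \<Longrightarrow> G A (PFun S \<tau>)"
| G_All: "pars A (TAll K C) \<Longrightarrow> gkind B = Some K \<Longrightarrow> G (inst B C) \<tau> \<Longrightarrow> G A (PTFun B \<tau>)"
| V_At: "At A' \<in> X \<Longrightarrow> joinable A A' \<Longrightarrow> V A X"
| V_Imp: "pars A (Imp B C) \<Longrightarrow> V C Y \<Longrightarrow>
    (\<And>\<tau>. \<tau> \<in> Y \<Longrightarrow> \<exists>S. PFun S \<tau> \<in> X \<and> (\<forall>\<sigma>\<in>rcset S. G B \<sigma>)) \<Longrightarrow> V A X"
| V_All: "pars A (TAll K C) \<Longrightarrow> finite L \<Longrightarrow> (\<And>e. e \<in> E K - L \<Longrightarrow> V (inst (EVar e) C) (Y e)) \<Longrightarrow>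
    (\<And>e. e \<in> E K - L \<Longrightarrow> Y e \<subseteq> tapp X (EVar e)) \<Longrightarrow> V A X"

inductive_cases G_AtE: "G A (At A')"
inductive_cases G_PFunE: "G A (PFun S \<tau>)"
inductive_cases G_PTFunE: "G A (PTFun B \<tau>)"

text \<open>Ensures that a condition on all but finitely many members of \<open>E K\<close> is never
  vacuous.\<close>

lemma E_fresh: "finite L \<Longrightarrow> \<exists>e. e \<in> E K - L"
  using E_infinite[of K] by (metis Diff_eq_empty_iff finite_subset subsetI ex_in_conv)

lemma V_mono: "V A X \<Longrightarrow> X \<subseteq> X' \<Longrightarrow> V A X'"
proof -
  assume "V A X" "X \<subseteq> X'"
  then show "V A X'"
  proof (cases rule: V.cases)
    case (V_At A')
    then show ?thesis using \<open>X \<subseteq> X'\<close> by (blast intro: G_V.V_At)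
  next
    case (V_Imp B C Y)
    then show ?thesis using \<open>X \<subseteq> X'\<close> by (intro G_V.V_Imp[OF V_Imp(1,2)]) blast
  next
    case (V_All K C L Y)
    show ?thesis
      by (rule G_V.V_All[OF V_All(1,2), of Y], erule V_All(3))
        (use V_All(4) tapp_mono[OF \<open>X \<subseteq> X'\<close>] in blast)
  qed
qed

text \<open>Takes the largest \<open>Y\<close> that the last premise of \<open>V_Imp\<close> admits;
  this is the reduction of \<open>ver\<close> at an implication, read in the model.\<close>

lemma V_fapp: "V C (fapp X {\<sigma>. G B \<sigma>}) \<Longrightarrow> V (Imp B C) X"
  by (rule V_Imp[OF rtranclp.rtrancl_refl]) (auto simp: fapp_def)

text \<open>Every test inspects at least one point, at a quantified type because the sample is
  infinite. A metaterm without points therefore passes no test.\<close>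

lemma V_nonempty: "V A X \<Longrightarrow> X \<noteq> {}"
proof -
  \<comment> \<open>The trivial claim about \<open>G\<close> is only there to fit the mutual
    induction rule.\<close>
  have "G A \<tau> \<Longrightarrow> True" and "V A X \<Longrightarrow> X \<noteq> {}" for \<tau>
  proof (induction rule: G_V.inducts)
    case (V_All A K C L Y X)
    then obtain e where "e \<in> E K - L" using E_fresh by blast
    with V_All show ?case unfolding tapp_def by blast
  qed auto
  then show "V A X \<Longrightarrow> X \<noteq> {}" by blast
qed

text \<open>The rules see \<open>A\<close> only through \<open>joinable\<close> and through reducts
  of the forms \<open>Imp B C\<close> and \<open>TAll K C\<close>, and such reducts can be matched
  along joinability.\<close>

lemma G_V_joinable:
  "G A \<tau> \<Longrightarrow> joinable A A' \<Longrightarrow> G A' \<tau>"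
  "V A X \<Longrightarrow> joinable A A' \<Longrightarrow> V A' X"
proof (induction arbitrary: A' and A' rule: G_V.inducts)
  case (G_At A A1) then show ?case by (blast intro: G_V.G_At joinable_trans joinable_sym)
next
  case (G_Imp A B C S \<tau>)
  from joinable_ImpD[OF G_Imp.prems G_Imp.hyps(1)] show ?case using G_Imp.IH G_V.G_Imp by blast
next
  case (G_All A K C B \<tau>)
  from joinable_TAllD[OF G_All.prems G_All.hyps(1)] obtain C'
      where *: "pars A' (TAll K C')" "joinable C C'" by blast
  show ?case
    by (rule G_V.G_All[OF *(1)]) (use G_All joinable_inst[OF *(2) joinable_refl] in blast)+
next
  case (V_At A1 X A) then show ?case by (blast intro: G_V.V_At joinable_trans joinable_sym)
next
  case (V_Imp A B C Y X)
  from joinable_ImpD[OF V_Imp.prems V_Imp.hyps(1)] obtain B' C' where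
    *: "pars A' (Imp B' C')" "joinable B B'" "joinable C C'" by blast
  show ?case
    by (rule G_V.V_Imp[OF *(1)]) (use V_Imp.IH *(2,3) in blast)+
next
  case (V_All A K C L Y X)
  from joinable_TAllD[OF V_All.prems V_All.hyps(1)] obtain C'
      where *: "pars A' (TAll K C')" "joinable C C'" by blast
  show ?case
    by (rule G_V.V_All[OF *(1) V_All.hyps(2), of Y])
        (use V_All.IH V_All.hyps *(2) joinable_inst joinable_refl in blast)+
qed

text \<open>At an implication, one point of \<open>X\<close> is chosen for each of countably many
  points of the codomain test. At a quantified type the supports for the individual eigenvariables
  are united, which stays countable because the sample is.\<close>

lemma V_continuous: "V A X \<Longrightarrow> \<exists>S. countable S \<and> S \<subseteq> X \<and> V A S"
proof -
  have "G A \<tau> \<Longrightarrow> True" and "V A X \<Longrightarrow> \<exists>S. countable S \<and> S \<subseteq> X \<and> V A S" for \<tau>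
  proof (induction rule: G_V.inducts)
    case (V_At A' X A)
    then show ?case by (intro exI[of _ "{At A'}"]) (auto intro: G_V.V_At)
  next
    case (V_Imp A B C Y X)
    then obtain Y0 where Y0: "countable Y0" "Y0 \<subseteq> Y" "V C Y0" by blast
    from V_Imp have "\<forall>\<tau>\<in>Y0. \<exists>S. PFun S \<tau> \<in> X \<and> (\<forall>\<sigma>\<in>rcset S. G B \<sigma>)" using Y0(2) by blast
    then obtain S where S: "\<And>\<tau>. \<tau> \<in> Y0 \<Longrightarrow> PFun (S \<tau>) \<tau> \<in> X \<and> (\<forall>\<sigma>\<in>rcset (S \<tau>). G B \<sigma>)" by metis
    have "V A ((\<lambda>\<tau>. PFun (S \<tau>) \<tau>) ` Y0)"
      by (rule G_V.V_Imp[OF V_Imp.hyps(1) Y0(3)]) (use S in blast)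
    with Y0 S show ?case by (intro exI[of _ "(\<lambda>\<tau>. PFun (S \<tau>) \<tau>) ` Y0"]) auto
  next
    case (V_All A K C L Y X)
    then obtain Y0 where Y0:
        "\<And>e. e \<in> E K - L \<Longrightarrow> countable (Y0 e) \<and> Y0 e \<subseteq> Y e \<and> V (inst (EVar e) C) (Y0 e)"
      by metis
    have "\<forall>e\<in>E K - L. \<forall>\<tau>\<in>Y0 e. \<exists>B. PTFun B \<tau> \<in> X \<and> joinable B (EVar e) \<and> gkind B = gkind (EVar e)"
      using Y0 V_All.IH(3) unfolding tapp_def by (simp add: subset_iff)
    then obtain B where B: "\<And>e \<tau>. e \<in> E K - L \<Longrightarrow> \<tau> \<in> Y0 e \<Longrightarrow>
      PTFun (B e \<tau>) \<tau> \<in> X \<and> joinable (B e \<tau>) (EVar e) \<and> gkind (B e \<tau>) = gkind (EVar e)" by metis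
    let ?S = "\<Union>e\<in>E K - L. (\<lambda>\<tau>. PTFun (B e \<tau>) \<tau>) ` Y0 e"
    have "V A ?S"
    proof (rule G_V.V_All[OF V_All.hyps(1,2), of Y0])
      fix e assume e: "e \<in> E K - L"
      then show "V (inst (EVar e) C) (Y0 e)" using Y0 by blast
      show "Y0 e \<subseteq> tapp ?S (EVar e)"
        using B[OF e] e unfolding tapp_def by fastforce
    qed
    moreover have "countable ?S"
      using Y0 by (intro countable_UN countable_image) (auto intro: countable_subset[OF _ E_countable])
    moreover have "?S \<subseteq> X" using B by blast
    ultimately show ?case by blast
  qed auto
  then show "V A X \<Longrightarrow> ?thesis" by blast
qed

text \<open>\<open>V_G\<close> is proved by induction on \<open>V\<close>, but at a point \<open>PFun S \<tau>\<close> of \<open>G D\<close> it is needed for the unrelated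
  test on \<open>S\<close>. It is therefore first relativised to points that satisfy it hereditarily.\<close>

primrec sound :: "('k, 'a, 'e) point \<Rightarrow> bool" where
  "sound PStar = True"
| "sound (At A) = True"
| "sound (PFun S \<tau>) \<longleftrightarrow> (\<forall>b\<in>rcset (cimage sound S). b) \<and> sound \<tau> \<and>
    (\<forall>A D. V A (rcset S) \<longrightarrow> (\<forall>\<sigma>\<in>rcset S. G D \<sigma>) \<longrightarrow> joinable A D)"
| "sound (PTFun B \<tau>) \<longleftrightarrow> sound \<tau>"

text \<open>The type under test and the type that generated the points are compared along the
  derivation of \<open>V\<close>. Codomains follow from the induction hypothesis, domains from the
  soundness of a single function point.\<close>

lemma V_G_sound: "V A X \<Longrightarrow> \<forall>\<tau>\<in>X. sound \<tau> \<Longrightarrow> \<forall>\<tau>\<in>X. G D \<tau> \<Longrightarrow> joinable A D"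
proof -
  have "G A \<tau> \<Longrightarrow> True" and "V A X \<Longrightarrow> \<forall>\<tau>\<in>X. sound \<tau> \<Longrightarrow> \<forall>\<tau>\<in>X. G D \<tau> \<Longrightarrow> joinable A D" for \<tau>
  proof (induction arbitrary: and D rule: G_V.inducts)
    case (V_At A' X A)
    then show ?case by (meson G_AtE joinable_sym joinable_trans)
  next
    case (V_Imp A B C Y X)
    have "Y \<noteq> {}" using V_nonempty V_Imp.IH(1) by blast
    then obtain \<tau> S where \<tau>: "PFun S \<tau> \<in> X" "\<forall>\<sigma>\<in>rcset S. G B \<sigma>" using V_Imp.IH(3) by blast
    with V_Imp.prems have "G D (PFun S \<tau>)" by blast
    then obtain B1 C1 where D: "pars D (Imp B1 C1)" "V B1 (rcset S)" by (auto elim: G_PFunE)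
    \<comment> \<open>Roles are exchanged in the domain: the points in \<open>S\<close> belong to
      \<open>gen\<close> at \<open>B\<close> and pass the test at \<open>B1\<close>. This is exactly
      the situation recorded in \<open>sound (PFun S \<tau>)\<close>.\<close>
    have "joinable B1 B" using V_Imp.prems(1) \<tau> D(2) by (auto dest: bspec[of X])
    have "joinable C C1"
    proof (rule V_Imp.IH(2); intro ballI)
      fix \<upsilon> assume "\<upsilon> \<in> Y"
      then obtain S' where S': "PFun S' \<upsilon> \<in> X" using V_Imp.IH(3) by blast
      with V_Imp.prems show "sound \<upsilon>" by (auto dest: bspec[of X])
      from S' V_Imp.prems have "G D (PFun S' \<upsilon>)" by blast
      then obtain B2 C2 where D2: "pars D (Imp B2 C2)" "G C2 \<upsilon>" by (auto elim: G_PFunE)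
      have "joinable (Imp B2 C2) (Imp B1 C1)" using pars_joinable[OF D(1)] pars_joinable[OF D2(1)]
          by (meson joinable_sym joinable_trans)
      with D2(2) show "G C1 \<upsilon>" using G_V_joinable(1) joinable_Imp_Imp by blast
    qed
    with \<open>joinable B1 B\<close> have "joinable (Imp B C) (Imp B1 C1)"
        by (intro joinable_map2[of _ _ _ _ Imp]) (auto intro: joinable_sym par_Imp)
    with V_Imp.hyps(1) D(1) show ?case by (meson joinable_sym joinable_trans pars_joinable)
  next
    case (V_All A K C L Y X)
    have wit: "\<exists>\<tau> B. \<tau> \<in> Y e \<and> PTFun B \<tau> \<in> X \<and> joinable B (EVar e) \<and> gkind B = Some K"
        if "e \<in> E K - L" for e
    proof -
      have "Y e \<noteq> {}" using V_nonempty V_All.IH(1) that by blast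
      then show ?thesis using V_All.IH(3)[OF that] E_kind[of e K] that unfolding tapp_def by auto
    qed
    obtain e0 where e0: "e0 \<in> E K - L" using V_All.hyps(2) E_fresh by blast
    from wit[OF e0] obtain \<tau> B where "PTFun B \<tau> \<in> X" "gkind B = Some K" by blast
    with V_All.prems(2) have "G D (PTFun B \<tau>)" by blast
    \<comment> \<open>The kind of \<open>B\<close> ensures that \<open>D\<close> quantifies over the
      same kind \<open>K\<close>.\<close>
    then obtain C1 where D: "pars D (TAll K C1)" using \<open>gkind B = Some K\<close> by (auto elim: G_PTFunE)
    \<comment> \<open>The test holds for almost all eigenvariables, so one may be chosen outside
      both bodies and then abstracted again.\<close>
    obtain e where e: "e \<in> E K - L" "e \<notin> ty_fev C" "e \<notin> ty_fev C1"
      using E_fresh[of "L \<union> ty_fev C \<union> ty_fev C1"] V_All.hyps(2) by auto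
    have "joinable (inst (EVar e) C) (inst (EVar e) C1)"
    proof (rule V_All.IH(2)[OF e(1)]; intro ballI)
      fix \<upsilon> assume "\<upsilon> \<in> Y e"
      then obtain B where B: "PTFun B \<upsilon> \<in> X" "joinable B (EVar e)" using V_All.IH(3)[OF e(1)]
          unfolding tapp_def by blast
      with V_All.prems show "sound \<upsilon>" by (auto dest: bspec[of X])
      from B V_All.prems have "G D (PTFun B \<upsilon>)" by blast
      then obtain K2 C2 where D2: "pars D (TAll K2 C2)" "G (inst B C2) \<upsilon>" by (auto elim: G_PTFunE)
      have "joinable (TAll K2 C2) (TAll K C1)" using pars_joinable[OF D] pars_joinable[OF D2(1)]
          by (meson joinable_sym joinable_trans)
      then have "joinable C2 C1" using joinable_TAll_TAll by blast
      with D2(2) show "G (inst (EVar e) C1) \<upsilon>" using G_V_joinable(1) joinable_inst B(2) by blast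
    qed
    then have "joinable C C1" by (rule inst_leaf_inj[of "LX e", unfolded leaf_ty.simps])
        (use e in \<open>auto intro: ty_within_fresh_fev\<close>)
    then have "joinable (TAll K C) (TAll K C1)" by (rule joinable_map) (rule par_TAll)
    with V_All.hyps(1) D show ?case by (meson joinable_sym joinable_trans pars_joinable)
  qed auto
  then show "V A X \<Longrightarrow> \<forall>\<tau>\<in>X. sound \<tau> \<Longrightarrow> \<forall>\<tau>\<in>X. G D \<tau> \<Longrightarrow> joinable A D" by blast
qed

text \<open>The nested induction hypothesis covers all members of \<open>S\<close>;
  \<open>cimage.rep_eq\<close> brings the clause of \<open>sound\<close>, written with
  \<open>cimage\<close> for the sake of primitive recursion, into that form.\<close>

lemma all_sound: "sound \<tau>"
proof (induction \<tau>)
  case (PFun S \<tau>)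
  then show ?case using V_G_sound by (simp add: cimage.rep_eq)
qed auto

lemma V_G: "V A X \<Longrightarrow> X \<subseteq> {\<tau>. G D \<tau>} \<Longrightarrow> joinable A D"
  using V_G_sound all_sound by blast

end

subsection \<open>Free leaves of metaterms\<close>

text \<open>\<open>Z\<close> bounds the leaves of types and \<open>W\<close> the term
  indices.\<close>

primrec m_within :: "(('a, 'e) leaf \<Rightarrow> bool) \<Rightarrow> (nat \<Rightarrow> bool) \<Rightarrow> ('k, 'a, 'e, 'x) mterm \<Rightarrow> bool" where
  "m_within Z W (BVar j) = W j"
| "m_within Z W (Var x) = True"
| "m_within Z W (Lam M) = m_within Z (case_nat True W) M"
| "m_within Z W (App M N) = (m_within Z W M \<and> m_within Z W N)"
| "m_within Z W (LamT K M) = m_within (push True Z) W M"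
| "m_within Z W (AppT M A) = (m_within Z W M \<and> ty_within Z A)"
| "m_within Z W Star = True"
| "m_within Z W (Guard M N) = (m_within Z W M \<and> m_within Z W N)"
| "m_within Z W (Gen A) = ty_within Z A"
| "m_within Z W (Ver A M) = (ty_within Z A \<and> m_within Z W M)"
| "m_within Z W (Nu K M) = m_within (epush True Z) W M"

definition mclosed :: "('k, 'a, 'e, 'x) mterm \<Rightarrow> bool" where
  "mclosed M \<longleftrightarrow> m_within name (\<lambda>_. False) M"

lemma case_nat_upd: "(case_nat v W)(Suc k := u) = case_nat v (W(k := u))"
  by (auto split: nat.split)

lemma push_upd: "(push v f)(LB (Suc k) := u) = push v (f(LB k := u))"
  by (rule push_eqI) auto
lemma push_upd_LE: "(push v f)(LE k := u) = push v (f(LE k := u))"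
  by (rule push_eqI) auto
lemma epush_upd: "(epush v f)(LE (Suc k) := u) = epush v (f(LE k := u))"
  by (rule epush_eqI) auto
lemma epush_upd_LB: "(epush v f)(LB k := u) = epush v (f(LB k := u))"
  by (rule epush_eqI) auto

lemma push_name [simp]: "name l \<Longrightarrow> push v f l = f l" by (cases l) auto
lemma epush_name [simp]: "name l \<Longrightarrow> epush v f l = f l" by (cases l) auto

lemma ty_within_closed: "closed A \<Longrightarrow> (\<And>l. name l \<Longrightarrow> Z l = Z' l) \<Longrightarrow> ty_within Z A = ty_within Z' A"
proof -
  have "ty_within Z A \<longleftrightarrow> ty_within (\<lambda>l. Z l \<and> name l) A" if "closed A" for Z
  proof -
    have "ty_within P A \<Longrightarrow> ty_within Q A \<Longrightarrow> ty_within (\<lambda>l. P l \<and> Q l) A" for P Q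
    proof (induction A arbitrary: P Q)
      case (TLam K A)
      have eq: "push True (\<lambda>l. P l \<and> Q l) = (\<lambda>l. push True P l \<and> push True Q l)"
        by (rule push_eqI[symmetric]) auto
      show ?case using TLam.IH[of "push True P" "push True Q"] TLam.prems
          by (simp only: ty_within.simps eq)
    next
      case (TAll K A)
      have eq: "push True (\<lambda>l. P l \<and> Q l) = (\<lambda>l. push True P l \<and> push True Q l)"
        by (rule push_eqI[symmetric]) auto
      show ?case using TAll.IH[of "push True P" "push True Q"] TAll.prems
          by (simp only: ty_within.simps eq)
    qed auto
    then show ?thesis using that unfolding closed_def by (auto elim: ty_within_mono)
  qed
  moreover assume "closed A" "\<And>l. name l \<Longrightarrow> Z l = Z' l"
  moreover from this(2) have "(\<lambda>l. Z l \<and> name l) = (\<lambda>l. Z' l \<and> name l)" by auto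
  ultimately show ?thesis by metis
qed

lemma m_within_mono:
  "m_within Z W M \<Longrightarrow> (\<And>l. Z l \<Longrightarrow> Z' l) \<Longrightarrow> (\<And>j. W j \<Longrightarrow> W' j) \<Longrightarrow> m_within Z' W' M"
proof (induction M arbitrary: Z Z' W W')
  case (Lam M)
  show ?case unfolding m_within.simps
    by (rule Lam.IH[OF Lam.prems(1)[unfolded m_within.simps] Lam.prems(2)])
      (auto split: nat.splits intro: Lam.prems(3))
next
  case (LamT K M)
  show ?case unfolding m_within.simps
    by (rule LamT.IH[OF LamT.prems(1)[unfolded m_within.simps] _ LamT.prems(3)])
      (auto elim!: push_mono[rotated] intro: LamT.prems(2))
next
  case (Nu K M)
  show ?case unfolding m_within.simps
    by (rule Nu.IH[OF Nu.prems(1)[unfolded m_within.simps] _ Nu.prems(3)])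
      (auto elim!: epush_mono[rotated] intro: Nu.prems(2))
next
  case (App M N) then show ?case unfolding m_within.simps by blast
next
  case (Guard M N) then show ?case unfolding m_within.simps by blast
next
  case (AppT M A) then show ?case unfolding m_within.simps by (blast intro: ty_within_mono)
next
  case (Ver A M) then show ?case unfolding m_within.simps by (blast intro: ty_within_mono)
next
  case (Gen A) then show ?case unfolding m_within.simps by (blast intro: ty_within_mono)
qed auto

lemma m_within_free:
  "m_within Z W M \<Longrightarrow>
   m_within (\<lambda>l. Z l \<and> (\<forall>a. l = LV a \<longrightarrow> a \<in> m_ftv M) \<and> (\<forall>e. l = LX e \<longrightarrow> e \<in> m_fev M)) W M"
proof -
  have "m_within Z W M \<Longrightarrow> m_ftv M \<subseteq> P \<Longrightarrow> m_fev M \<subseteq> Q \<Longrightarrow>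
     m_within (\<lambda>l. Z l \<and> (\<forall>a. l = LV a \<longrightarrow> a \<in> P) \<and> (\<forall>e. l = LX e \<longrightarrow> e \<in> Q)) W M" for P Q
  proof (induction M arbitrary: Z W)
    case (LamT K M)
    have eq: "push True (\<lambda>l. Z l \<and> (\<forall>a. l = LV a \<longrightarrow> a \<in> P) \<and> (\<forall>e. l = LX e \<longrightarrow> e \<in> Q)) =
      (\<lambda>l. push True Z l \<and> (\<forall>a. l = LV a \<longrightarrow> a \<in> P) \<and> (\<forall>e. l = LX e \<longrightarrow> e \<in> Q))"
      by (rule push_eqI[symmetric]) auto
    show ?case using LamT.IH[of "push True Z"] LamT.prems
        by (simp only: m_within.simps m_ftv.simps m_fev.simps eq)
  next
    case (Nu K M)
    have eq: "epush True (\<lambda>l. Z l \<and> (\<forall>a. l = LV a \<longrightarrow> a \<in> P) \<and> (\<forall>e. l = LX e \<longrightarrow> e \<in> Q)) =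
      (\<lambda>l. epush True Z l \<and> (\<forall>a. l = LV a \<longrightarrow> a \<in> P) \<and> (\<forall>e. l = LX e \<longrightarrow> e \<in> Q))"
      by (rule epush_eqI[symmetric]) auto
    show ?case using Nu.IH[of "epush True Z"] Nu.prems
        by (simp only: m_within.simps m_ftv.simps m_fev.simps eq)
  qed (auto elim!: ty_within_free[THEN ty_within_mono])
  then show "m_within Z W M \<Longrightarrow> ?thesis" by blast
qed

lemma ty_within_open:
  fixes A B :: "('k, 'a, 'e) ty"
  assumes "ty_ren Suc A = A"
  shows "ty_within Z (ty_open k A B) = ty_within (Z(LB k := ty_within Z A)) B"
proof -
  have "(\<lambda>l. ty_within Z ((leaf_ty(LB k := A)) l)) = Z(LB k := ty_within Z A)" by auto
  then show ?thesis by (simp only: ty_open_ty_sub[OF assms] ty_within_ty_sub)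
qed

lemma ty_within_eopen:
  fixes B :: "('k, 'a, 'e) ty"
  shows "ty_within Z (ty_eopen k d B) = ty_within (Z(LE k := Z (LX d))) B"
proof -
  let ?\<sigma> = "leaf_ty(LE k := EVar d) :: ('a, 'e) leaf \<Rightarrow> ('k, 'a, 'e) ty"
  have "(\<lambda>l. ty_within Z (?\<sigma> l)) = Z(LE k := Z (LX d))" by auto
  then show ?thesis by (simp only: ty_eopen_ty_sub ty_within_ty_sub)
qed

lemma m_within_topen:
  assumes "closed A"
  shows "m_within Z W (m_topen k A M) = m_within (Z(LB k := ty_within Z A)) W M"
proof -
  have [simp]: "ty_within (push True Z) A = ty_within Z A"
      "ty_within (epush True Z) A = ty_within Z A" for Z
    by (rule ty_within_closed[OF assms]; simp)+
  show ?thesis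
    by (induction M arbitrary: k Z W)
      (simp_all add: ty_within_open ty_ren_closed assms push_upd epush_upd_LB del: fun_upd_apply)
qed

lemma m_within_eopen: "m_within Z W (m_eopen k d M) = m_within (Z(LE k := Z (LX d))) W M"
  by (induction M arbitrary: k Z W)
    (simp_all add: ty_within_eopen epush_upd push_upd_LE del: fun_upd_apply)

lemma m_within_open_Var: "m_within Z W (m_open k (Var x) M) = m_within Z (W(k := True)) M"
  by (induction M arbitrary: k Z W) (simp_all add: case_nat_upd del: fun_upd_apply, simp)

text \<open>A closed \<open>P\<close> satisfies every bound that admits all names, so it may be
  inserted unchanged below binders.\<close>

lemma m_within_open:
  assumes "mclosed P"
  shows "(\<And>l. name l \<Longrightarrow> Z l) \<Longrightarrow> m_within Z (W(k := True)) M \<Longrightarrow> m_within Z W (m_open k P M)"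
proof (induction M arbitrary: k Z W)
  case (BVar j)
  have "m_within Z W P" using assms unfolding mclosed_def by (rule m_within_mono) (use BVar in auto)
  then show ?case using BVar by auto
qed (simp_all add: case_nat_upd del: fun_upd_apply)

text \<open>The binder equations hold for any opening name, because a closed metaterm may contain
  every name.\<close>

lemma mclosed_simps:
  fixes M N :: "('k, 'a, 'e, 'x) mterm"
  shows "mclosed (Lam M) \<longleftrightarrow> mclosed (m_open 0 (Var x) M)"
  "mclosed (LamT K M) \<longleftrightarrow> mclosed (m_topen 0 (TVar a) M)"
  "mclosed (Nu K M) \<longleftrightarrow> mclosed (m_eopen 0 e M)"
  "mclosed (App M N) \<longleftrightarrow> mclosed M \<and> mclosed N"
  "mclosed (AppT M A) \<longleftrightarrow> mclosed M \<and> closed A"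
  "mclosed (Guard M N) \<longleftrightarrow> mclosed M \<and> mclosed N"
  "mclosed (Gen A) \<longleftrightarrow> closed A"
  "mclosed (Ver A M) \<longleftrightarrow> closed A \<and> mclosed M"
  "mclosed (Var x)" "mclosed Star" "\<not> mclosed (BVar j)"
proof -
  have "(case_nat True (\<lambda>_. False)) = (\<lambda>_. False)(0 := True)"
      by (auto simp: fun_eq_iff split: nat.split)
  then show "mclosed (Lam M) \<longleftrightarrow> mclosed (m_open 0 (Var x) M)"
    by (simp add: mclosed_def m_within_open_Var)
  have "push True name = (name :: ('a, 'e) leaf \<Rightarrow> bool)(LB 0 := ty_within name (TVar a))"
      by (rule push_eqI[symmetric]) auto
  then show "mclosed (LamT K M) \<longleftrightarrow> mclosed (m_topen 0 (TVar a) M)"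
    unfolding mclosed_def m_within_topen[OF closed_TVar] by simp
  have "epush True name = (name :: ('a, 'e) leaf \<Rightarrow> bool)(LE 0 := name (LX e))"
      by (rule epush_eqI[symmetric]) auto
  then show "mclosed (Nu K M) \<longleftrightarrow> mclosed (m_eopen 0 e M)"
    unfolding mclosed_def m_within_eopen by simp
qed (auto simp: mclosed_def closed_def)

lemma wk_mclosed: "wk \<Xi> M \<Longrightarrow> mclosed M"
proof (induction rule: wk.induct)
  case (Lam x M) then show ?case by (simp add: mclosed_simps(1)[of _ x])
next
  case (LamT a M K) then show ?case by (simp add: mclosed_simps(2)[of _ _ a])
next
  case (Nu e M K) then show ?case by (simp add: mclosed_simps(3)[of _ _ e])
qed (auto simp: mclosed_simps dest!: gkinding_kind_of kind_of_kind_env_closed)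

lemma m_conv_mclosed: "m_conv M M' \<Longrightarrow> mclosed M \<and> mclosed M'"
proof (induction rule: m_conv.induct)
  case (Lam x M) then show ?case by (simp add: mclosed_simps(1)[of _ x])
next
  case (LamT a M K) then show ?case by (simp add: mclosed_simps(2)[of _ _ a])
next
  case (Nu e M K) then show ?case by (simp add: mclosed_simps(3)[of _ _ e])
qed (auto simp: mclosed_simps dest: ty_eq_joinable)

text \<open>Only type arguments are checked: \<open>tapp\<close> looks at kinds, whereas
  \<open>G\<close> and \<open>V\<close> are invariant under joinability alone.\<close>

primrec kinded_types :: "(('a, 'e) leaf \<Rightarrow> 'k kind option) \<Rightarrow> ('k, 'a, 'e, 'x) mterm \<Rightarrow> bool" where
  "kinded_types \<kappa> (BVar j) = True"
| "kinded_types \<kappa> (Var x) = True"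
| "kinded_types \<kappa> (Lam M) = kinded_types \<kappa> M"
| "kinded_types \<kappa> (App M N) = (kinded_types \<kappa> M \<and> kinded_types \<kappa> N)"
| "kinded_types \<kappa> (LamT K M) = kinded_types (push (Some K) \<kappa>) M"
| "kinded_types \<kappa> (AppT M A) = (kinded_types \<kappa> M \<and> kind_of \<kappa> A \<noteq> None)"
| "kinded_types \<kappa> Star = True"
| "kinded_types \<kappa> (Guard M N) = (kinded_types \<kappa> M \<and> kinded_types \<kappa> N)"
| "kinded_types \<kappa> (Gen A) = True"
| "kinded_types \<kappa> (Ver A M) = kinded_types \<kappa> M"
| "kinded_types \<kappa> (Nu K M) = kinded_types (epush (Some K) \<kappa>) M"

lemma kinded_types_agree:
  "m_within Z W M \<Longrightarrow> (\<And>l. Z l \<Longrightarrow> \<kappa> l = \<kappa>' l) \<Longrightarrow> kinded_types \<kappa> M = kinded_types \<kappa>' M"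
proof (induction M arbitrary: Z W \<kappa> \<kappa>')
  case (LamT K M)
  show ?case unfolding kinded_types.simps
    by (rule LamT.IH[OF LamT.prems(1)[unfolded m_within.simps]], erule push_rel[of Z _ "(=)"])
      (auto intro: LamT.prems(2))
next
  case (Nu K M)
  show ?case unfolding kinded_types.simps
    by (rule Nu.IH[OF Nu.prems(1)[unfolded m_within.simps]], erule epush_rel[of Z _ "(=)"])
      (auto intro: Nu.prems(2))
next
  case (App M N) show ?case using App.IH[of Z W \<kappa> \<kappa>'] App.prems by simp
next
  case (Guard M N) show ?case using Guard.IH[of Z W \<kappa> \<kappa>'] Guard.prems by simp
next
  case (AppT M A)
  then have "kind_of \<kappa> A = kind_of \<kappa>' A" by (intro kind_of_agree[of Z]) auto
  then show ?case using AppT.IH[of Z W \<kappa> \<kappa>'] AppT.prems by simp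
next
  case (Ver A M) show ?case using Ver.IH[of Z W \<kappa> \<kappa>'] Ver.prems by simp
next
  case (Lam M) show ?case using Lam.IH[of Z "case_nat True W" \<kappa> \<kappa>'] Lam.prems by simp
qed auto

lemma kinded_types_open_Var: "kinded_types \<kappa> (m_open k (Var x) M) = kinded_types \<kappa> M"
  by (induction M arbitrary: k \<kappa>) simp_all

lemma kind_of_open_TVar:
  fixes A :: "('k, 'a, 'e) ty"
  shows "kind_of \<kappa> (ty_open k (TVar a) A) = kind_of (\<kappa>(LB k := \<kappa> (LV a))) A"
proof -
  let ?\<sigma> = "leaf_ty(LB k := TVar a) :: ('a, 'e) leaf \<Rightarrow> ('k, 'a, 'e) ty"
  have "(\<lambda>l. kind_of \<kappa> (?\<sigma> l)) = \<kappa>(LB k := \<kappa> (LV a))" by auto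
  then show ?thesis by (simp only: ty_open_ty_sub[OF ty_ren.simps(3)] kind_of_ty_sub)
qed

lemma kind_of_eopen:
  fixes A :: "('k, 'a, 'e) ty"
  shows "kind_of \<kappa> (ty_eopen k e A) = kind_of (\<kappa>(LE k := \<kappa> (LX e))) A"
proof -
  let ?\<sigma> = "leaf_ty(LE k := EVar e) :: ('a, 'e) leaf \<Rightarrow> ('k, 'a, 'e) ty"
  have "(\<lambda>l. kind_of \<kappa> (?\<sigma> l)) = \<kappa>(LE k := \<kappa> (LX e))" by auto
  then show ?thesis by (simp only: ty_eopen_ty_sub kind_of_ty_sub)
qed

lemma kinded_types_topen_TVar:
    "kinded_types \<kappa> (m_topen k (TVar a) M) = kinded_types (\<kappa>(LB k := \<kappa> (LV a))) M"
  by (induction M arbitrary: k \<kappa>)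
      (simp_all add: kind_of_open_TVar push_upd epush_upd_LB del: fun_upd_apply)

lemma kinded_types_eopen: "kinded_types \<kappa> (m_eopen k e M) = kinded_types (\<kappa>(LE k := \<kappa> (LX e))) M"
  by (induction M arbitrary: k \<kappa>) (simp_all add: kind_of_eopen epush_upd push_upd_LE del: fun_upd_apply)

lemma wk_kinded_types: "wk \<Xi> M \<Longrightarrow> kinded_types (kind_env (\<lambda>v. Some (\<Xi> v))) M"
proof (induction rule: wk.induct)
  case (LamT a M K)
  let ?\<kappa> = "kind_env (\<lambda>v. Some (\<Xi> v))"
  have "push (Some K) ?\<kappa> = ?\<kappa>(LB 0 := ?\<kappa> (LV a))" by (rule push_eqI[symmetric]) (auto simp: LamT)
  with LamT show ?case unfolding kinded_types_topen_TVar by simp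
next
  case (Nu e M K)
  let ?\<kappa> = "kind_env (\<lambda>v. Some (\<Xi> v))"
  have "epush (Some K) ?\<kappa> = ?\<kappa>(LE 0 := ?\<kappa> (LX e))" by (rule epush_eqI[symmetric]) (auto simp: Nu)
  with Nu show ?case unfolding kinded_types_eopen by simp
qed (auto simp: kinded_types_open_Var dest: gkinding_kind_of)

subsection \<open>Denotation of metaterms\<close>

lemma countable_rcset: "countable (rcset S)"
  using rcset[of S] by simp

context model
begin

text \<open>Indices and names are read from environments, so binders choose no fresh names. The
  cofinite quantifier at \<open>Nu\<close> matches the one in \<open>V_All\<close>, which makes the
  unfolding of \<open>ver\<close> at a quantified type sound.\<close>

primrec den :: "('k, 'a, 'e, 'x) mterm \<Rightarrow> ('x \<Rightarrow> ('k, 'a, 'e) point set) \<Rightarrow> (nat \<Rightarrow> ('k, 'a, 'e) point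
    set) \<Rightarrow>
    (('a, 'e) leaf \<Rightarrow> ('k, 'a, 'e) ty) \<Rightarrow> ('k, 'a, 'e) point set" where
  "den (BVar j) \<theta> \<beta> \<sigma> = \<beta> j"
| "den (Var x) \<theta> \<beta> \<sigma> = \<theta> x"
| "den (Lam M) \<theta> \<beta> \<sigma> = {PFun S \<tau> | S \<tau>. \<tau> \<in> den M \<theta> (case_nat (rcset S) \<beta>) \<sigma>}"
| "den (App M N) \<theta> \<beta> \<sigma> = fapp (den M \<theta> \<beta> \<sigma>) (den N \<theta> \<beta> \<sigma>)"
| "den (LamT K M) \<theta> \<beta> \<sigma> = {PTFun B \<tau> | B \<tau>. gkind B = Some K \<and> \<tau> \<in> den M \<theta> \<beta> (push B \<sigma>)}"
| "den (AppT M A) \<theta> \<beta> \<sigma> = tapp (den M \<theta> \<beta> \<sigma>) (ty_sub \<sigma> A)"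
| "den Star \<theta> \<beta> \<sigma> = {PStar}"
| "den (Guard M N) \<theta> \<beta> \<sigma> = {\<tau> \<in> den N \<theta> \<beta> \<sigma>. PStar \<in> den M \<theta> \<beta> \<sigma>}"
| "den (Gen A) \<theta> \<beta> \<sigma> = {\<tau>. G (ty_sub \<sigma> A) \<tau>}"
| "den (Ver A M) \<theta> \<beta> \<sigma> = {\<tau>. \<tau> = PStar \<and> V (ty_sub \<sigma> A) (den M \<theta> \<beta> \<sigma>)}"
| "den (Nu K M) \<theta> \<beta> \<sigma> =
     {\<tau>. \<exists>L. finite L \<and> (\<forall>e \<in> E K - L. \<tau> \<in> den M \<theta> \<beta> (epush (EVar e) \<sigma>))}"

lemma case_nat_mono: "(\<And>j. \<beta> j \<subseteq> \<beta>' j) \<Longrightarrow> case_nat S \<beta> j \<subseteq> case_nat S \<beta>' j"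
  by (cases j) auto

lemma den_mono: "(\<And>j. \<beta> j \<subseteq> \<beta>' j) \<Longrightarrow> den M \<theta> \<beta> \<sigma> \<subseteq> den M \<theta> \<beta>' \<sigma>"
proof (induction M arbitrary: \<beta> \<beta>' \<sigma>)
  case (Lam M)
  have "den M \<theta> (case_nat S \<beta>) \<sigma> \<subseteq> den M \<theta> (case_nat S \<beta>') \<sigma>" for S
    by (rule Lam.IH) (rule case_nat_mono, rule Lam.prems)
  then show ?case by auto
next
  case (App M N)
  show ?case unfolding den.simps by (rule fapp_mono) (rule App.IH, rule App.prems)+
next
  case (LamT K M)
  have "den M \<theta> \<beta> (push B \<sigma>) \<subseteq> den M \<theta> \<beta>' (push B \<sigma>)" for B by (rule LamT.IH) (rule LamT.prems)
  then show ?case by auto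
next
  case (AppT M A)
  show ?case unfolding den.simps by (rule tapp_mono) (rule AppT.IH, rule AppT.prems)
next
  case (Guard M N)
  have "den M \<theta> \<beta> \<sigma> \<subseteq> den M \<theta> \<beta>' \<sigma>" "den N \<theta> \<beta> \<sigma> \<subseteq> den N \<theta> \<beta>' \<sigma>"
    by (rule Guard.IH, rule Guard.prems)+
  then show ?case by auto
next
  case (Ver A M)
  have "den M \<theta> \<beta> \<sigma> \<subseteq> den M \<theta> \<beta>' \<sigma>" by (rule Ver.IH, rule Ver.prems)
  then show ?case by (auto elim: V_mono)
next
  case (Nu K M)
  have "den M \<theta> \<beta> (epush B \<sigma>) \<subseteq> den M \<theta> \<beta>' (epush B \<sigma>)" for B by (rule Nu.IH) (rule Nu.prems)
  then show ?case unfolding den.simps by blast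
qed auto

lemma den_agree:
  "m_within Z W M \<Longrightarrow> (\<And>x. x \<in> m_fv M \<Longrightarrow> \<theta> x = \<theta>' x) \<Longrightarrow> (\<And>j. W j \<Longrightarrow> \<beta> j = \<beta>' j) \<Longrightarrow>
   (\<And>l. Z l \<Longrightarrow> \<sigma> l = \<sigma>' l) \<Longrightarrow> den M \<theta> \<beta> \<sigma> = den M \<theta>' \<beta>' \<sigma>'"
proof (induction M arbitrary: Z W \<beta> \<beta>' \<sigma> \<sigma>')
  case (Lam M)
  have "den M \<theta> (case_nat S \<beta>) \<sigma> = den M \<theta>' (case_nat S \<beta>') \<sigma>'" for S
    by (rule Lam.IH[OF Lam.prems(1)[unfolded m_within.simps] _ _ Lam.prems(4)])
      (auto simp: Lam.prems(2,3) split: nat.splits)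
  then show ?case by simp
next
  case (App M N)
  have "den M \<theta> \<beta> \<sigma> = den M \<theta>' \<beta>' \<sigma>'"
    by (rule App.IH(1)[of Z W]) (use App.prems in auto)
  moreover have "den N \<theta> \<beta> \<sigma> = den N \<theta>' \<beta>' \<sigma>'"
    by (rule App.IH(2)[of Z W]) (use App.prems in auto)
  ultimately show ?case by simp
next
  case (Guard M N)
  have "den M \<theta> \<beta> \<sigma> = den M \<theta>' \<beta>' \<sigma>'"
    by (rule Guard.IH(1)[of Z W]) (use Guard.prems in auto)
  moreover have "den N \<theta> \<beta> \<sigma> = den N \<theta>' \<beta>' \<sigma>'"
    by (rule Guard.IH(2)[of Z W]) (use Guard.prems in auto)
  ultimately show ?case by simp
next
  case (LamT K M)
  have "den M \<theta> \<beta> (push B \<sigma>) = den M \<theta>' \<beta>' (push B \<sigma>')" for B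
    by (rule LamT.IH[OF LamT.prems(1)[unfolded m_within.simps]], use LamT.prems(2) in simp,
        erule LamT.prems(3), erule push_rel[of Z _ "(=)"]) (auto intro: LamT.prems(4))
  then show ?case by simp
next
  case (Nu K M)
  have "den M \<theta> \<beta> (epush B \<sigma>) = den M \<theta>' \<beta>' (epush B \<sigma>')" for B
    by (rule Nu.IH[OF Nu.prems(1)[unfolded m_within.simps]], use Nu.prems(2) in simp,
        erule Nu.prems(3), erule epush_rel[of Z _ "(=)"]) (auto intro: Nu.prems(4))
  then show ?case by simp
next
  case (AppT M A)
  have "den M \<theta> \<beta> \<sigma> = den M \<theta>' \<beta>' \<sigma>'"
    by (rule AppT.IH[of Z W]) (use AppT.prems in auto)
  moreover have "ty_sub \<sigma> A = ty_sub \<sigma>' A" by (rule ty_sub_agree[of Z]) (use AppT.prems in auto)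
  ultimately show ?case by simp
next
  case (Ver A M)
  have "den M \<theta> \<beta> \<sigma> = den M \<theta>' \<beta>' \<sigma>'"
    by (rule Ver.IH[of Z W]) (use Ver.prems in auto)
  moreover have "ty_sub \<sigma> A = ty_sub \<sigma>' A" by (rule ty_sub_agree[of Z]) (use Ver.prems in auto)
  ultimately show ?case by simp
next
  case (Gen A)
  have "ty_sub \<sigma> A = ty_sub \<sigma>' A" by (rule ty_sub_agree[of Z]) (use Gen.prems in auto)
  then show ?case by simp
qed auto

lemma den_mclosed:
  assumes "mclosed M" "\<And>x. x \<in> m_fv M \<Longrightarrow> \<theta> x = \<theta>' x" "\<And>l. name l \<Longrightarrow> \<sigma> l = \<sigma>' l"
  shows "den M \<theta> \<beta> \<sigma> = den M \<theta>' \<beta>' \<sigma>'"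
  using assms(1)[unfolded mclosed_def] by (rule den_agree) (use assms in auto)

text \<open>\<open>P\<close> enters binders unshifted; being closed, it has the same denotation in
  every extended environment.\<close>

lemma den_open:
  assumes "mclosed P"
  shows "den (m_open k P M) \<theta> \<beta> \<sigma> = den M \<theta> (\<beta>(k := den P \<theta> \<beta> \<sigma>)) \<sigma>"
proof -
  have [simp]: "den P \<theta> (case_nat S \<beta>) \<sigma> = den P \<theta> \<beta> \<sigma>" "den P \<theta> \<beta> (push B \<sigma>) = den P \<theta> \<beta> \<sigma>"
    "den P \<theta> \<beta> (epush B \<sigma>) = den P \<theta> \<beta> \<sigma>" for S \<beta> \<sigma> B
    by (rule den_mclosed[OF assms]; simp)+
  show ?thesis
    by (induction M arbitrary: k \<beta> \<sigma>) (simp_all add: case_nat_upd del: fun_upd_apply, simp)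
qed

lemma ty_sub_ty_open:
  assumes "closed A"
  shows "ty_sub \<sigma> (ty_open k A B) = ty_sub (\<sigma>(LB k := ty_sub \<sigma> A)) B"
proof -
  have "(\<lambda>l. ty_sub \<sigma> ((leaf_ty(LB k := A)) l)) = \<sigma>(LB k := ty_sub \<sigma> A)" by auto
  then show ?thesis by (simp only: ty_open_ty_sub[OF ty_ren_closed[OF assms]] ty_sub_ty_sub)
qed

lemma ty_sub_ty_eopen:
  fixes B :: "('k, 'a, 'e) ty"
  shows "ty_sub \<sigma> (ty_eopen k d B) = ty_sub (\<sigma>(LE k := \<sigma> (LX d))) B"
proof -
  let ?\<sigma> = "leaf_ty(LE k := EVar d) :: ('a, 'e) leaf \<Rightarrow> ('k, 'a, 'e) ty"
  have "(\<lambda>l. ty_sub \<sigma> (?\<sigma> l)) = \<sigma>(LE k := \<sigma> (LX d))" by auto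
  then show ?thesis by (simp only: ty_eopen_ty_sub ty_sub_ty_sub)
qed

lemma den_topen:
  assumes "closed A"
  shows "den (m_topen k A M) \<theta> \<beta> \<sigma> = den M \<theta> \<beta> (\<sigma>(LB k := ty_sub \<sigma> A))"
proof -
  have [simp]: "ty_sub (push B \<sigma>) A = ty_sub \<sigma> A" "ty_sub (epush B \<sigma>) A = ty_sub \<sigma> A" for B \<sigma>
    by (rule ty_sub_closed[OF assms]; simp)+
  show ?thesis
    by (induction M arbitrary: k \<beta> \<sigma>)
      (simp_all add: ty_sub_ty_open[OF assms] push_upd epush_upd_LB del: fun_upd_apply)
qed

lemma den_eopen: "den (m_eopen k d M) \<theta> \<beta> \<sigma> = den M \<theta> \<beta> (\<sigma>(LE k := \<sigma> (LX d)))"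
  by (induction M arbitrary: k \<beta> \<sigma>)
    (simp_all add: ty_sub_ty_eopen push_upd_LE epush_upd del: fun_upd_apply)

text \<open>Connects named rules with index environments: a fresh variable carrying \<open>S\<close>
  behaves like the bound index carrying \<open>S\<close>. The two lemmas below do the same for the
  type binders.\<close>

lemma den_Lam_open:
  assumes "mclosed (Lam M)" "x \<notin> m_fv M"
  shows "den (m_open 0 (Var x) M) (\<theta>(x := S)) \<beta> \<sigma> = den M \<theta> (case_nat S \<beta>) \<sigma>"
  unfolding den_open[OF mclosed_simps(9)]
  by (rule den_agree[OF assms(1)[unfolded mclosed_def m_within.simps]])
      (use assms(2) in \<open>auto split: nat.splits\<close>)

lemma den_LamT_open:
  assumes "mclosed (LamT K M)" "a \<notin> m_ftv M"
  shows "den (m_topen 0 (TVar a) M) \<theta> \<beta> (\<sigma>(LV a := B)) = den M \<theta> \<beta> (push B \<sigma>)"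
  unfolding den_topen[OF closed_TVar]
proof (rule den_agree[OF m_within_free[OF assms(1)[unfolded mclosed_def m_within.simps]]])
  fix l assume "push True name l \<and> (\<forall>a. l = LV a \<longrightarrow> a \<in> m_ftv M) \<and> (\<forall>e. l = LX e \<longrightarrow> e \<in> m_fev M)"
  then show "((\<sigma>(LV a := B))(LB 0 := ty_sub (\<sigma>(LV a := B)) (TVar a))) l = push B \<sigma> l"
    using assms(2) by (cases l rule: leaf_cases) auto
qed auto

lemma den_Nu_open:
  assumes "mclosed (Nu K M)" "e \<notin> m_fev M"
  shows "den (m_eopen 0 e M) \<theta> \<beta> (\<sigma>(LX e := B)) = den M \<theta> \<beta> (epush B \<sigma>)"
  unfolding den_eopen
proof (rule den_agree[OF m_within_free[OF assms(1)[unfolded mclosed_def m_within.simps]]])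
  fix l assume "epush True name l \<and> (\<forall>a. l = LV a \<longrightarrow> a \<in> m_ftv M) \<and> (\<forall>e. l = LX e \<longrightarrow> e \<in> m_fev M)"
  then show "((\<sigma>(LX e := B))(LE 0 := (\<sigma>(LX e := B)) (LX e))) l = epush B \<sigma> l"
    using assms(2) by (cases l rule: leaf_cases) auto
qed auto

lemma den_upd_mono: "S \<subseteq> S' \<Longrightarrow> den M \<theta> (\<beta>(k := S)) \<sigma> \<subseteq> den M \<theta> (\<beta>(k := S')) \<sigma>"
  by (rule den_mono) auto

text \<open>The countable supports of countably many points have a countable union, and by
  monotonicity it supports all of them at once.\<close>

lemma den_union:
  assumes "\<And>\<tau>. \<tau> \<in> den M \<theta> (\<beta>(k := X)) \<sigma> \<Longrightarrow>
      \<exists>S. countable S \<and> S \<subseteq> X \<and> \<tau> \<in> den M \<theta> (\<beta>(k := S)) \<sigma>"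
    and "T \<subseteq> den M \<theta> (\<beta>(k := X)) \<sigma>" "countable T"
  shows "\<exists>S. countable S \<and> S \<subseteq> X \<and> T \<subseteq> den M \<theta> (\<beta>(k := S)) \<sigma>"
proof -
  from assms(1,2) have "\<forall>\<tau>\<in>T. \<exists>S. countable S \<and> S \<subseteq> X \<and> \<tau> \<in> den M \<theta> (\<beta>(k := S)) \<sigma>" by blast
  then obtain S where S: "\<And>\<tau>. \<tau> \<in> T \<Longrightarrow> countable (S \<tau>) \<and> S \<tau> \<subseteq> X \<and> \<tau> \<in> den M \<theta> (\<beta>(k := S \<tau>)) \<sigma>"
    by metis
  have "\<tau> \<in> den M \<theta> (\<beta>(k := \<Union>(S ` T))) \<sigma>" if "\<tau> \<in> T" for \<tau>
    using S[OF that] den_upd_mono[of "S \<tau>" "\<Union>(S ` T)"] that by blast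
  moreover have "countable (\<Union>(S ` T))" using S assms(3) by auto
  moreover have "\<Union>(S ` T) \<subseteq> X" using S by blast
  ultimately show ?thesis by blast
qed

text \<open>Each observation on \<open>M\<close> draws on countably many points of one bound
  variable. This is needed for \<beta>-expansion, since the argument of a \<open>PFun\<close> point
  is a countable set.\<close>

lemma den_continuous:
  "\<tau> \<in> den M \<theta> (\<beta>(k := X)) \<sigma> \<Longrightarrow> \<exists>S. countable S \<and> S \<subseteq> X \<and> \<tau> \<in> den M \<theta> (\<beta>(k := S)) \<sigma>"
proof (induction M arbitrary: \<tau> k \<beta> \<sigma>)
  case (BVar j)
  then show ?case
    by (intro exI[of _ "if j = k then {\<tau>} else {}"]) (auto simp: fun_upd_apply split: if_splits)
next
  note fun_upd_apply [simp del]
  case (Lam M)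
  then obtain T \<upsilon> where T: "\<tau> = PFun T \<upsilon>" "\<upsilon> \<in> den M \<theta> ((case_nat (rcset T) \<beta>)(Suc k := X)) \<sigma>"
    by (auto simp: case_nat_upd)
  from Lam.IH[OF T(2)] obtain S where "countable S" "S \<subseteq> X"
    "\<upsilon> \<in> den M \<theta> ((case_nat (rcset T) \<beta>)(Suc k := S)) \<sigma>" by blast
  with T(1) show ?case by (auto simp: case_nat_upd)
next
  note fun_upd_apply [simp del]
  case (App M N)
  then obtain T where T: "PFun T \<tau> \<in> den M \<theta> (\<beta>(k := X)) \<sigma>" "rcset T \<subseteq> den N \<theta> (\<beta>(k := X)) \<sigma>"
    by (auto simp: fapp_def)
  from App.IH(1)[OF T(1)] obtain S where S: "countable S" "S \<subseteq> X" "PFun T \<tau> \<in> den M \<theta> (\<beta>(k := S)) \<sigma>"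
    by blast
  from den_union[OF App.IH(2) T(2) countable_rcset] obtain S' where S': "countable S'" "S' \<subseteq> X"
    "rcset T \<subseteq> den N \<theta> (\<beta>(k := S')) \<sigma>" by blast
  have "PFun T \<tau> \<in> den M \<theta> (\<beta>(k := S \<union> S')) \<sigma>" "rcset T \<subseteq> den N \<theta> (\<beta>(k := S \<union> S')) \<sigma>"
    using S(3) S'(3) den_upd_mono[of S "S \<union> S'"] den_upd_mono[of S' "S \<union> S'"] by blast+
  then show ?case using S S' by (intro exI[of _ "S \<union> S'"]) (auto simp: fapp_def)
next
  note fun_upd_apply [simp del]
  case (LamT K M)
  then obtain B \<upsilon> where B: "\<tau> = PTFun B \<upsilon>" "gkind B = Some K" "\<upsilon> \<in> den M \<theta> (\<beta>(k := X)) (push B \<sigma>)"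
    by (auto)
  from LamT.IH[OF B(3)] obtain S where S: "countable S" "S \<subseteq> X" "\<upsilon> \<in> den M \<theta> (\<beta>(k := S)) (push B \<sigma>)"
    by blast
  have "\<tau> \<in> den (LamT K M) \<theta> (\<beta>(k := S)) \<sigma>" using B(1,2) S(3) by simp
  with S(1,2) show ?case by (intro exI[of _ S] conjI)
next
  note fun_upd_apply [simp del]
  case (AppT M A)
  then obtain B J where B: "PTFun B \<tau> \<in> den M \<theta> (\<beta>(k := X)) \<sigma>"
    "joinable B (ty_sub \<sigma> A)" "gkind (ty_sub \<sigma> A) = Some J" "gkind B = Some J"
    by (auto simp: tapp_def)
  from AppT.IH[OF B(1)] obtain S where S: "countable S" "S \<subseteq> X" "PTFun B \<tau> \<in> den M \<theta> (\<beta>(k := S)) \<sigma>"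
    by blast
  have "\<tau> \<in> den (AppT M A) \<theta> (\<beta>(k := S)) \<sigma>" using B(2-) S(3) by (auto simp: tapp_def)
  with S(1,2) show ?case by (intro exI[of _ S] conjI)
next
  note fun_upd_apply [simp del]
  case (Guard M N)
  then have "PStar \<in> den M \<theta> (\<beta>(k := X)) \<sigma>" "\<tau> \<in> den N \<theta> (\<beta>(k := X)) \<sigma>" by auto
  then obtain S S' where S: "countable S" "S \<subseteq> X" "PStar \<in> den M \<theta> (\<beta>(k := S)) \<sigma>"
    "countable S'" "S' \<subseteq> X" "\<tau> \<in> den N \<theta> (\<beta>(k := S')) \<sigma>" using Guard.IH by meson
  have "PStar \<in> den M \<theta> (\<beta>(k := S \<union> S')) \<sigma>" "\<tau> \<in> den N \<theta> (\<beta>(k := S \<union> S')) \<sigma>"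
    using S(3,6) den_upd_mono[of S "S \<union> S'"] den_upd_mono[of S' "S \<union> S'"] by blast+
  then show ?case using S by (intro exI[of _ "S \<union> S'"]) auto
next
  note fun_upd_apply [simp del]
  case (Ver A M)
  then have \<tau>: "\<tau> = PStar" "V (ty_sub \<sigma> A) (den M \<theta> (\<beta>(k := X)) \<sigma>)" by auto
  from V_continuous[OF \<tau>(2)] obtain T where T: "countable T" "T \<subseteq> den M \<theta> (\<beta>(k := X)) \<sigma>"
    "V (ty_sub \<sigma> A) T" by blast
  from den_union[OF Ver.IH T(2,1)] obtain S where S: "countable S" "S \<subseteq> X"
    "T \<subseteq> den M \<theta> (\<beta>(k := S)) \<sigma>" by blast
  with V_mono[OF T(3) S(3)] \<tau>(1) show ?case by auto
next
  note fun_upd_apply [simp del]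
  case (Nu K M)
  from Nu.prems obtain L where L: "finite L"
      "\<And>e. e \<in> E K - L \<Longrightarrow> \<tau> \<in> den M \<theta> (\<beta>(k := X)) (epush (EVar e) \<sigma>)"
    by auto
  then have "\<forall>e\<in>E K - L. \<exists>S. countable S \<and> S \<subseteq> X \<and> \<tau> \<in> den M \<theta> (\<beta>(k := S)) (epush (EVar e) \<sigma>)"
    by (intro ballI Nu.IH) simp
  then obtain S where S: "\<And>e. e \<in> E K - L \<Longrightarrow> countable (S e) \<and> S e \<subseteq> X \<and>
      \<tau> \<in> den M \<theta> (\<beta>(k := S e)) (epush (EVar e) \<sigma>)" by metis
  let ?S = "\<Union>e\<in>E K - L. S e"
  have "\<tau> \<in> den M \<theta> (\<beta>(k := ?S)) (epush (EVar e) \<sigma>)" if "e \<in> E K - L" for e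
    using S[OF that] den_upd_mono[of "S e" ?S] that by blast
  moreover have "countable ?S"
    using S by (intro countable_UN) (auto intro: countable_subset[OF _ E_countable])
  moreover have "?S \<subseteq> X" using S by blast
  ultimately show ?case using L(1) by (intro exI[of _ ?S]) auto
qed auto

lemma tapp_joinable: "joinable A A' \<Longrightarrow> gkind A = gkind A' \<Longrightarrow> tapp X A = tapp X A'"
  unfolding tapp_def by (auto intro: joinable_trans joinable_sym)

lemma G_joinable_eq: "joinable A A' \<Longrightarrow> {\<tau>. G A \<tau>} = {\<tau>. G A' \<tau>}"
  using G_V_joinable(1) joinable_sym by blast

lemma V_joinable_eq: "joinable A A' \<Longrightarrow> V A X = V A' X"
  using G_V_joinable(2) joinable_sym by blast

text \<open>Equality of kinds is a separate premise because an ill-kinded type may reduce to a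
  well-kinded one, and \<open>tapp\<close> distinguishes the two.\<close>

lemma den_joinable:
  "(\<And>l. joinable (\<sigma> l) (\<sigma>' l)) \<Longrightarrow> (\<And>l. gkind (\<sigma> l) = gkind (\<sigma>' l)) \<Longrightarrow> den M \<theta> \<beta> \<sigma> = den M \<theta> \<beta> \<sigma>'"
proof (induction M arbitrary: \<beta> \<sigma> \<sigma>')
  case (LamT K M)
  have "den M \<theta> \<beta> (push B \<sigma>) = den M \<theta> \<beta> (push B \<sigma>')" for B
  proof (rule LamT.IH)
    fix l show "joinable (push B \<sigma> l) (push B \<sigma>' l)" "gkind (push B \<sigma> l) = gkind (push B \<sigma>' l)"
      by (cases l rule: leaf_cases; simp add: LamT.prems)+
  qed
  then show ?case by simp
next
  case (Nu K M)
  have "den M \<theta> \<beta> (epush B \<sigma>) = den M \<theta> \<beta> (epush B \<sigma>')" for B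
  proof (rule Nu.IH)
    fix l show "joinable (epush B \<sigma> l) (epush B \<sigma>' l)" "gkind (epush B \<sigma> l) = gkind (epush B \<sigma>' l)"
      by (cases l rule: leaf_cases; simp add: Nu.prems)+
  qed
  then show ?case by simp
next
  case (App M N) then show ?case unfolding den.simps by metis
next
  case (Guard M N) then show ?case unfolding den.simps by metis
next
  case (Lam M)
  have "den M \<theta> \<beta> \<sigma> = den M \<theta> \<beta> \<sigma>'" for \<beta> by (rule Lam.IH) (rule Lam.prems)+
  then show ?case by simp
next
  case (AppT M A)
  have "den M \<theta> \<beta> \<sigma> = den M \<theta> \<beta> \<sigma>'" by (rule AppT.IH) (rule AppT.prems)+
  moreover have "tapp X (ty_sub \<sigma> A) = tapp X (ty_sub \<sigma>' A)" for X
    by (rule tapp_joinable) (simp_all add: joinable_ty_sub2 AppT.prems kind_of_ty_sub)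
  ultimately show ?case by simp
next
  case (Gen A) show ?case unfolding den.simps by (rule G_joinable_eq) (rule joinable_ty_sub2, rule Gen)
next
  case (Ver A M)
  have "den M \<theta> \<beta> \<sigma> = den M \<theta> \<beta> \<sigma>'" by (rule Ver.IH) (rule Ver.prems)+
  moreover have "V (ty_sub \<sigma> A) X = V (ty_sub \<sigma>' A) X" for X
      by (rule V_joinable_eq) (rule joinable_ty_sub2, rule Ver)
  ultimately show ?case by simp
qed auto

lemma den_push_joinable:
  assumes "joinable B B'" "gkind B = gkind B'"
  shows "den M \<theta> \<beta> (push B \<sigma>) = den M \<theta> \<beta> (push B' \<sigma>)"
proof (rule den_joinable)
  fix l show "joinable (push B \<sigma> l) (push B' \<sigma> l)" "gkind (push B \<sigma> l) = gkind (push B' \<sigma> l)"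
    by (cases l rule: leaf_cases; simp add: assms)+
qed

text \<open>Convertible types that both have a kind have the same kind, so \<open>tapp\<close>
  cannot tell them apart; hence the condition on the type arguments of both sides.\<close>

lemma den_conv:
  "m_conv M M' \<Longrightarrow> kinded_types (\<lambda>l. gkind (\<sigma> l)) M \<Longrightarrow> kinded_types (\<lambda>l. gkind (\<sigma> l)) M' \<Longrightarrow>
   den M \<theta> \<beta> \<sigma> = den M' \<theta> \<beta> \<sigma>"
proof (induction arbitrary: \<theta> \<beta> \<sigma> rule: m_conv.induct)
  case (Lam x M M')
  from m_conv_mclosed[OF Lam.hyps(3)] have mc: "mclosed (Lam M)" "mclosed (Lam M')"
    by (simp_all add: mclosed_simps(1)[of _ x])
  have "den M \<theta> (case_nat S \<beta>) \<sigma> = den M' \<theta> (case_nat S \<beta>) \<sigma>" for S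
    unfolding den_Lam_open[OF mc(1) Lam.hyps(1), symmetric] den_Lam_open[OF mc(2) Lam.hyps(2),
        symmetric]
    by (rule Lam.IH) (use Lam.prems in \<open>simp_all add: kinded_types_open_Var\<close>)
  then show ?case by simp
next
  case (LamT a M M' K)
  from m_conv_mclosed[OF LamT.hyps(3)] have mc: "mclosed (LamT K M)" "mclosed (LamT K M')"
    by (simp_all add: mclosed_simps(2)[of _ _ a])
  have "den M \<theta> \<beta> (push B \<sigma>) = den M' \<theta> \<beta> (push B \<sigma>)" if B: "gkind B = Some K" for B
    unfolding den_LamT_open[OF mc(1) LamT.hyps(1), symmetric] den_LamT_open[OF mc(2) LamT.hyps(2),
        symmetric]
  proof (rule LamT.IH)
    have *: "kinded_types (\<lambda>l. gkind ((\<sigma>(LV a := B)) l)) (m_topen 0 (TVar a) N)"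
      if "kinded_types (\<lambda>l. gkind (\<sigma> l)) (LamT K N)" "mclosed (LamT K N)" "a \<notin> m_ftv N"
          for N :: "('k, 'a, 'e, 'b) mterm"
    proof -
      let ?\<kappa> = "\<lambda>l. gkind ((\<sigma>(LV a := B)) l)"
      have "kinded_types (push (Some K) (\<lambda>l. gkind (\<sigma> l))) N = kinded_types (?\<kappa>(LB 0 := ?\<kappa> (LV a))) N"
      proof (rule kinded_types_agree[OF m_within_free[OF that(2)[unfolded mclosed_def m_within.simps]]])
        fix l assume "push True name l \<and> (\<forall>a. l = LV a \<longrightarrow> a \<in> m_ftv N) \<and> (\<forall>e. l = LX e \<longrightarrow> e \<in> m_fev N)"
        then show "push (Some K) (\<lambda>l. gkind (\<sigma> l)) l = (?\<kappa>(LB 0 := ?\<kappa> (LV a))) l"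
          using that(3) B by (cases l rule: leaf_cases) auto
      qed
      then show ?thesis using that(1) unfolding kinded_types_topen_TVar by simp
    qed
    show "kinded_types (\<lambda>l. gkind ((\<sigma>(LV a := B)) l)) (m_topen 0 (TVar a) M)"
      "kinded_types (\<lambda>l. gkind ((\<sigma>(LV a := B)) l)) (m_topen 0 (TVar a) M')"
      using LamT.prems LamT.hyps(1,2) mc by (blast intro: *)+
  qed
  then show ?case by auto
next
  case (Nu e M M' K)
  from m_conv_mclosed[OF Nu.hyps(3)] have mc: "mclosed (Nu K M)" "mclosed (Nu K M')"
    by (simp_all add: mclosed_simps(3)[of _ _ e])
  have "den M \<theta> \<beta> (epush B \<sigma>) = den M' \<theta> \<beta> (epush B \<sigma>)" if B: "gkind B = Some K" for B
    unfolding den_Nu_open[OF mc(1) Nu.hyps(1), symmetric] den_Nu_open[OF mc(2) Nu.hyps(2), symmetric]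
  proof (rule Nu.IH)
    have *: "kinded_types (\<lambda>l. gkind ((\<sigma>(LX e := B)) l)) (m_eopen 0 e N)"
      if "kinded_types (\<lambda>l. gkind (\<sigma> l)) (Nu K N)" "mclosed (Nu K N)" "e \<notin> m_fev N"
          for N :: "('k, 'a, 'e, 'b) mterm"
    proof -
      let ?\<kappa> = "\<lambda>l. gkind ((\<sigma>(LX e := B)) l)"
      have "kinded_types (epush (Some K) (\<lambda>l. gkind (\<sigma> l))) N = kinded_types (?\<kappa>(LE 0 := ?\<kappa> (LX e))) N"
      proof (rule kinded_types_agree[OF m_within_free[OF that(2)[unfolded mclosed_def m_within.simps]]])
        fix l assume "epush True name l \<and> (\<forall>a. l = LV a \<longrightarrow> a \<in> m_ftv N) \<and> (\<forall>e. l = LX e \<longrightarrow> e \<in> m_fev N)"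
        then show "epush (Some K) (\<lambda>l. gkind (\<sigma> l)) l = (?\<kappa>(LE 0 := ?\<kappa> (LX e))) l"
          using that(3) B by (cases l rule: leaf_cases) auto
      qed
      then show ?thesis using that(1) unfolding kinded_types_eopen by simp
    qed
    show "kinded_types (\<lambda>l. gkind ((\<sigma>(LX e := B)) l)) (m_eopen 0 e M)"
      "kinded_types (\<lambda>l. gkind ((\<sigma>(LX e := B)) l)) (m_eopen 0 e M')"
      using Nu.prems Nu.hyps(1,2) mc by (blast intro: *)+
  qed
  then have "den M \<theta> \<beta> (epush (EVar e) \<sigma>) = den M' \<theta> \<beta> (epush (EVar e) \<sigma>)" if "e \<in> E K" for e
    using E_kind[OF that] by simp
  then show ?case by auto
next
  case (AppT M M' A A')
  have "den M \<theta> \<beta> \<sigma> = den M' \<theta> \<beta> \<sigma>" by (rule AppT.IH) (use AppT.prems in auto)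
  moreover have "joinable A A'" using AppT.hyps(2) ty_eq_joinable by blast
  moreover from this have "gkind (ty_sub \<sigma> A) = gkind (ty_sub \<sigma> A')"
    using AppT.prems unfolding kind_of_ty_sub by (auto dest: kind_of_joinable)
  ultimately show ?case by (simp add: tapp_joinable joinable_ty_sub1)
next
  case (Gen A A')
  then have "joinable (ty_sub \<sigma> A) (ty_sub \<sigma> A')" using ty_eq_joinable joinable_ty_sub1 by blast
  then show ?case unfolding den.simps by (rule G_joinable_eq)
next
  case (Ver A A' M M')
  have "den M \<theta> \<beta> \<sigma> = den M' \<theta> \<beta> \<sigma>" by (rule Ver.IH) (use Ver.prems in auto)
  moreover have "joinable (ty_sub \<sigma> A) (ty_sub \<sigma> A')" using Ver.hyps ty_eq_joinable joinable_ty_sub1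
      by blast
  ultimately show ?case using V_joinable_eq by auto
next
  case (App M M' N N')
  then show ?case unfolding den.simps kinded_types.simps by metis
next
  case (Guard M M' N N')
  then show ?case unfolding den.simps kinded_types.simps by metis
qed auto


subsection \<open>Reduction in the model\<close>

text \<open>Allows at each name any type of the kind prescribed by \<Xi>. The class is stable under
  the extensions made below \<Lambda> and \<nu>, and it preserves the kinds of closed types.\<close>

definition admissible :: "(('a, 'e) leaf \<Rightarrow> ('k, 'a, 'e) ty) \<Rightarrow> bool" where
  "admissible \<sigma> \<longleftrightarrow> (\<forall>l. name l \<longrightarrow> gkind (\<sigma> l) = kind_env (\<lambda>v. Some (\<Xi> v)) l)"

lemma admissible_LV: "admissible \<sigma> \<Longrightarrow> gkind B = Some (\<Xi> (Inl a)) \<Longrightarrow> admissible (\<sigma>(LV a := B))"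
  unfolding admissible_def by auto

lemma admissible_LX: "admissible \<sigma> \<Longrightarrow> gkind B = Some (\<Xi> (Inr e)) \<Longrightarrow> admissible (\<sigma>(LX e := B))"
  unfolding admissible_def by auto

lemma gkind_ty_sub:
  assumes "admissible \<sigma>" "closed A" shows "gkind (ty_sub \<sigma> A) = gkind A"
  unfolding kind_of_ty_sub by (rule kind_of_agree[OF assms(2)[unfolded closed_def]])
      (use assms(1) in \<open>simp add: admissible_def\<close>)

lemma den_LamT_topen:
  assumes "mclosed (LamT K M)" "closed A"
  shows "den (m_topen 0 A M) \<theta> \<beta> \<sigma> = den M \<theta> \<beta> (push (ty_sub \<sigma> A) \<sigma>)"
  unfolding den_topen[OF assms(2)]
proof (rule den_agree[OF assms(1)[unfolded mclosed_def m_within.simps]])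
  fix l :: "('a, 'e) leaf" assume "push True name l"
  then show "(\<sigma>(LB 0 := ty_sub \<sigma> A)) l = push (ty_sub \<sigma> A) \<sigma> l" by (cases l rule: leaf_cases) auto
qed auto

lemma den_Lam_mopen:
  assumes "mclosed (Lam M)"
  shows "den M \<theta> (\<beta>(0 := S)) \<sigma> = den M \<theta> (case_nat S \<beta>) \<sigma>"
  by (rule den_agree[OF assms[unfolded mclosed_def m_within.simps]]) (auto split: nat.splits)

text \<open>Each rule is sound for expansion. The rules for \<open>gen\<close> and
  \<open>ver\<close> at compound types are matched by the introduction rules of \<open>G\<close> and
  \<open>V\<close>.\<close>

lemma root_red_den:
  assumes "root_red \<Xi> M N" "mclosed M" "admissible \<sigma>"
  shows "den N \<theta> \<beta> \<sigma> \<subseteq> den M \<theta> \<beta> \<sigma>"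
  using assms(1)
proof cases
  case (beta M1 N1)
  with assms(2) have mc: "mclosed (Lam M1)" "mclosed N1" by (simp_all add: mclosed_simps)
  show ?thesis
  proof
    fix \<tau> assume "\<tau> \<in> den N \<theta> \<beta> \<sigma>"
    then have "\<tau> \<in> den M1 \<theta> (\<beta>(0 := den N1 \<theta> \<beta> \<sigma>)) \<sigma>" unfolding beta den_open[OF mc(2)] .
    \<comment> \<open>Continuity replaces all points of the argument by a countable subset, which a
      \<open>PFun\<close> point can carry.\<close>
    from den_continuous[OF this] obtain S where S: "countable S" "S \<subseteq> den N1 \<theta> \<beta> \<sigma>"
      "\<tau> \<in> den M1 \<theta> (case_nat S \<beta>) \<sigma>" unfolding den_Lam_mopen[OF mc(1)] by blast
    from S(1) have "rcset (acset S) = S" by (simp add: acset_inverse)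
    then show "\<tau> \<in> den M \<theta> \<beta> \<sigma>" unfolding beta den.simps fapp_def using S(2,3)
      by (auto intro!: exI[of _ "acset S"])
  qed
next
  case (tbeta A K M1)
  with assms(2) have mc: "mclosed (LamT K M1)" "closed A" by (simp_all add: mclosed_simps)
  \<comment> \<open>The kinding side condition of the rule supplies the kinds that
    \<open>tapp\<close> checks.\<close>
  have "gkind (ty_sub \<sigma> A) = Some K" using tbeta(3) gkinding_kind_of gkind_ty_sub[OF assms(3) mc(2)]
      by metis
  then show ?thesis unfolding tbeta den_LamT_topen[OF mc] by (auto simp: tapp_def intro: joinable_refl)
next
  case (guard)
  then show ?thesis by auto
next
  case (ver_gen A)
  then show ?thesis using V_At[of "ty_sub \<sigma> A" "{\<tau>. G (ty_sub \<sigma> A) \<tau>}"] G_At[OF joinable_refl] by auto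
next
  case (ver_Imp A B M1)
  then show ?thesis using V_fapp by auto
next
  case (ver_All K A M1)
  with assms(2) have mc: "closed (TAll K A)" "mclosed M1" by (simp_all add: mclosed_simps)
  have eq: "ty_sub (epush (EVar e) \<sigma>) (ty_open 0 (EBound 0) A) = inst (EVar e) (ty_sub (up \<sigma>) A)" for e
  proof -
    have "ty_sub (epush (EVar e) \<sigma>) (ty_open 0 (EBound 0) A) =
        ty_sub (\<lambda>l. ty_sub (epush (EVar e) \<sigma>) ((leaf_ty(LB 0 := EBound 0)) l)) A"
      by (simp only: ty_open_ty_sub[OF ty_ren.simps(2)] ty_sub_ty_sub)
    also have "\<dots> = ty_sub (push (EVar e) \<sigma>) A"
    proof (rule ty_sub_agree[OF mc(1)[unfolded closed_def ty_within.simps]])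
      fix l :: "('a, 'e) leaf" assume "push True name l"
      then show "ty_sub (epush (EVar e) \<sigma>) ((leaf_ty(LB 0 := EBound 0)) l) = push (EVar e) \<sigma> l"
        by (cases l rule: leaf_cases) auto
    qed
    finally show ?thesis by (simp add: inst_up)
  qed
  have M1: "den M1 \<theta> \<beta> (epush (EVar e) \<sigma>) = den M1 \<theta> \<beta> \<sigma>" for e
    by (rule den_mclosed[OF mc(2)]) auto
  show ?thesis
  proof
    fix \<tau> assume "\<tau> \<in> den N \<theta> \<beta> \<sigma>"
    then obtain L where L: "finite L" "\<And>e. e \<in> E K - L \<Longrightarrow> \<tau> = PStar"
      "\<And>e. e \<in> E K - L \<Longrightarrow> V (inst (EVar e) (ty_sub (up \<sigma>) A)) (tapp (den M1 \<theta> \<beta> \<sigma>) (EVar e))"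
      unfolding ver_All den.simps by (auto simp: eq M1)
    have "V (TAll K (ty_sub (up \<sigma>) A)) (den M1 \<theta> \<beta> \<sigma>)"
      by (rule V_All[OF rtranclp.rtrancl_refl L(1,3)]) auto
    moreover have "\<tau> = PStar" using L(2) E_fresh[OF L(1)] by blast
    ultimately show "\<tau> \<in> den M \<theta> \<beta> \<sigma>" unfolding ver_All by simp
  qed
next
  case (gen_Imp A B)
  then show ?thesis by (auto intro: G_Imp[OF rtranclp.rtrancl_refl])
next
  case (gen_All K A)
  then show ?thesis by (auto intro!: G_All[OF rtranclp.rtrancl_refl] simp: inst_up)
next
  case (nu e M1 K)
  have "mclosed (m_eopen 0 e M1)" using assms(2) unfolding nu(1)
      by (simp add: mclosed_simps(3)[of _ _ e])
  from m_within_free[OF this[unfolded mclosed_def]]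
  have "m_within (\<lambda>l. name l \<and> l \<noteq> LX e) (\<lambda>_. False) (m_eopen 0 e M1)"
    by (rule m_within_mono) (use nu(3) in auto)
  \<comment> \<open>Since \<open>LX e\<close> is excluded, unfolding the opening excludes the index
    \<open>LE 0\<close> as well: the body ignores its bound eigenvariable, whatever value it
    receives.\<close>
  note mc = this[unfolded m_within_eopen]
  have "den N \<theta> \<beta> \<sigma> = den M1 \<theta> \<beta> (epush (EVar d) \<sigma>)" for d
    unfolding nu(2) den_eopen by (rule den_agree[OF mc]) (auto split: if_splits)
  then show ?thesis unfolding nu(1) by auto
qed

text \<open>Generic in \<open>R\<close> because it serves twice, for \<open>root_red\<close> and for
  the converse of \<open>root_beta\<close>. Below \<Lambda> and \<nu>, the kind given to the opening
  name keeps the extended environment admissible.\<close>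

lemma ctxt_closure_den:
  assumes R: "\<And>M N \<theta> \<beta> \<sigma>. R M N \<Longrightarrow> mclosed M \<Longrightarrow> mclosed N \<Longrightarrow> admissible \<sigma> \<Longrightarrow> den N \<theta> \<beta> \<sigma> \<subseteq> den M \<theta> \<beta> \<sigma>"
  shows "ctxt_closure \<Xi> R M N \<Longrightarrow> mclosed M \<Longrightarrow> mclosed N \<Longrightarrow> admissible \<sigma> \<Longrightarrow>
    den N \<theta> \<beta> \<sigma> \<subseteq> den M \<theta> \<beta> \<sigma>"
proof (induction arbitrary: \<theta> \<beta> \<sigma> rule: ctxt_closure.induct)
  case (base M N) then show ?case by (rule R)
next
  case (Lam x M M')
  have "den M' \<theta> (case_nat S \<beta>) \<sigma> \<subseteq> den M \<theta> (case_nat S \<beta>) \<sigma>" for S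
    unfolding den_Lam_open[OF Lam.prems(1) Lam.hyps(1), symmetric]
      den_Lam_open[OF Lam.prems(2) Lam.hyps(2), symmetric]
    by (rule Lam.IH) (use Lam.prems mclosed_simps(1)[of _ x] in auto)
  then show ?case by auto
next
  case (LamT a M M' K)
  have "den M' \<theta> \<beta> (push B \<sigma>) \<subseteq> den M \<theta> \<beta> (push B \<sigma>)" if "gkind B = Some K" for B
    unfolding den_LamT_open[OF LamT.prems(1) LamT.hyps(1), symmetric]
      den_LamT_open[OF LamT.prems(2) LamT.hyps(2), symmetric]
    by (rule LamT.IH) (use LamT.prems LamT.hyps(3) that in \<open>simp_all add: mclosed_simps(2)[of _ _ a]
        admissible_LV del: fun_upd_apply\<close>)
  then show ?case by auto
next
  case (Nu e M M' K)
  have "den M' \<theta> \<beta> (epush B \<sigma>) \<subseteq> den M \<theta> \<beta> (epush B \<sigma>)" if "gkind B = Some K" for B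
    unfolding den_Nu_open[OF Nu.prems(1) Nu.hyps(1), symmetric]
      den_Nu_open[OF Nu.prems(2) Nu.hyps(2), symmetric]
    by (rule Nu.IH) (use Nu.prems Nu.hyps(3) that in \<open>simp_all add: mclosed_simps(3)[of _ _ e]
        admissible_LX del: fun_upd_apply\<close>)
  then have "den M' \<theta> \<beta> (epush (EVar d) \<sigma>) \<subseteq> den M \<theta> \<beta> (epush (EVar d) \<sigma>)" if "d \<in> E K" for d
    using E_kind[OF that] by simp
  then show ?case unfolding den.simps by blast
next
  case (AppL M M' N)
  have "den M' \<theta> \<beta> \<sigma> \<subseteq> den M \<theta> \<beta> \<sigma>" by (rule AppL.IH) (use AppL.prems in \<open>auto simp: mclosed_simps\<close>)
  then show ?case by (simp add: fapp_mono)
next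
  case (AppR N N' M)
  have "den N' \<theta> \<beta> \<sigma> \<subseteq> den N \<theta> \<beta> \<sigma>" by (rule AppR.IH) (use AppR.prems in \<open>auto simp: mclosed_simps\<close>)
  then show ?case by (simp add: fapp_mono)
next
  case (AppT M M' A)
  have "den M' \<theta> \<beta> \<sigma> \<subseteq> den M \<theta> \<beta> \<sigma>" by (rule AppT.IH) (use AppT.prems in \<open>auto simp: mclosed_simps\<close>)
  then show ?case by (simp add: tapp_mono)
next
  case (GuardL M M' N)
  have "den M' \<theta> \<beta> \<sigma> \<subseteq> den M \<theta> \<beta> \<sigma>" by (rule GuardL.IH) (use GuardL.prems in \<open>auto simp: mclosed_simps\<close>)
  then show ?case by auto
next
  case (GuardR N N' M)
  have "den N' \<theta> \<beta> \<sigma> \<subseteq> den N \<theta> \<beta> \<sigma>" by (rule GuardR.IH) (use GuardR.prems in \<open>auto simp: mclosed_simps\<close>)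
  then show ?case by auto
next
  case (Ver M M' A)
  have "den M' \<theta> \<beta> \<sigma> \<subseteq> den M \<theta> \<beta> \<sigma>" by (rule Ver.IH) (use Ver.prems in \<open>auto simp: mclosed_simps\<close>)
  then show ?case by (auto elim: V_mono)
qed

lemma meta_eq_den:
  assumes "meta_eq \<Xi> M N" "admissible \<sigma>"
  shows "den M \<theta> \<beta> \<sigma> = den N \<theta> \<beta> \<sigma>"
proof -
  have "kinded_types (\<lambda>l. gkind (\<sigma> l)) P" if "wk \<Xi> P" for P :: "('k, 'a, 'e, 'b) mterm"
  proof -
    have "kinded_types (\<lambda>l. gkind (\<sigma> l)) P = kinded_types (kind_env (\<lambda>v. Some (\<Xi> v))) P"
      by (rule kinded_types_agree[OF wk_mclosed[OF that, unfolded mclosed_def]])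
        (use assms(2) in \<open>simp add: admissible_def\<close>)
    then show ?thesis using wk_kinded_types[OF that] by simp
  qed
  with assms(1) show ?thesis unfolding meta_eq_def by (intro den_conv) auto
qed

lemma red_den:
  assumes "red \<Xi> M N" "admissible \<sigma>"
  shows "den N \<theta> \<beta> \<sigma> \<subseteq> den M \<theta> \<beta> \<sigma>"
proof -
  from assms(1) obtain M' N' where *: "meta_eq \<Xi> M M'" "ctxt_closure \<Xi> (root_red \<Xi>) M' N'"
      "meta_eq \<Xi> N' N"
    unfolding red_def by blast
  have "den N' \<theta> \<beta> \<sigma> \<subseteq> den M' \<theta> \<beta> \<sigma>"
  proof (rule ctxt_closure_den[OF _ *(2) _ _ assms(2)])
    show "mclosed M'" "mclosed N'" using *(1,3) wk_mclosed unfolding meta_eq_def by blast+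
  qed (rule root_red_den)
  then show ?thesis using meta_eq_den[OF *(1) assms(2)] meta_eq_den[OF *(3) assms(2)] by simp
qed

lemma reds_Star_den:
  assumes "reds \<Xi> M Star" "admissible \<sigma>"
  shows "PStar \<in> den M \<theta> \<beta> \<sigma>"
proof -
  from assms(1) obtain N where *: "(red \<Xi>)\<^sup>*\<^sup>* M N" "meta_eq \<Xi> N Star" unfolding reds_def by blast
  from *(1) have "den N \<theta> \<beta> \<sigma> \<subseteq> den M \<theta> \<beta> \<sigma>"
    by (induction rule: rtranclp_induct) (auto dest: red_den[OF _ assms(2)])
  then show ?thesis using meta_eq_den[OF *(2) assms(2)] by auto
qed

text \<open>Monotonicity suffices in this direction: a function point fires on a subset of the
  points of the argument. An ill-kinded type redex has no points at all.\<close>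

lemma root_beta_den:
  assumes "root_beta M N" "mclosed M"
  shows "den M \<theta> \<beta> \<sigma> \<subseteq> den N \<theta> \<beta> \<sigma>"
  using assms(1)
proof cases
  case (beta M1 N1)
  with assms(2) have mc: "mclosed (Lam M1)" "mclosed N1" by (simp_all add: mclosed_simps)
  have "den M1 \<theta> (case_nat (rcset S) \<beta>) \<sigma> \<subseteq> den M1 \<theta> (case_nat (den N1 \<theta> \<beta> \<sigma>) \<beta>) \<sigma>"
    if "rcset S \<subseteq> den N1 \<theta> \<beta> \<sigma>" for S by (rule den_mono) (use that in \<open>auto split: nat.split\<close>)
  then show ?thesis unfolding beta den_open[OF mc(2)] den_Lam_mopen[OF mc(1)] by (auto simp: fapp_def)
next
  case (tbeta K M1 A)
  with assms(2) have mc: "mclosed (LamT K M1)" "closed A" by (simp_all add: mclosed_simps)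
  have "den M1 \<theta> \<beta> (push B \<sigma>) = den M1 \<theta> \<beta> (push (ty_sub \<sigma> A) \<sigma>)"
    if "joinable B (ty_sub \<sigma> A)" "gkind (ty_sub \<sigma> A) = Some J" "gkind B = Some J" for B J
    by (rule den_push_joinable) (use that in auto)
  then show ?thesis unfolding tbeta den_LamT_topen[OF mc] by (auto simp: tapp_def)
qed

end

subsection \<open>Normal forms\<close>

text \<open>The context rules treat both sides alike; this makes \<open>ctxt_closure_den\<close>
  applicable to \<beta>-steps read backwards.\<close>

lemma ctxt_closure_converse: "ctxt_closure \<Xi> R M N \<Longrightarrow> ctxt_closure \<Xi> (\<lambda>x y. R y x) N M"
  by (induction rule: ctxt_closure.induct) (auto intro: ctxt_closure.intros)

lemma root_beta_mclosed: "root_beta M N \<Longrightarrow> mclosed M \<Longrightarrow> mclosed N"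
proof (induction rule: root_beta.induct)
  case (beta M N)
  then have mc: "m_within name (case_nat True (\<lambda>_. False)) M" "mclosed N" by (auto simp: mclosed_def)
  moreover have "case_nat True (\<lambda>_. False) = (\<lambda>_. False)(0 := True)"
      by (auto simp: fun_eq_iff split: nat.split)
  ultimately show ?case unfolding mclosed_def[of "m_open _ _ _"] by (intro m_within_open) auto
next
  case (tbeta K M A)
  then have "m_within (push True name) (\<lambda>_. False) M" "closed A" by (auto simp: mclosed_def closed_def)
  moreover have "(name(LB 0 := ty_within name A)) l" if "push True name l" for l
    using that \<open>closed A\<close> by (cases l rule: leaf_cases) (auto simp: closed_def)
  ultimately show ?case unfolding mclosed_def m_within_topen[OF \<open>closed A\<close>]
    by (elim m_within_mono)
qed

lemma ctxt_beta_mclosed: "ctxt_closure \<Xi> root_beta M N \<Longrightarrow> mclosed M \<Longrightarrow> mclosed N"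
proof (induction rule: ctxt_closure.induct)
  case (base M N) then show ?case by (rule root_beta_mclosed)
next
  case (Lam x M M') then show ?case by (simp add: mclosed_simps(1)[of _ x])
next
  case (LamT a M M' K) then show ?case by (simp add: mclosed_simps(2)[of _ _ a])
next
  case (Nu e M M' K) then show ?case by (simp add: mclosed_simps(3)[of _ _ e])
qed (auto simp: mclosed_simps)

lemma pure_open: "pure M \<Longrightarrow> pure P \<Longrightarrow> pure (m_open k P M)"
  by (induction M arbitrary: k) auto

lemma pure_open_Var: "pure (m_open k (Var x) M) = pure M"
  by (induction M arbitrary: k) auto

lemma pure_topen: "pure (m_topen k A M) = pure M"
  by (induction M arbitrary: k) auto

lemma ctxt_beta_pure: "ctxt_closure \<Xi> root_beta M N \<Longrightarrow> pure M \<Longrightarrow> pure N"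
proof (induction rule: ctxt_closure.induct)
  case (base M N) then show ?case by (cases rule: root_beta.cases) (auto simp: pure_open pure_topen)
qed (auto simp: pure_open_Var pure_topen)

lemma m_conv_pure: "m_conv M N \<Longrightarrow> pure M = pure N"
  by (induction rule: m_conv.induct) (auto simp: pure_open_Var pure_topen)

text \<open>A syntactic form of normality that passes to components and to opened bodies, as the
  recursion of the readback requires.\<close>

primrec beta_normal :: "('k, 'a, 'e, 'x) mterm \<Rightarrow> bool" where
  "beta_normal (BVar j) = True"
| "beta_normal (Var x) = True"
| "beta_normal (Lam M) = beta_normal M"
| "beta_normal (App M N) = (beta_normal M \<and> beta_normal N \<and> (\<nexists>P. M = Lam P))"
| "beta_normal (LamT K M) = beta_normal M"
| "beta_normal (AppT M A) = (beta_normal M \<and> (\<nexists>K P. M = LamT K P))"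
| "beta_normal Star = True"
| "beta_normal (Guard M N) = (beta_normal M \<and> beta_normal N)"
| "beta_normal (Gen A) = True"
| "beta_normal (Ver A M) = beta_normal M"
| "beta_normal (Nu K M) = beta_normal M"

lemma beta_normal_open_Var: "beta_normal (m_open k (Var x) M) = beta_normal M"
proof (induction M arbitrary: k)
  case (App M N) then show ?case by (cases M) auto
next
  case (AppT M A) then show ?case by (cases M) auto
qed auto

lemma beta_normal_topen: "beta_normal (m_topen k A M) = beta_normal M"
proof (induction M arbitrary: k)
  case (App M N) then show ?case by (cases M) auto
next
  case (AppT M A) then show ?case by (cases M) auto
qed auto

lemma beta_normal_eopen: "beta_normal (m_eopen k A M) = beta_normal M"
proof (induction M arbitrary: k)
  case (App M N) then show ?case by (cases M) auto
next
  case (AppT M A) then show ?case by (cases M) auto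
qed auto

lemma m_conv_beta_normal: "m_conv M N \<Longrightarrow> beta_normal M = beta_normal N"
proof (induction rule: m_conv.induct)
  case (App M M' N N') 
  from App.hyps(1) have "(\<exists>P. M = Lam P) = (\<exists>P. M' = Lam P)" by cases auto
  with App show ?case by simp
next
  case (AppT M M' A A') 
  from AppT.hyps(1) have "(\<exists>K P. M = LamT K P) = (\<exists>K P. M' = LamT K P)" by cases auto
  with AppT show ?case by simp
qed (auto simp: beta_normal_open_Var beta_normal_topen beta_normal_eopen)

text \<open>\<open>M\<close> arises by replacing \<open>x\<close> with the index for its depth,
  which \<open>\<not> W k\<close> leaves vacant. The context rules below binders need reducts
  presented as opened bodies.\<close>

lemma m_closing: "m_within Z W P \<Longrightarrow> \<not> W k \<Longrightarrow> \<exists>M. m_open k (Var x) M = P \<and> x \<notin> m_fv M"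
proof (induction P arbitrary: Z W k)
  case (BVar j) then show ?case by (intro exI[of _ "BVar j"]) auto
next
  case (Var y) then show ?case by (intro exI[of _ "if y = x then BVar k else Var y"]) auto
next
  case (Lam P)
  from Lam.IH[of Z "case_nat True W" "Suc k"] Lam.prems obtain M
      where "m_open (Suc k) (Var x) M = P" "x \<notin> m_fv M"
    by auto
  then show ?case by (intro exI[of _ "Lam M"]) simp
next
  case (App P Q)
  then obtain M N where "m_open k (Var x) M = P" "x \<notin> m_fv M" "m_open k (Var x) N = Q" "x \<notin> m_fv N"
    by (metis m_within.simps(4))
  then show ?case by (intro exI[of _ "App M N"]) simp
next
  case (Guard P Q)
  then obtain M N where "m_open k (Var x) M = P" "x \<notin> m_fv M" "m_open k (Var x) N = Q" "x \<notin> m_fv N"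
    by (metis m_within.simps(8))
  then show ?case by (intro exI[of _ "Guard M N"]) simp
next
  case (LamT K P)
  from LamT.IH[of "push True Z" W k] LamT.prems obtain M where "m_open k (Var x) M = P" "x \<notin> m_fv M"
    by auto
  then show ?case by (intro exI[of _ "LamT K M"]) simp
next
  case (AppT P A)
  then obtain M where "m_open k (Var x) M = P" "x \<notin> m_fv M" by (metis m_within.simps(6))
  then show ?case by (intro exI[of _ "AppT M A"]) simp
next
  case Star then show ?case by (intro exI[of _ Star]) simp
next
  case (Gen A) then show ?case by (intro exI[of _ "Gen A"]) simp
next
  case (Ver A P)
  then obtain M where "m_open k (Var x) M = P" "x \<notin> m_fv M" by (metis m_within.simps(10))
  then show ?case by (intro exI[of _ "Ver A M"]) simp
next
  case (Nu K P)
  from Nu.IH[of "epush True Z" W k] Nu.prems obtain M where "m_open k (Var x) M = P" "x \<notin> m_fv M"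
    by auto
  then show ?case by (intro exI[of _ "Nu K M"]) simp
qed

lemma ty_closing: "ty_within Z A \<Longrightarrow> \<not> Z (LB k) \<Longrightarrow> \<exists>B. ty_open k (TVar a) B = A \<and> a \<notin> ty_ftv B"
proof (induction A arbitrary: Z k)
  case (TBound j) then show ?case by (intro exI[of _ "TBound j"]) auto
next
  case (EBound j) then show ?case by (intro exI[of _ "EBound j"]) auto
next
  case (TVar b) then show ?case by (intro exI[of _ "if b = a then TBound k else TVar b"]) auto
next
  case (EVar e) then show ?case by (intro exI[of _ "EVar e"]) auto
next
  case (TLam K A)
  from TLam.IH[of "push True Z" "Suc k"] TLam.prems obtain B
      where "ty_open (Suc k) (TVar a) B = A" "a \<notin> ty_ftv B"
    by auto
  then show ?case by (intro exI[of _ "TLam K B"]) simp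
next
  case (TAll K A)
  from TAll.IH[of "push True Z" "Suc k"] TAll.prems obtain B
      where "ty_open (Suc k) (TVar a) B = A" "a \<notin> ty_ftv B"
    by auto
  then show ?case by (intro exI[of _ "TAll K B"]) simp
next
  case (TApp A1 A2)
  then obtain B1 B2 where "ty_open k (TVar a) B1 = A1" "a \<notin> ty_ftv B1" "ty_open k (TVar a) B2 = A2"
      "a \<notin> ty_ftv B2"
    by (metis ty_within.simps(6))
  then show ?case by (intro exI[of _ "TApp B1 B2"]) simp
next
  case (Imp A1 A2)
  then obtain B1 B2 where "ty_open k (TVar a) B1 = A1" "a \<notin> ty_ftv B1" "ty_open k (TVar a) B2 = A2"
      "a \<notin> ty_ftv B2"
    by (metis ty_within.simps(7))
  then show ?case by (intro exI[of _ "Imp B1 B2"]) simp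
qed

lemma m_tclosing: "pure P \<Longrightarrow> m_within Z W P \<Longrightarrow> \<not> Z (LB k) \<Longrightarrow>
  \<exists>M. m_topen k (TVar a) M = P \<and> a \<notin> m_ftv M"
proof (induction P arbitrary: Z W k)
  case (BVar j) then show ?case by (intro exI[of _ "BVar j"]) auto
next
  case (Var y) then show ?case by (intro exI[of _ "Var y"]) auto
next
  case (Lam P)
  from Lam.IH[of Z "case_nat True W" k] Lam.prems obtain M
      where "m_topen k (TVar a) M = P" "a \<notin> m_ftv M"
    by auto
  then show ?case by (intro exI[of _ "Lam M"]) simp
next
  case (App P Q)
  then obtain M N where "m_topen k (TVar a) M = P" "a \<notin> m_ftv M" "m_topen k (TVar a) N = Q"
      "a \<notin> m_ftv N"
    by (metis m_within.simps(4) pure.simps(4))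
  then show ?case by (intro exI[of _ "App M N"]) simp
next
  case (LamT K P)
  from LamT.IH[of "push True Z" W "Suc k"] LamT.prems obtain M
      where "m_topen (Suc k) (TVar a) M = P" "a \<notin> m_ftv M"
    by auto
  then show ?case by (intro exI[of _ "LamT K M"]) simp
next
  case (AppT P A)
  then obtain M where "m_topen k (TVar a) M = P" "a \<notin> m_ftv M"
      by (metis m_within.simps(6) pure.simps(6))
  moreover obtain B where "ty_open k (TVar a) B = A" "a \<notin> ty_ftv B"
      using ty_closing[of Z A k a] AppT.prems by auto
  ultimately show ?case by (intro exI[of _ "AppT M B"]) simp
qed auto

lemma size_m_open_Var: "size (m_open k (Var x) M) = size M"
  by (induction M arbitrary: k) auto

lemma size_m_topen: "size (m_topen k (TVar a) M) = size M"
  by (induction M arbitrary: k) (auto simp: size_ty_open_TVar)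

lemma finite_m_fv: "finite (m_fv M)" by (induction M) auto
lemma finite_m_ftv: "finite (m_ftv M)" by (induction M) auto
lemma finite_m_fev: "finite (m_fev M)" by (induction M) auto

text \<open>A redex below a binder is contracted in the body opened with a fresh name, and the
  reduct is closed again. Below \<Lambda> the name must have the kind of the binder, hence the
  appeal to \<open>kind_assignment\<close>.\<close>

lemma not_beta_normal_reducible:
  fixes M :: "('k, 'a, 'e, 'x) mterm"
  assumes \<Xi>: "kind_assignment \<Xi>" and inf: "infinite (UNIV :: 'x set)"
  shows "pure M \<Longrightarrow> mclosed M \<Longrightarrow> \<not> beta_normal M \<Longrightarrow> \<exists>N. ctxt_closure \<Xi> root_beta M N"
proof (induction M rule: measure_induct_rule[of size])
  case (less M)
  show ?case
  proof (cases M)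
    case (Lam M1)
    obtain x where x: "x \<notin> m_fv M1" using ex_new_if_finite[OF inf finite_m_fv] by blast
    have mc: "mclosed (m_open 0 (Var x) M1)" using less.prems(2) Lam
        by (simp add: mclosed_simps(1)[of _ x])
    moreover have "size (m_open 0 (Var x) M1) < size M" by (simp add: Lam size_m_open_Var)
    ultimately obtain P where P: "ctxt_closure \<Xi> root_beta (m_open 0 (Var x) M1) P"
      using less.IH less.prems Lam by
          (metis beta_normal_open_Var pure_open_Var beta_normal.simps(3) pure.simps(3))
    from ctxt_beta_mclosed[OF P mc] m_closing[of name "\<lambda>_. False" P 0 x] obtain M2 where
      "m_open 0 (Var x) M2 = P" "x \<notin> m_fv M2" unfolding mclosed_def by blast
    with P x show ?thesis unfolding Lam by (blast intro: ctxt_closure.Lam)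
  next
    case (LamT K M1)
    have "infinite {a. \<Xi> (Inl a) = K}" using \<Xi> unfolding kind_assignment_def by blast
    then obtain a where a: "\<Xi> (Inl a) = K" "a \<notin> m_ftv M1"
      using finite_m_ftv[of M1] by (metis (mono_tags, lifting) finite_subset mem_Collect_eq subsetI)
    have mc: "mclosed (m_topen 0 (TVar a) M1)" using less.prems(2) LamT
        by (simp add: mclosed_simps(2)[of _ _ a])
    moreover have "size (m_topen 0 (TVar a) M1) < size M" by (simp add: LamT size_m_topen)
    moreover have pu: "pure (m_topen 0 (TVar a) M1)" using less.prems LamT by (simp add: pure_topen)
    ultimately obtain P where P: "ctxt_closure \<Xi> root_beta (m_topen 0 (TVar a) M1) P"
      using less.IH less.prems LamT by (metis beta_normal_topen beta_normal.simps(5))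
    from ctxt_beta_mclosed[OF P mc] ctxt_beta_pure[OF P pu] m_tclosing[of P name
        "\<lambda>_. False" 0 a] obtain M2 where
      "m_topen 0 (TVar a) M2 = P" "a \<notin> m_ftv M2" unfolding mclosed_def by auto
    with P a show ?thesis unfolding LamT by (blast intro: ctxt_closure.LamT)
  next
    case (App M1 M2)
    then have *: "mclosed M1" "mclosed M2" "pure M1" "pure M2" "size M1 < size M" "size M2 < size M"
      using less.prems by (auto simp: mclosed_simps)
    consider P where "M1 = Lam P" | "\<not> beta_normal M1" | "\<not> beta_normal M2" using less.prems App by auto
    then show ?thesis
    proof cases
      case 1
      then show ?thesis unfolding App by (auto intro: ctxt_closure.base root_beta.beta)
    next
      case 2
      from less.IH[OF *(5,3,1) 2] show ?thesis unfolding App by (auto intro: ctxt_closure.AppL)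
    next
      case 3
      from less.IH[OF *(6,4,2) 3] show ?thesis unfolding App by (auto intro: ctxt_closure.AppR)
    qed
  next
    case (AppT M1 A)
    then have *: "mclosed M1" "pure M1" "size M1 < size M"
      using less.prems by (auto simp: mclosed_simps)
    consider K P where "M1 = LamT K P" | "\<not> beta_normal M1" using less.prems AppT by auto
    then show ?thesis
    proof cases
      case 1
      then show ?thesis unfolding AppT by (auto intro: ctxt_closure.base root_beta.tbeta)
    next
      case 2
      from less.IH[OF *(3,2,1) 2] show ?thesis unfolding AppT by (auto intro: ctxt_closure.AppT)
    qed
  qed (use less.prems in auto)
qed

subsection \<open>Reading typing derivations off the model\<close>

lemma wf_env_gwf: "wf_env \<xi> \<Gamma> \<Longrightarrow> \<Gamma> x = Some C \<Longrightarrow> kind_of (kind_env \<xi>) C = Some KProp"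
  unfolding wf_env_def using kinding_kind_of by blast

lemma typing_joinable:
  fixes A B :: "('k, 'a, 'e) ty"
  assumes "infinite (UNIV :: 'a set)" "finite (dom \<xi>)" "typing \<xi> \<Gamma> t A" "joinable A B"
    "kind_of (kind_env \<xi>) A = Some KProp" "kind_of (kind_env \<xi>) B = Some KProp"
  shows "typing \<xi> \<Gamma> t B"
  using assms by (intro typing.conv[OF assms(3)] kind_of_kinding joinable_ty_eq)
      (auto intro: kind_of_kind_env_closed)

context model
begin

text \<open>A variable outside \<open>\<Gamma>\<close> gets no points, so no test can succeed on a
  term headed by it.\<close>

definition genv :: "('x \<rightharpoonup> ('k, 'a, 'e) ty) \<Rightarrow> (('a, 'e) leaf \<Rightarrow> ('k, 'a, 'e) ty) \<Rightarrow>
    'x \<Rightarrow> ('k, 'a, 'e) point set" where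
  "genv \<Gamma> \<sigma> x = (case \<Gamma> x of None \<Rightarrow> {} | Some C \<Rightarrow> {\<tau>. G (ty_sub \<sigma> C) \<tau>})"

lemma den_env_subst:
  assumes "\<And>x C. \<Gamma> x = Some C \<Longrightarrow> closed C"
  shows "den (env_subst \<Gamma> M) (\<lambda>_. {}) \<beta> \<sigma> = den M (genv \<Gamma> \<sigma>) \<beta> \<sigma>"
proof -
  have [simp]: "genv \<Gamma> (push B \<sigma>) = genv \<Gamma> \<sigma>" "genv \<Gamma> (epush B \<sigma>) = genv \<Gamma> \<sigma>" for B \<sigma>
  proof -
    have "ty_sub (push B \<sigma>) C = ty_sub \<sigma> C" "ty_sub (epush B \<sigma>) C = ty_sub \<sigma> C" if "\<Gamma> x = Some C"
        for x C
      by (rule ty_sub_closed[OF assms[OF that]]; simp)+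
    then show "genv \<Gamma> (push B \<sigma>) = genv \<Gamma> \<sigma>" "genv \<Gamma> (epush B \<sigma>) = genv \<Gamma> \<sigma>"
      by (auto simp: genv_def fun_eq_iff split: option.splits)
  qed
  show ?thesis
    by (induction M arbitrary: \<beta> \<sigma>) (simp_all add: genv_def[of \<Gamma>] split: option.split)
qed

text \<open>Reading a type off a derivation of \<open>V\<close> opens a \<open>\<Lambda>a:K\<close> with an eigenvariable where typing needs a
  type-variable; \<open>r\<close> records this correspondence and must be undone to recover the type.\<close>

definition renaming :: "('a + 'e \<rightharpoonup> 'k kind) \<Rightarrow> (('a, 'e) leaf \<Rightarrow> ('a, 'e) leaf) \<Rightarrow> bool" where
  "renaming \<xi> r \<longleftrightarrow> inj_on r {l. kind_env \<xi> l \<noteq> None} \<and>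
     (\<forall>l. kind_env \<xi> l \<noteq> None \<longrightarrow> kind_env (\<lambda>v. Some (\<Xi> v)) (r l) = kind_env \<xi> l)"

lemma gkind_renaming:
  assumes "renaming \<xi> r" "ty_within (\<lambda>l. kind_env \<xi> l \<noteq> None) A"
  shows "gkind (ty_sub (\<lambda>l. leaf_ty (r l)) A) = kind_of (kind_env \<xi>) A"
  unfolding kind_of_ty_sub by (rule kind_of_agree[OF assms(2)])
      (use assms(1) in \<open>simp add: renaming_def\<close>)

lemma renaming_inj:
  fixes A B :: "('k, 'a, 'e) ty"
  assumes "renaming \<xi> r" "ty_within (\<lambda>l. kind_env \<xi> l \<noteq> None) A" "ty_within (\<lambda>l. kind_env \<xi> l \<noteq> None) B"
    "ty_sub (\<lambda>l. leaf_ty (r l)) A = ty_sub (\<lambda>l. leaf_ty (r l)) B"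
  shows "A = B"
proof -
  let ?\<psi> = "\<lambda>l. leaf_ty (inv_into {l. kind_env \<xi> l \<noteq> None} r l) :: ('k, 'a, 'e) ty"
  have "ty_sub ?\<psi> (ty_sub (\<lambda>l. leaf_ty (r l)) C) = C" if "ty_within (\<lambda>l. kind_env \<xi> l \<noteq> None) C" for C
  proof -
    have "ty_sub ?\<psi> (ty_sub (\<lambda>l. leaf_ty (r l)) C) = ty_sub leaf_ty C" unfolding ty_sub_ty_sub
      by (rule ty_sub_agree[OF that]) (use assms(1) in \<open>simp add: renaming_def\<close>)
    then show ?thesis by simp
  qed
  with assms(2-) show ?thesis by metis
qed

text \<open>A common reduct of the renamed types pulls back along both reductions. Reduction adds no
  names, so the two preimages stay where \<open>r\<close> is injective and must coincide.\<close>

lemma renaming_joinable: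
  fixes A B :: "('k, 'a, 'e) ty"
  assumes "renaming \<xi> r" "ty_within (\<lambda>l. kind_env \<xi> l \<noteq> None) A" "ty_within (\<lambda>l. kind_env \<xi> l \<noteq> None) B"
    "joinable (ty_sub (\<lambda>l. leaf_ty (r l)) A) (ty_sub (\<lambda>l. leaf_ty (r l)) B)"
  shows "joinable A B"
proof -
  from assms(4) obtain C where "pars (ty_sub (\<lambda>l. leaf_ty (r l)) A) C"
      "pars (ty_sub (\<lambda>l. leaf_ty (r l)) B) C"
    unfolding joinable_def by blast
  then obtain A' B' where *: "pars A A'" "pars B B'"
      "ty_sub (\<lambda>l. leaf_ty (r l)) A' = ty_sub (\<lambda>l. leaf_ty (r l)) B'"
    using pars_reflect by metis
  have "A' = B'" by (rule renaming_inj[OF assms(1) _ _ *(3)]) (use * assms ty_within_pars in blast)+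
  with * show ?thesis unfolding joinable_def by blast
qed

lemma renaming_Imp:
  assumes "pars (ty_sub (\<lambda>l. leaf_ty (r l)) A) (Imp B C)" "kind_of \<kappa> A = Some KProp"
  shows "\<exists>B' C'. pars A (Imp B' C') \<and> B = ty_sub (\<lambda>l. leaf_ty (r l)) B' \<and>
      C = ty_sub (\<lambda>l. leaf_ty (r l)) C' \<and>
    kind_of \<kappa> B' = Some KProp \<and> kind_of \<kappa> C' = Some KProp"
proof -
  from pars_reflect[OF assms(1)] obtain D where D: "pars A D" "Imp B C = ty_sub (\<lambda>l. leaf_ty (r l)) D"
      by blast
  from D(2) obtain B' C' where "D = Imp B' C'" "B = ty_sub (\<lambda>l. leaf_ty (r l)) B'"
      "C = ty_sub (\<lambda>l. leaf_ty (r l)) C'"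
    by (cases D) (auto dest: HOL.sym)
  with D(1) kind_of_pars[OF D(1) assms(2)] show ?thesis by (auto split: if_splits)
qed

lemma renaming_TAll:
  assumes "pars (ty_sub (\<lambda>l. leaf_ty (r l)) A) (TAll K C)" "kind_of \<kappa> A = Some KProp"
  shows "\<exists>C'. pars A (TAll K C') \<and> C = ty_sub (up (\<lambda>l. leaf_ty (r l))) C' \<and>
      kind_of (push (Some K) \<kappa>) C' = Some KProp"
proof -
  from pars_reflect[OF assms(1)] obtain D
      where D: "pars A D" "TAll K C = ty_sub (\<lambda>l. leaf_ty (r l)) D" by blast
  from D(2) obtain C' where "D = TAll K C'" "C = ty_sub (up (\<lambda>l. leaf_ty (r l))) C'"
    by (cases D) (auto dest: HOL.sym)
  with D(1) kind_of_pars[OF D(1) assms(2)] show ?thesis by (auto split: if_splits)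
qed

text \<open>The bound on free leaves keeps the type arguments in \<open>N\<close> inside the domain
  of \<open>\<xi>\<close>, where \<open>r\<close> preserves kinds and is injective.\<close>

definition readable :: "('a + 'e \<rightharpoonup> 'k kind) \<Rightarrow> (('a, 'e) leaf \<Rightarrow> ('a, 'e) leaf) \<Rightarrow>
    ('x \<rightharpoonup> ('k, 'a, 'e) ty) \<Rightarrow> ('k, 'a, 'e, 'x) mterm \<Rightarrow> bool" where
  "readable \<xi> r \<Gamma> N \<longleftrightarrow> finite (dom \<xi>) \<and> renaming \<xi> r \<and> wf_env \<xi> \<Gamma> \<and> pure N \<and> beta_normal N \<and>
     m_within (\<lambda>l. kind_env \<xi> l \<noteq> None) (\<lambda>_. False) N"

lemma readable_mclosed: "readable \<xi> r \<Gamma> N \<Longrightarrow> mclosed N"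
  unfolding readable_def mclosed_def by (auto elim!: m_within_mono intro: kind_env_name)

text \<open>The points of \<open>N\<close> belong to \<open>gen\<close> at the inferred type
  \<open>D\<close>, so by \<open>V_G\<close> the tested type is convertible to \<open>D\<close>, and
  the conversion rule concludes.\<close>

lemma read_neutral:
  fixes N :: "('k, 'a, 'e, 'x) mterm"
  assumes inf: "infinite (UNIV :: 'a set)" and "readable \<xi> r \<Gamma> N"
    and neutral: "den N \<theta> \<beta> (\<lambda>l. leaf_ty (r l)) \<noteq> {} \<Longrightarrow>
      \<exists>D. kind_of (kind_env \<xi>) D = Some KProp \<and> typing \<xi> \<Gamma> N D \<and>
        den N \<theta> \<beta> (\<lambda>l. leaf_ty (r l)) \<subseteq> {\<tau>. G (ty_sub (\<lambda>l. leaf_ty (r l)) D) \<tau>}"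
    and A: "kind_of (kind_env \<xi>) A = Some KProp"
        "V (ty_sub (\<lambda>l. leaf_ty (r l)) A) (den N \<theta> \<beta> (\<lambda>l. leaf_ty (r l)))"
  shows "typing \<xi> \<Gamma> N A"
proof -
  from neutral[OF V_nonempty[OF A(2)]] obtain D
      where D: "kind_of (kind_env \<xi>) D = Some KProp" "typing \<xi> \<Gamma> N D"
    "den N \<theta> \<beta> (\<lambda>l. leaf_ty (r l)) \<subseteq> {\<tau>. G (ty_sub (\<lambda>l. leaf_ty (r l)) D) \<tau>}" by blast
  from assms(2) have r: "renaming \<xi> r" "finite (dom \<xi>)" unfolding readable_def by auto
  from V_G[OF A(2) D(3)] have "joinable A D"
    by (rule renaming_joinable[OF r(1), rotated 2]) (intro kind_of_ty_within, fact)+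
  from typing_joinable[OF inf r(2) D(2) joinable_sym[OF this] D(1) A(1)] show ?thesis .
qed

lemma read_App:
  fixes N1 N2 :: "('k, 'a, 'e, 'x) mterm" and r :: "('a, 'e) leaf \<Rightarrow> ('a, 'e) leaf"
  defines "\<phi> \<equiv> \<lambda>l. leaf_ty (r l) :: ('k, 'a, 'e) ty"
  assumes inf: "infinite (UNIV :: 'a set)" and "readable \<xi> r \<Gamma> (App N1 N2)"
    and 1: "\<exists>D. kind_of (kind_env \<xi>) D = Some KProp \<and> typing \<xi> \<Gamma> N1 D \<and>
        den N1 \<theta> \<beta> \<phi> \<subseteq> {\<tau>. G (ty_sub \<phi> D) \<tau>}"
    and 2: "\<And>B. kind_of (kind_env \<xi>) B = Some KProp \<Longrightarrow> V (ty_sub \<phi> B) (den N2 \<theta> \<beta> \<phi>) \<Longrightarrow> typing \<xi> \<Gamma> N2 B"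
    and ne: "den (App N1 N2) \<theta> \<beta> \<phi> \<noteq> {}"
  shows "\<exists>D. kind_of (kind_env \<xi>) D = Some KProp \<and> typing \<xi> \<Gamma> (App N1 N2) D \<and>
    den (App N1 N2) \<theta> \<beta> \<phi> \<subseteq> {\<tau>. G (ty_sub \<phi> D) \<tau>}"
proof -
  from assms(3) have fin: "finite (dom \<xi>)" unfolding readable_def by auto
  from 1 obtain D where D: "kind_of (kind_env \<xi>) D = Some KProp" "typing \<xi> \<Gamma> N1 D"
    "den N1 \<theta> \<beta> \<phi> \<subseteq> {\<tau>. G (ty_sub \<phi> D) \<tau>}" by blast
  \<comment> \<open>One point of the application exposes the domain type: its \<open>S\<close>
    passes the test at that type and consists of points of \<open>N2\<close>, so \<open>N2\<close>
    passes it too.\<close>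
  from ne obtain \<tau> S where \<tau>: "PFun S \<tau> \<in> den N1 \<theta> \<beta> \<phi>" "rcset S \<subseteq> den N2 \<theta> \<beta> \<phi>"
    by (auto simp: fapp_def)
  with D(3) have "G (ty_sub \<phi> D) (PFun S \<tau>)" by blast
  then obtain B C where BC: "pars (ty_sub \<phi> D) (Imp B C)" "V B (rcset S)" by (auto elim: G_PFunE)
  from renaming_Imp[OF BC(1)[unfolded \<phi>_def] D(1)] obtain B' C' where
    D': "pars D (Imp B' C')" "B = ty_sub \<phi> B'" "C = ty_sub \<phi> C'"
        "kind_of (kind_env \<xi>) B' = Some KProp" "kind_of (kind_env \<xi>) C' = Some KProp"
    unfolding \<phi>_def by blast
  have "typing \<xi> \<Gamma> N1 (Imp B' C')"
    by (rule typing_joinable[OF inf fin D(2) pars_joinable[OF D'(1)] D(1)]) (simp add: D')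
  moreover have "typing \<xi> \<Gamma> N2 B'" by (rule 2[OF D'(4)], rule V_mono[OF _ \<tau>(2)])
      (use BC(2) D'(2) in simp)
  ultimately have "typing \<xi> \<Gamma> (App N1 N2) C'" by (rule typing.App)
  moreover have "den (App N1 N2) \<theta> \<beta> \<phi> \<subseteq> {\<tau>. G (ty_sub \<phi> C') \<tau>}"
  proof
    fix \<upsilon> assume "\<upsilon> \<in> den (App N1 N2) \<theta> \<beta> \<phi>"
    then obtain T where "PFun T \<upsilon> \<in> den N1 \<theta> \<beta> \<phi>" by (auto simp: fapp_def)
    with D(3) have "G (ty_sub \<phi> D) (PFun T \<upsilon>)" by blast
    then obtain B2 C2 where D2: "pars (ty_sub \<phi> D) (Imp B2 C2)" "G C2 \<upsilon>" by (auto elim: G_PFunE)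
    have "joinable (Imp B2 C2) (Imp B C)" using pars_joinable[OF BC(1)] pars_joinable[OF D2(1)]
        by (meson joinable_sym joinable_trans)
    with D2(2) D'(3) show "\<upsilon> \<in> {\<tau>. G (ty_sub \<phi> C') \<tau>}" using G_V_joinable(1) joinable_Imp_Imp by blast
  qed
  ultimately show ?thesis using D'(5) by blast
qed

lemma read_AppT:
  fixes N1 :: "('k, 'a, 'e, 'x) mterm" and r :: "('a, 'e) leaf \<Rightarrow> ('a, 'e) leaf"
  defines "\<phi> \<equiv> \<lambda>l. leaf_ty (r l) :: ('k, 'a, 'e) ty"
  assumes inf: "infinite (UNIV :: 'a set)" and rd: "readable \<xi> r \<Gamma> (AppT N1 B)"
    and 1: "\<exists>D. kind_of (kind_env \<xi>) D = Some KProp \<and> typing \<xi> \<Gamma> N1 D \<and>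
        den N1 \<theta> \<beta> \<phi> \<subseteq> {\<tau>. G (ty_sub \<phi> D) \<tau>}"
    and ne: "den (AppT N1 B) \<theta> \<beta> \<phi> \<noteq> {}"
  shows "\<exists>D. kind_of (kind_env \<xi>) D = Some KProp \<and> typing \<xi> \<Gamma> (AppT N1 B) D \<and>
    den (AppT N1 B) \<theta> \<beta> \<phi> \<subseteq> {\<tau>. G (ty_sub \<phi> D) \<tau>}"
proof -
  from rd have fin: "finite (dom \<xi>)" and r: "renaming \<xi> r" and B:
      "ty_within (\<lambda>l. kind_env \<xi> l \<noteq> None) B"
    unfolding readable_def by auto
  from 1 obtain D where D: "kind_of (kind_env \<xi>) D = Some KProp" "typing \<xi> \<Gamma> N1 D"
    "den N1 \<theta> \<beta> \<phi> \<subseteq> {\<tau>. G (ty_sub \<phi> D) \<tau>}" by blast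
  from ne obtain \<tau> B1 K where \<tau>: "PTFun B1 \<tau> \<in> den N1 \<theta> \<beta> \<phi>" "gkind (ty_sub \<phi> B) = Some K"
      "gkind B1 = Some K"
    by (auto simp: tapp_def)
  with D(3) have "G (ty_sub \<phi> D) (PTFun B1 \<tau>)" by blast
  then obtain C where C: "pars (ty_sub \<phi> D) (TAll K C)" using \<tau>(3) by (auto elim: G_PTFunE)
  from renaming_TAll[OF C[unfolded \<phi>_def] D(1)] obtain C' where
    D': "pars D (TAll K C')" "C = ty_sub (up \<phi>) C'"
        "kind_of (push (Some K) (kind_env \<xi>)) C' = Some KProp"
    unfolding \<phi>_def by blast
  \<comment> \<open>The kind check in \<open>tapp\<close>, transported back along \<open>r\<close>,
    is what the rule for type application asks of \<open>B\<close>.\<close>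
  have kB: "kind_of (kind_env \<xi>) B = Some K" using gkind_renaming[OF r B] \<tau>(2) unfolding \<phi>_def by simp
  have kAll: "kind_of (kind_env \<xi>) (TAll K C') = Some KProp" by (simp add: D')
  have "typing \<xi> \<Gamma> N1 (TAll K C')"
    by (rule typing_joinable[OF inf fin D(2) pars_joinable[OF D'(1)] D(1) kAll])
  then have "typing \<xi> \<Gamma> (AppT N1 B) (ty_open 0 B C')"
      by (rule typing.AppT) (rule kind_of_kinding[OF inf fin kB])
  moreover have "ty_open 0 B C' = inst B C'"
    by (rule ty_open_inst)
        (use kind_of_kind_env_closed[OF kB] kind_of_kind_env_closed[OF kAll] in \<open>auto simp:
        ty_ren_closed ty_lc_closed[symmetric]\<close>)
  moreover have "den (AppT N1 B) \<theta> \<beta> \<phi> \<subseteq> {\<tau>. G (ty_sub \<phi> (inst B C')) \<tau>}"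
  proof
    fix \<upsilon> assume "\<upsilon> \<in> den (AppT N1 B) \<theta> \<beta> \<phi>"
    then obtain B2 where B2: "PTFun B2 \<upsilon> \<in> den N1 \<theta> \<beta> \<phi>" "joinable B2 (ty_sub \<phi> B)"
        by (auto simp: tapp_def)
    with D(3) have "G (ty_sub \<phi> D) (PTFun B2 \<upsilon>)" by blast
    then obtain K2 C2 where D2: "pars (ty_sub \<phi> D) (TAll K2 C2)" "G (inst B2 C2) \<upsilon>"
        by (auto elim: G_PTFunE)
    have "joinable (TAll K2 C2) (TAll K C)" using pars_joinable[OF C] pars_joinable[OF D2(1)]
        by (meson joinable_sym joinable_trans)
    then have "joinable (inst B2 C2) (inst (ty_sub \<phi> B) C)"
        using B2(2) joinable_TAll_TAll joinable_inst by blast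
    with D2(2) show "\<upsilon> \<in> {\<tau>. G (ty_sub \<phi> (inst B C')) \<tau>}"
      unfolding ty_sub_inst_up D'(2)[symmetric] using G_V_joinable(1) by blast
  qed
  moreover have "kind_of (kind_env \<xi>) (inst B C') = Some KProp" by (simp add: kind_of_inst kB D')
  ultimately show ?thesis by auto
qed

lemma read_Lam:
  fixes N :: "('k, 'a, 'e, 'x) mterm" and r :: "('a, 'e) leaf \<Rightarrow> ('a, 'e) leaf"
  defines "\<phi> \<equiv> \<lambda>l. leaf_ty (r l) :: ('k, 'a, 'e) ty"
  assumes inf: "infinite (UNIV :: 'a set)" "infinite (UNIV :: 'x set)" and rd: "readable \<xi> r \<Gamma> (Lam N)"
    and IH: "\<And>x \<Gamma>' B. readable \<xi> r \<Gamma>' (m_open 0 (Var x) N) \<Longrightarrow> kind_of (kind_env \<xi>) B = Some KProp \<Longrightarrow>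
      V (ty_sub \<phi> B) (den (m_open 0 (Var x) N) (genv \<Gamma>' \<phi>) \<beta> \<phi>) \<Longrightarrow> typing \<xi> \<Gamma>' (m_open 0 (Var x) N) B"
    and A: "kind_of (kind_env \<xi>) A = Some KProp" "V (ty_sub \<phi> A) (den (Lam N) (genv \<Gamma> \<phi>) \<beta> \<phi>)"
  shows "typing \<xi> \<Gamma> (Lam N) A"
  using A(2)
proof cases
  \<comment> \<open>An abstraction has only \<open>PFun\<close> points, so of the three tests only
    the one at an implication can succeed.\<close>
  case (V_At A') then show ?thesis by auto
next
  case (V_All K C L Y)
  obtain e where "e \<in> E K - L" using E_fresh[OF V_All(2)] by blast
  with V_All(3,4) V_nonempty show ?thesis by (fastforce simp: tapp_def)
next
  case (V_Imp B C Y)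
  from rd have fin: "finite (dom \<xi>)" and \<Gamma>: "wf_env \<xi> \<Gamma>" unfolding readable_def by auto
  from renaming_Imp[OF V_Imp(1)[unfolded \<phi>_def] A(1)] obtain B' C' where
    A': "pars A (Imp B' C')" "B = ty_sub \<phi> B'" "C = ty_sub \<phi> C'"
        "kind_of (kind_env \<xi>) B' = Some KProp" "kind_of (kind_env \<xi>) C' = Some KProp"
    unfolding \<phi>_def by blast
  have "finite (m_fv N \<union> dom \<Gamma>)" using \<Gamma> unfolding wf_env_def by (simp add: finite_m_fv)
  then obtain x where x: "x \<notin> m_fv N" "x \<notin> dom \<Gamma>" using ex_new_if_finite[OF inf(2)] by blast
  define \<Gamma>' where "\<Gamma>' = \<Gamma>(x \<mapsto> B')"
  have "wf_env \<xi> \<Gamma>'" using \<Gamma> kind_of_kinding[OF inf(1) fin A'(4)] unfolding wf_env_def \<Gamma>'_def by auto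
  moreover have "m_within (\<lambda>l. kind_env \<xi> l \<noteq> None) ((\<lambda>_. False)(0 := True)) N"
    using rd unfolding readable_def by (auto elim!: m_within_mono split: nat.splits)
  ultimately have rd': "readable \<xi> r \<Gamma>' (m_open 0 (Var x) N)"
    using rd unfolding readable_def by (simp add: pure_open_Var beta_normal_open_Var m_within_open_Var)
  have genv: "genv \<Gamma>' \<phi> = (genv \<Gamma> \<phi>)(x := {\<tau>. G B \<tau>})"
    by (auto simp: genv_def \<Gamma>'_def fun_eq_iff A'(2))
  have "Y \<subseteq> den (m_open 0 (Var x) N) (genv \<Gamma>' \<phi>) \<beta> \<phi>"
  proof
    fix \<tau> assume "\<tau> \<in> Y"
    from V_Imp(3)[OF this] obtain S where S: "\<tau> \<in> den N (genv \<Gamma> \<phi>) (case_nat (rcset S) \<beta>) \<phi>"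
      "rcset S \<subseteq> {\<tau>. G B \<tau>}" by auto
    \<comment> \<open>All of \<open>S\<close> lies in \<open>gen\<close> at \<open>B\<close>, so by
      monotonicity \<open>S\<close> may be enlarged to the full set that the new variable
      denotes.\<close>
    have "den N (genv \<Gamma> \<phi>) (case_nat (rcset S) \<beta>) \<phi> \<subseteq> den N (genv \<Gamma> \<phi>) (case_nat {\<tau>. G B \<tau>} \<beta>) \<phi>"
      by (rule den_mono) (use S(2) in \<open>auto split: nat.split\<close>)
    with S(1) show "\<tau> \<in> den (m_open 0 (Var x) N) (genv \<Gamma>' \<phi>) \<beta> \<phi>"
      unfolding genv den_Lam_open[OF readable_mclosed[OF rd] x(1)] by blast
  qed
  from V_mono[OF V_Imp(2) this] have "typing \<xi> \<Gamma>' (m_open 0 (Var x) N) C'"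
    unfolding A'(3) by (rule IH[OF rd' A'(5)])
  then have "typing \<xi> \<Gamma> (Lam N) (Imp B' C')" unfolding \<Gamma>'_def by (rule typing.Lam[OF x(2,1)])
  then show ?thesis by (rule typing_joinable[OF inf(1) fin _ joinable_sym[OF pars_joinable[OF A'(1)]]
      _ A(1)]) (simp add: A')
qed

lemma finite_kind_env: "finite (dom \<xi>) \<Longrightarrow> finite {l. kind_env \<xi> l \<noteq> None}"
proof -
  assume "finite (dom \<xi>)"
  moreover have "{l. kind_env \<xi> l \<noteq> None} \<subseteq> case_sum LV LX ` dom \<xi>"
  proof
    fix l assume "l \<in> {l. kind_env \<xi> l \<noteq> None}"
    then show "l \<in> case_sum LV LX ` dom \<xi>" by (cases l) (force simp: image_iff dom_def)+
  qed
  ultimately show ?thesis by (meson finite_imageI finite_subset)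
qed

text \<open>The test instantiates the quantifier with an eigenvariable \<open>e\<close>, typing with
  a type-variable \<open>a\<close>; recording \<open>a\<close> as renamed to \<open>e\<close> makes
  both instances agree.\<close>

lemma read_LamT:
  fixes N :: "('k, 'a, 'e, 'x) mterm" and r :: "('a, 'e) leaf \<Rightarrow> ('a, 'e) leaf"
  defines "\<phi> \<equiv> \<lambda>l. leaf_ty (r l) :: ('k, 'a, 'e) ty"
  assumes inf: "infinite (UNIV :: 'a set)" and rd: "readable \<xi> r \<Gamma> (LamT J N)"
    and IH: "\<And>a \<xi>' r' B. readable \<xi>' r' \<Gamma> (m_topen 0 (TVar a) N) \<Longrightarrow>
        kind_of (kind_env \<xi>') B = Some KProp \<Longrightarrow>
      V (ty_sub (\<lambda>l. leaf_ty (r' l)) B) (den (m_topen 0 (TVar a) N) (genv \<Gamma> (\<lambda>l. leaf_ty (r' l))) \<beta>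
          (\<lambda>l. leaf_ty (r' l))) \<Longrightarrow>
      typing \<xi>' \<Gamma> (m_topen 0 (TVar a) N) B"
    and A: "kind_of (kind_env \<xi>) A = Some KProp" "V (ty_sub \<phi> A) (den (LamT J N) (genv \<Gamma> \<phi>) \<beta> \<phi>)"
  shows "typing \<xi> \<Gamma> (LamT J N) A"
  using A(2)
proof cases
  case (V_At A') then show ?thesis by auto
next
  case (V_Imp B C Y)
  with V_nonempty[OF V_Imp(2)] show ?thesis by fastforce
next
  case (V_All K C L Y)
  from rd have fin: "finite (dom \<xi>)" and \<Gamma>: "wf_env \<xi> \<Gamma>" and r: "renaming \<xi> r" unfolding readable_def
      by auto
  from renaming_TAll[OF V_All(1)[unfolded \<phi>_def] A(1)] obtain C' where
    A': "pars A (TAll K C')" "C = ty_sub (up \<phi>) C'"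
        "kind_of (push (Some K) (kind_env \<xi>)) C' = Some KProp"
    unfolding \<phi>_def by blast
  have kAll: "kind_of (kind_env \<xi>) (TAll K C') = Some KProp" by (simp add: A')
  let ?S = "Inl -` dom \<xi> \<union> m_ftv N \<union> ty_ftv C' \<union> \<Union>(ty_ftv ` ran \<Gamma>)"
  have "finite ?S" using fin \<Gamma> unfolding wf_env_def
    by (auto simp: finite_vimageI finite_m_ftv finite_ran)
  from ex_new_if_finite[OF inf this] obtain a where a: "Inl a \<notin> dom \<xi>" "a \<notin> m_ftv N" "a \<notin> ty_ftv C'"
    "\<And>x B. \<Gamma> x = Some B \<Longrightarrow> a \<notin> ty_ftv B" by (auto simp: ran_def)
  \<comment> \<open>Besides the exceptions of the test, \<open>e\<close> must avoid the image of
    \<open>r\<close>, so that the extended renaming stays injective.\<close>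
  have "finite (L \<union> LX -` r ` {l. kind_env \<xi> l \<noteq> None})"
    using V_All(2) finite_kind_env[OF fin] by (auto intro!: finite_vimageI simp: inj_on_def)
  from E_fresh[OF this, of K] obtain e where e: "e \<in> E K - L" "LX e \<notin> r ` {l. kind_env \<xi> l \<noteq> None}"
      by blast
  have ke: "\<Xi> (Inr e) = K" using e(1) E_kind by blast
  define \<xi>' where "\<xi>' = \<xi>(Inl a \<mapsto> K)"
  define r' where "r' = r(LV a := LX e)"
  define \<phi>' where "\<phi>' = (\<lambda>l. leaf_ty (r' l) :: ('k, 'a, 'e) ty)"
  have \<phi>': "\<phi>' = \<phi>(LV a := EVar e)" by (auto simp: \<phi>'_def r'_def \<phi>_def)
  have dom: "kind_env \<xi>' l = (if l = LV a then Some K else kind_env \<xi> l)" for l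
      by (cases l) (auto simp: \<xi>'_def)
  have a_dom: "kind_env \<xi> (LV a) = None" using a(1) by (auto simp: dom_def)
  \<comment> \<open>\<open>Y e\<close> has a point; it carries a type of kind \<open>J\<close> that
    has the kind of \<open>EVar e\<close>, which is \<open>K\<close>.\<close>
  have "J = K" and Y: "Y e \<subseteq> den N (genv \<Gamma> \<phi>) \<beta> (push (EVar e) \<phi>)"
  proof -
    have *: "J = K \<and> \<tau> \<in> den N (genv \<Gamma> \<phi>) \<beta> (push (EVar e) \<phi>)" if "\<tau> \<in> Y e" for \<tau>
    proof -
      from that V_All(4)[OF e(1)] obtain B
          where B: "joinable B (EVar e)" "gkind B = gkind (EVar e)" "gkind B = Some J"
        "\<tau> \<in> den N (genv \<Gamma> \<phi>) \<beta> (push B \<phi>)" by (auto simp: tapp_def)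
      then show ?thesis using den_push_joinable[OF B(1,2), of N "genv \<Gamma> \<phi>" \<beta> \<phi>] ke by auto
    qed
    from * V_nonempty[OF V_All(3)[OF e(1)]] show "J = K" by blast
    from * show "Y e \<subseteq> den N (genv \<Gamma> \<phi>) \<beta> (push (EVar e) \<phi>)" by blast
  qed
  have \<Gamma>C: "kind_of (kind_env \<xi>) B = Some KProp" if "\<Gamma> x = Some B" for x B using wf_env_gwf[OF \<Gamma> that] .
  have "ty_sub \<phi>' B = ty_sub \<phi> B" if "\<Gamma> x = Some B" for x B
    by (rule ty_sub_agree[OF kind_of_ty_within[OF \<Gamma>C[OF that]]]) (use a_dom in \<open>auto simp: \<phi>'\<close>)
  then have genv: "genv \<Gamma> \<phi>' = genv \<Gamma> \<phi>" by (auto simp: genv_def fun_eq_iff split: option.split)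
  have fin': "finite (dom \<xi>')" using fin by (simp add: \<xi>'_def)
  have "kind_of (kind_env \<xi>') B = Some KProp" if "\<Gamma> x = Some B" for x B
    by (rule kind_of_mono[OF \<Gamma>C[OF that]]) (use a_dom in \<open>auto simp: dom\<close>)
  then have "wf_env \<xi>' \<Gamma>" using \<Gamma> kind_of_kinding[OF inf fin'] unfolding wf_env_def by blast
  moreover have "renaming \<xi>' r'"
  proof -
    let ?D = "{l. kind_env \<xi> l \<noteq> None}"
    have D: "{l. kind_env \<xi>' l \<noteq> None} = insert (LV a) ?D" by (auto simp: dom)
    have "r' ` (?D - {LV a}) \<subseteq> r ` ?D" by (auto simp: r'_def)
    moreover have "inj_on r' ?D" unfolding r'_def using r e(2)
      by (intro inj_on_fun_updI) (simp_all add: renaming_def)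
    ultimately have "inj_on r' (insert (LV a) ?D)" using e(2) unfolding inj_on_insert
      by (auto simp: r'_def)
    then show ?thesis using r ke unfolding renaming_def D by (auto simp: dom r'_def)
  qed
  moreover have "m_within (\<lambda>l. kind_env \<xi>' l \<noteq> None) (\<lambda>_. False) (m_topen 0 (TVar a) N)"
  proof -
    have *: "((\<lambda>l. kind_env \<xi>' l \<noteq> None)(LB 0 := ty_within (\<lambda>l. kind_env \<xi>' l \<noteq> None) (TVar a))) l"
      if "push True (\<lambda>l. kind_env \<xi> l \<noteq> None) l" for l
      using that by (cases l rule: leaf_cases) (auto simp: dom)
    have "m_within (push True (\<lambda>l. kind_env \<xi> l \<noteq> None)) (\<lambda>_. False) N" using rd
        unfolding readable_def by simp
    then show ?thesis unfolding m_within_topen[OF closed_TVar] by (rule m_within_mono) (rule *)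
  qed
  ultimately have rd': "readable \<xi>' r' \<Gamma> (m_topen 0 (TVar a) N)"
    using rd fin' unfolding readable_def by (simp add: pure_topen beta_normal_topen)
  have open_eq: "ty_open 0 (TVar a) C' = inst (TVar a) C'"
    by (rule ty_open_inst)
        (use kind_of_kind_env_closed[OF kAll] in \<open>auto simp: ty_lc_closed[symmetric]\<close>)
  have "ty_sub \<phi>' (inst (TVar a) C') = ty_sub (push (EVar e) \<phi>') C'" by (simp add: ty_sub_inst \<phi>')
  also have "\<dots> = ty_sub (push (EVar e) \<phi>) C'"
  proof (rule ty_sub_agree[OF ty_within_ftv[OF kind_of_ty_within[OF A'(3)] a(3)]])
    fix l assume "push (Some K) (kind_env \<xi>) l \<noteq> None \<and> l \<noteq> LV a"
    then show "push (EVar e) \<phi>' l = push (EVar e) \<phi> l" by (cases l rule: leaf_cases) (auto simp: \<phi>')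
  qed
  also have "\<dots> = inst (EVar e) C" unfolding A'(2) inst_up ..
  finally have C: "ty_sub \<phi>' (ty_open 0 (TVar a) C') = inst (EVar e) C" unfolding open_eq .
  have "typing \<xi>' \<Gamma> (m_topen 0 (TVar a) N) (ty_open 0 (TVar a) C')"
  proof (rule IH[OF rd'])
    show "kind_of (kind_env \<xi>') (ty_open 0 (TVar a) C') = Some KProp"
      unfolding \<xi>'_def kind_of_open_fresh[OF a(3)] by (rule A')
    have "V (inst (EVar e) C) (den N (genv \<Gamma> \<phi>) \<beta> (push (EVar e) \<phi>))"
      by (rule V_mono[OF V_All(3)[OF e(1)] Y])
    then have "V (ty_sub \<phi>' (ty_open 0 (TVar a) C')) (den (m_topen 0 (TVar a) N) (genv \<Gamma> \<phi>') \<beta> \<phi>')"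
      unfolding C genv unfolding \<phi>' den_LamT_open[OF readable_mclosed[OF rd] a(2)] .
    then show "V (ty_sub (\<lambda>l. leaf_ty (r' l)) (ty_open 0 (TVar a) C'))
      (den (m_topen 0 (TVar a) N) (genv \<Gamma> (\<lambda>l. leaf_ty (r' l))) \<beta> (\<lambda>l. leaf_ty
          (r' l)))" unfolding \<phi>'_def .
  qed
  then have "typing \<xi> \<Gamma> (LamT J N) (TAll K C')" unfolding \<xi>'_def \<open>J = K\<close>
    by (rule typing.LamT[OF a(1-3), rotated]) (rule a(4))
  then show ?thesis by (rule typing_joinable[OF inf fin _ joinable_sym[OF pars_joinable[OF A'(1)]]
      kAll A(1)])
qed

text \<open>The induction is on size because binders are entered through opened bodies.
  \<open>\<xi>\<close>, \<open>r\<close> and \<open>\<Gamma>\<close> vary, as each binder extends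
  some of them.\<close>

lemma readback:
  fixes N :: "('k, 'a, 'e, 'x) mterm"
  assumes inf: "infinite (UNIV :: 'a set)" "infinite (UNIV :: 'x set)"
  shows "readable \<xi> r \<Gamma> N \<Longrightarrow> kind_of (kind_env \<xi>) A = Some KProp \<Longrightarrow>
    V (ty_sub (\<lambda>l. leaf_ty (r l)) A) (den N (genv \<Gamma> (\<lambda>l. leaf_ty (r l))) \<beta> (\<lambda>l. leaf_ty
        (r l))) \<Longrightarrow> typing \<xi> \<Gamma> N A"
proof (induction N arbitrary: \<xi> r \<Gamma> A rule: measure_induct_rule[of size])
  case (less N)
  \<comment> \<open>Types are inferred along the spine: the inner induction handles the head, and
    arguments are strictly smaller than \<open>N\<close>, so the outer hypothesis checks them.
    Nonemptiness passes from an application to its head.\<close>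
  have neutral: "\<exists>D. kind_of (kind_env \<xi>) D = Some KProp \<and> typing \<xi> \<Gamma> P D \<and>
      den P (genv \<Gamma> (\<lambda>l. leaf_ty (r l))) \<beta> (\<lambda>l. leaf_ty (r l)) \<subseteq> {\<tau>. G (ty_sub (\<lambda>l. leaf_ty
          (r l)) D) \<tau>}"
    if "size P \<le> size N" "readable \<xi> r \<Gamma> P"
        "den P (genv \<Gamma> (\<lambda>l. leaf_ty (r l))) \<beta> (\<lambda>l. leaf_ty (r l)) \<noteq> {}"
      "\<nexists>Q. P = Lam Q" "\<nexists>K Q. P = LamT K Q" for P
    using that
  proof (induction P)
    case (Var x)
    then obtain C where C: "\<Gamma> x = Some C" by (auto simp: genv_def split: option.splits)
    then show ?case using Var wf_env_gwf[of \<xi> \<Gamma>] unfolding readable_def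
      by (intro exI[of _ C]) (auto simp: genv_def intro: typing.Var)
  next
    case (App P Q)
    have rd: "readable \<xi> r \<Gamma> P" "readable \<xi> r \<Gamma> Q" using App.prems(2) unfolding readable_def by auto
    have "\<nexists>R. P = Lam R" using App.prems(2) unfolding readable_def by auto
    moreover have "\<nexists>K R. P = LamT K R" using App.prems(3) by (auto simp: fapp_def)
    moreover have "den P (genv \<Gamma> (\<lambda>l. leaf_ty (r l))) \<beta> (\<lambda>l. leaf_ty (r l)) \<noteq> {}" using App.prems(3)
        by (auto simp: fapp_def)
    ultimately have 1: "\<exists>D. kind_of (kind_env \<xi>) D = Some KProp \<and> typing \<xi> \<Gamma> P D \<and>
      den P (genv \<Gamma> (\<lambda>l. leaf_ty (r l))) \<beta> (\<lambda>l. leaf_ty (r l)) \<subseteq> {\<tau>. G (ty_sub (\<lambda>l. leaf_ty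
          (r l)) D) \<tau>}"
      using App.IH(1) rd(1) App.prems(1) by simp
    have "size Q < size N" using App.prems(1) by simp
    from less.IH[OF this rd(2)] show ?case by (rule read_App[OF inf(1) App.prems(2) 1 _ App.prems(3)])
  next
    case (AppT P B)
    have rd: "readable \<xi> r \<Gamma> P" using AppT.prems(2) unfolding readable_def by auto
    have "\<nexists>K R. P = LamT K R" using AppT.prems(2) unfolding readable_def by auto
    moreover have "\<nexists>R. P = Lam R" using AppT.prems(3) by (auto simp: tapp_def)
    moreover have "den P (genv \<Gamma> (\<lambda>l. leaf_ty (r l))) \<beta> (\<lambda>l. leaf_ty (r l)) \<noteq> {}" using AppT.prems(3)
        by (auto simp: tapp_def)
    ultimately have 1: "\<exists>D. kind_of (kind_env \<xi>) D = Some KProp \<and> typing \<xi> \<Gamma> P D \<and>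
      den P (genv \<Gamma> (\<lambda>l. leaf_ty (r l))) \<beta> (\<lambda>l. leaf_ty (r l)) \<subseteq> {\<tau>. G (ty_sub (\<lambda>l. leaf_ty
          (r l)) D) \<tau>}"
      using AppT.IH rd AppT.prems(1) by simp
    show ?case by (rule read_AppT[OF inf(1) AppT.prems(2) 1 AppT.prems(3)])
  qed (auto simp: readable_def)
  show ?case
  proof (cases "(\<exists>Q. N = Lam Q) \<or> (\<exists>K Q. N = LamT K Q)")
    case False
    then show ?thesis
      by (intro read_neutral[OF inf(1) less.prems(1) _ less.prems(2,3)] neutral)
          (use less.prems in auto)
  next
    case True
    then show ?thesis
    proof (elim disjE exE)
      fix Q assume N: "N = Lam Q"
      show ?thesis unfolding N
      proof (rule read_Lam[OF inf less.prems(1)[unfolded N] _ less.prems(2) less.prems(3)[unfolded N]])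
        fix x \<Gamma>' B
        have "size (m_open 0 (Var x) Q) < size N" by (simp add: N size_m_open_Var)
        from less.IH[OF this, of \<xi> r \<Gamma>' B] show
            "readable \<xi> r \<Gamma>' (m_open 0 (Var x) Q) \<Longrightarrow> kind_of (kind_env \<xi>) B = Some KProp \<Longrightarrow>
          V (ty_sub (\<lambda>l. leaf_ty (r l)) B) (den (m_open 0 (Var x) Q) (genv \<Gamma>' (\<lambda>l. leaf_ty (r l))) \<beta>
              (\<lambda>l. leaf_ty (r l))) \<Longrightarrow>
          typing \<xi> \<Gamma>' (m_open 0 (Var x) Q) B" .
      qed
    next
      fix K Q assume N: "N = LamT K Q"
      show ?thesis unfolding N
      proof (rule read_LamT[OF inf(1) less.prems(1)[unfolded N] _ less.prems(2) less.prems(3)[unfolded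
          N]])
        fix a \<xi>' r' B
        have "size (m_topen 0 (TVar a) Q) < size N" by (simp add: N size_m_topen)
        from less.IH[OF this, of \<xi>' r' \<Gamma> B] show
            "readable \<xi>' r' \<Gamma> (m_topen 0 (TVar a) Q) \<Longrightarrow> kind_of (kind_env \<xi>') B = Some KProp \<Longrightarrow>
          V (ty_sub (\<lambda>l. leaf_ty (r' l)) B) (den (m_topen 0 (TVar a) Q) (genv \<Gamma> (\<lambda>l. leaf_ty
              (r' l))) \<beta> (\<lambda>l. leaf_ty (r' l))) \<Longrightarrow>
          typing \<xi>' \<Gamma> (m_topen 0 (TVar a) Q) B" .
      qed
    qed
  qed
qed

end

theorem theorem5p3:
  fixes \<Xi> :: "'a + 'e \<Rightarrow> 'k kind"
    and A :: "('k, 'a, 'e) ty"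
    and M :: "('k, 'a, 'e, 'x) mterm"
    and \<Gamma> :: "'x \<rightharpoonup> ('k, 'a, 'e) ty"
  assumes "kind_assignment \<Xi>"
    and "infinite (UNIV :: 'x set)"
    and "gkinding \<Xi> A KProp"
    and "wk \<Xi> M"
    and "gwf_env \<Xi> \<Gamma>"
    and "reds \<Xi> (Ver A (env_subst \<Gamma> M)) Star"
    and "good \<Xi> M"
  shows "\<forall>N. beta_nf_of \<Xi> M N \<longrightarrow> pure N \<and> gtyping \<Xi> \<Gamma> N A"
proof (intro allI impI)
  fix N assume "beta_nf_of \<Xi> M N"
  then obtain N' where N': "(ctxt_closure \<Xi> root_beta)\<^sup>*\<^sup>* M N'"
    "\<nexists>P. ctxt_closure \<Xi> root_beta N' P" "N' = N \<or> meta_eq \<Xi> N' N"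
    unfolding beta_nf_of_def by blast
  \<comment> \<open>The sample for each kind is a countably infinite part of its eigenvariables, of
    which there may be uncountably many.\<close>
  have "\<exists>C. C \<subseteq> {e. \<Xi> (Inr e) = K} \<and> infinite C \<and> countable C" for K
    using infinite_countable_subset'[of "{e. \<Xi> (Inr e) = K}"] assms(1) unfolding kind_assignment_def
        by blast
  then obtain E where E: "\<And>K. E K \<subseteq> {e. \<Xi> (Inr e) = K}" "\<And>K. infinite (E K)" "\<And>K. countable (E K)"
    by metis
  interpret model \<Xi> E by unfold_locales (use E in blast)+
  have inf: "infinite (UNIV :: 'a set)"
  proof
    assume "finite (UNIV :: 'a set)"
    then have "finite {a. \<Xi> (Inl a) = KProp}" by (rule finite_subset[rotated]) simp
    then show False using assms(1) unfolding kind_assignment_def by blast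
  qed
  have adm: "admissible leaf_ty" unfolding admissible_def by simp
  define \<beta> :: "nat \<Rightarrow> ('k, 'a, 'e) point set" where "\<beta> = (\<lambda>_. {})"
  have \<Gamma>: "gkind C = Some KProp" if "\<Gamma> x = Some C" for x C
    using assms(5) that gkinding_kind_of unfolding gwf_env_def by blast
  \<comment> \<open>The point of \<star> is carried back along the whole reduction; reading off the
    clauses for \<open>Ver\<close> and \<Gamma> leaves a successful test on
    \<open>M\<close>.\<close>
  have "PStar \<in> den (Ver A (env_subst \<Gamma> M)) (\<lambda>_. {}) \<beta> leaf_ty" by (rule reds_Star_den[OF assms(6) adm])
  then have V: "V A (den M (genv \<Gamma> leaf_ty) \<beta> leaf_ty)"
      using den_env_subst[of \<Gamma> M \<beta> leaf_ty, OF kind_of_kind_env_closed[OF \<Gamma>]] by simp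
  have *: "mclosed N' \<and> pure N' \<and> den M (genv \<Gamma> leaf_ty) \<beta> leaf_ty \<subseteq> den N' (genv \<Gamma> leaf_ty) \<beta> leaf_ty"
    using N'(1)
  proof (induction rule: rtranclp_induct)
    case base
    then show ?case using wk_mclosed[OF assms(4)] assms(7) unfolding good_def by blast
  next
    case (step P Q)
    have "mclosed Q" using ctxt_beta_mclosed step by blast
    moreover have "den P (genv \<Gamma> leaf_ty) \<beta> leaf_ty \<subseteq> den Q (genv \<Gamma> leaf_ty) \<beta> leaf_ty"
    \<comment> \<open>Read backwards, the \<beta>-step becomes a step of the converse relation, so
      points move forward from \<open>P\<close> to \<open>Q\<close>.\<close>
    proof (rule ctxt_closure_den[OF _ ctxt_closure_converse[OF step(2)] \<open>mclosed Q\<close> _ adm])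
      show "mclosed P" using step by blast
    qed (rule root_beta_den)
    ultimately show ?case using ctxt_beta_pure step by blast
  qed
  then have beta_normal: "beta_normal N'" using not_beta_normal_reducible[OF assms(1,2)] N'(2) by blast
  \<comment> \<open>\<open>beta_nf_of\<close> permits a final conversion of types, which preserves
    closedness, purity, normality and denotation.\<close>
  have N: "mclosed N" "pure N" "beta_normal N" "V A (den N (genv \<Gamma> leaf_ty) \<beta> leaf_ty)"
  proof -
    have "mclosed N \<and> pure N \<and> beta_normal N \<and>
        den N' (genv \<Gamma> leaf_ty) \<beta> leaf_ty = den N (genv \<Gamma> leaf_ty) \<beta> leaf_ty"
      using N'(3)
    proof
      assume eq: "meta_eq \<Xi> N' N"
      then have "m_conv N' N" unfolding meta_eq_def by blast
      with * beta_normal meta_eq_den[OF eq adm] show ?thesis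
        using m_conv_mclosed m_conv_pure m_conv_beta_normal by blast
    qed (use * beta_normal in auto)
    with * V_mono[OF V] show "mclosed N" "pure N" "beta_normal N"
        "V A (den N (genv \<Gamma> leaf_ty) \<beta> leaf_ty)" by auto
  qed
  \<comment> \<open>Typing needs a finite kind-environment, so \<Xi> is cut down to the free names
    of the goal type, the normal form and the environment.\<close>
  define F where "F = Inl ` (ty_ftv A \<union> m_ftv N \<union> \<Union>(ty_ftv ` ran \<Gamma>)) \<union>
    Inr ` (ty_fev A \<union> m_fev N \<union> \<Union>(ty_fev ` ran \<Gamma>))"
  define \<xi> where "\<xi> = (\<lambda>v. if v \<in> F then Some (\<Xi> v) else None)"
  have "finite (ran \<Gamma>)" using assms(5) unfolding gwf_env_def by (simp add: finite_ran)
  then have "finite F" unfolding F_def by (auto simp: finite_m_ftv finite_m_fev)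
  then have fin: "finite (dom \<xi>)" by (auto simp: \<xi>_def dom_def)
  have kind_of: "kind_of (kind_env \<xi>) B = Some KProp" if "gkind B = Some KProp" "B = A \<or> B \<in> ran \<Gamma>"
      for B
  proof -
    have "kind_of (kind_env \<xi>) B = gkind B"
    proof (rule kind_of_agree[OF ty_within_free[OF kind_of_ty_within[OF that(1)]]])
      fix l
      assume "kind_env (\<lambda>v. Some (\<Xi> v)) l \<noteq> None \<and> (\<forall>a. l = LV a \<longrightarrow> a \<in> ty_ftv B) \<and> (\<forall>e. l = LX e \<longrightarrow>
          e \<in> ty_fev B)"
      then show "kind_env \<xi> l = kind_env (\<lambda>v. Some (\<Xi> v)) l" using that(2)
          by (cases l) (auto simp: \<xi>_def F_def)
    qed
    with that(1) show ?thesis by simp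
  qed
  have A: "gkind A = Some KProp" using assms(3) by (rule gkinding_kind_of)
  have "wf_env \<xi> \<Gamma>" unfolding wf_env_def
  proof (intro conjI allI impI)
    show "finite (dom \<Gamma>)" using assms(5) unfolding gwf_env_def by blast
    fix x C assume "\<Gamma> x = Some C"
    then show "kinding \<xi> C KProp" using kind_of_kinding[OF inf fin kind_of] \<Gamma> by (blast intro: ranI)
  qed
  \<comment> \<open>No binder has been entered yet, so the correspondence between type-variables and
    eigenvariables starts as the identity.\<close>
  moreover have "renaming \<xi> (\<lambda>l. l)"
  proof -
    have "kind_env \<xi> l \<noteq> None \<Longrightarrow> kind_env (\<lambda>v. Some (\<Xi> v)) l = kind_env \<xi> l" for l
      by (cases l) (auto simp: \<xi>_def split: if_splits)
    then show ?thesis unfolding renaming_def by (simp add: inj_on_def)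
  qed
  moreover have "m_within (\<lambda>l. kind_env \<xi> l \<noteq> None) (\<lambda>_. False) N"
  proof (rule m_within_mono[OF m_within_free[OF N(1)[unfolded mclosed_def]]])
    fix l assume "name l \<and> (\<forall>a. l = LV a \<longrightarrow> a \<in> m_ftv N) \<and> (\<forall>e. l = LX e \<longrightarrow> e \<in> m_fev N)"
    then show "kind_env \<xi> l \<noteq> None" by (cases l) (auto simp: \<xi>_def F_def)
  qed
  ultimately have "readable \<xi> (\<lambda>l. l) \<Gamma> N" using fin N unfolding readable_def by blast
  from readback[OF inf assms(2) this kind_of[OF A]] have "typing \<xi> \<Gamma> N A" using N(4) by simp
  moreover have "sub_kenv \<xi> \<Xi>" using fin unfolding sub_kenv_def by (auto simp: \<xi>_def split: if_splits)
  ultimately show "pure N \<and> gtyping \<Xi> \<Gamma> N A" using N(2) unfolding gtyping_def by blast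
qed

end
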